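(* Let $k,l\ge1$, $n=k+l+1$, and let $M$ be the immersion of $S^k\times S^l\times\mathbb{R}$ in $S^{n+1}$ given by $$\varphi(y,z,u)=\left(\sqrt{1-f_1^2(u)-f_2^2(u)}\;y,\;f_2(u)\,z,\;f_1(u)\right),$$ where $y\in S^k$, $z\in S^l$ and $(f_1(u),f_2(u))$ defines an immersion of $S^1$, with $f_1$ and $f_2$ smooth $T$-periodic functions satisfying $f_1'(u)^2+f_2'(u)^2=1$, $f_2(u)>0$ and $f_1(u)^2+f_2(u)^2<1$ for all $u$. Let $\alpha_i=i(k+i-1)$ and $\beta_i=i(l+i-1)$, $i=0,1,2,\dots$, be the eigenvalues of the Laplacian of the unit spheres $S^k$ and $S^l$ respectively. (1) The spectrum of the Laplace operator $\Delta$ on $M$ is the union $\bigcup_{i,j=0}^\infty\Gamma_{ij}$, where $\Gamma_{ij}=\{\lambda_{ij}(1),\lambda_{ij}(2),\dots\}$ is the ordered spectrum of the second order differential operator $$L_{ij}(\eta)=\frac{1}{1+(f')^2}\left(\eta''+\left(k\frac{f'}{f}+l\frac{f_2'}{f_2}-\frac{f'f''}{1+(f')^2}\right)\eta'\right)-\left(\frac{\alpha_i}{f^2}+\frac{\beta_j}{f_2^2}\right)\eta$$ defined on the set of $T$-periodic real functions. (2) The spectrum of the stability operator $J=\Delta+k+l+1+|A|^2$ on $M$ is the union $\bigcup_{i,j=0}^\infty\bar\Gamma_{ij}$, where $\bar\Gamma_{ij}=\{\bar\lambda_{ij}(1),\bar\lambda_{ij}(2),\dots\}$ is the ordered spectrum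 of the second order differential operator $$S_{ij}(\eta)=\frac{1}{1+(f')^2}\left(\eta''+\left(k\frac{f'}{f}+l\frac{f_2'}{f_2}-\frac{f'f''}{1+(f')^2}\right)\eta'\right)-\left(\frac{\alpha_i}{f^2}+\frac{\beta_j}{f_2^2}-n-\left(k\lambda_1^2+l\lambda_{k+1}^2+\lambda_{k+l+1}^2\right)\right)\eta$$ defined on the set of $T$-periodic real functions.
   Context: $S^k\subset\mathbb{R}^{k+1}$ and $S^l\subset\mathbb{R}^{l+1}$ are unit spheres. Functions on $M$ are regarded as functions of $(y,z,u)$, $T$-periodic in $u$ (i.e. functions on the compact manifold $S^k\times S^l\times\mathbb{R}/T\mathbb{Z}$ immersed by $\varphi$), and $\Delta=\operatorname{div}\nabla$ is the Laplace operator of the metric induced by $\varphi$. Sign convention: $\lambda$ is an eigenvalue (belongs to the spectrum) of an operator $P$ (any of $\Delta$, $J$, $\Delta_{S^k}$, $\Delta_{S^l}$, $L_{ij}$, $S_{ij}$) if $P\zeta+\lambda\zeta=0$ for some nonzero $\zeta$ in its domain. $|A|^2$ is the sum of the squares of the principal curvatures of $M$ in $S^{n+1}$, counted with multiplicity. Notation (functions of $u$): $$f=\sqrt{1-f_1^2-f_2^2},\quad g=f_2f_1'-f_1f_2',\quad h=\sqrt{1-g^2},\quad \kappa_1=-\frac{f_1'}{f_2},\quad \kappa_{l+1}=f_2''f_1'-f_1''f_2'.$$ The principal curvatures of $M$ are $$\lambda_1=\dots=\lambda_k=\frac gh,\quad \lambda_{k+1}=\dots=\lambda_{k+l}=\frac{g+\kappa_1}{h},\quad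 \lambda_{k+l+1}=\frac{g+\kappa_{l+1}}{h}-\frac{\kappa_{l+1}(ff')^2}{h^3}.$$ *)

theory Defs
  imports "HOL-Analysis.Analysis"
begin

section \<open>Smooth functions\<close>

fun Ck_on :: "nat \<Rightarrow> ('a::euclidean_space \<Rightarrow> 'b::real_normed_vector) \<Rightarrow> 'a set \<Rightarrow> bool" where
  "Ck_on 0 F U \<longleftrightarrow> continuous_on U F"
| "Ck_on (Suc m) F U \<longleftrightarrow>
     (\<forall>x\<in>U. F differentiable (at x)) \<and>
     (\<forall>v. Ck_on m (\<lambda>x. frechet_derivative F (at x) v) U)"

text \<open>
  A function on a subset \<open>N\<close> of a Euclidean space is smooth if near every point of \<open>N\<close> it is the
  restriction of a \<open>C\<^sup>\<infinity>\<close> function on an open set of the ambient space.  Only the values on \<open>N\<close> matter.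
\<close>

definition smooth_on ::
    "'a::euclidean_space set \<Rightarrow> ('a \<Rightarrow> 'b::real_normed_vector) \<Rightarrow> bool" where
  "smooth_on N F \<longleftrightarrow>
     (\<forall>x\<in>N. \<exists>U G. open U \<and> x \<in> U \<and> (\<forall>m. Ck_on m G U) \<and> (\<forall>q\<in>U \<inter> N. G q = F q))"


section \<open>Riemannian geometry of an immersed manifold\<close>

text \<open>
  Throughout, \<open>N\<close> is a submanifold of a Euclidean space \<open>'a\<close>, and \<open>\<phi> : N \<rightarrow> 'c\<close> is an immersion into a
  Euclidean space, by which \<open>N\<close> gets its Riemannian metric.  Vector fields on \<open>N\<close> are maps
  \<open>X : 'a \<Rightarrow> 'a\<close> with \<open>X p \<in> tangent_space N p\<close> for \<open>p \<in> N\<close>.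
\<close>

definition tangent_space :: "'a::euclidean_space set \<Rightarrow> 'a \<Rightarrow> 'a set" where
  "tangent_space N p =
     {v. \<exists>c :: real \<Rightarrow> 'a. (\<forall>t. c t \<in> N) \<and> c 0 = p \<and> (c has_vector_derivative v) (at 0)}"

text \<open>
  The differential.  The derivative within \<open>N\<close> is not unique as a linear map on the ambient space,
  but its values on \<open>tangent_space N p\<close> are, and it is only ever applied to tangent vectors.
\<close>

definition tdiff ::
    "'a::euclidean_space set \<Rightarrow> ('a \<Rightarrow> 'b::real_normed_vector) \<Rightarrow> 'a \<Rightarrow> 'a \<Rightarrow> 'b" where
  "tdiff N F p v = frechet_derivative F (at p within N) v"

definition induced_metric ::
    "'a::euclidean_space set \<Rightarrow> ('a \<Rightarrow> 'c::euclidean_space) \<Rightarrow> 'a \<Rightarrow> 'a \<Rightarrow> 'a \<Rightarrow> real" where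
  "induced_metric N \<phi> p v w = tdiff N \<phi> p v \<bullet> tdiff N \<phi> p w"

definition gradient ::
    "'a::euclidean_space set \<Rightarrow> ('a \<Rightarrow> 'c::euclidean_space) \<Rightarrow> ('a \<Rightarrow> real) \<Rightarrow> 'a \<Rightarrow> 'a" where
  "gradient N \<phi> \<zeta> p =
     (THE X. X \<in> tangent_space N p \<and>
             (\<forall>v\<in>tangent_space N p. induced_metric N \<phi> p X v = tdiff N \<zeta> p v))"

text \<open>
  The Levi-Civita connection of the induced metric: \<open>\<nabla>\<^sub>v X\<close> is the tangent vector whose image under
  \<open>d\<phi>\<^sub>p\<close> is the orthogonal projection to \<open>d\<phi>\<^sub>p (T\<^sub>p N)\<close> of the ambient derivative of
  \<open>q \<mapsto> d\<phi>\<^sub>q (X q)\<close> in the direction \<open>v\<close>.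
\<close>

definition covariant_derivative ::
    "'a::euclidean_space set \<Rightarrow> ('a \<Rightarrow> 'c::euclidean_space) \<Rightarrow> ('a \<Rightarrow> 'a) \<Rightarrow> 'a \<Rightarrow> 'a \<Rightarrow> 'a" where
  "covariant_derivative N \<phi> X p v =
     (THE W. W \<in> tangent_space N p \<and>
             (\<forall>w\<in>tangent_space N p.
                induced_metric N \<phi> p W w =
                tdiff N (\<lambda>q. tdiff N \<phi> q (X q)) p v \<bullet> tdiff N \<phi> p w))"

definition orthonormal_basis ::
    "'a::euclidean_space set \<Rightarrow> ('a \<Rightarrow> 'c::euclidean_space) \<Rightarrow> 'a \<Rightarrow> 'a set \<Rightarrow> bool" where
  "orthonormal_basis N \<phi> p E \<longleftrightarrow>
     finite E \<and> E \<subseteq> tangent_space N p \<and> span E = tangent_space N p \<and>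
     (\<forall>e\<in>E. \<forall>e'\<in>E. induced_metric N \<phi> p e e' = (if e = e' then 1 else 0))"

text \<open>
  \<open>div X = trace (v \<mapsto> \<nabla>\<^sub>v X)\<close>; the trace does not depend on the orthonormal basis chosen.
\<close>

definition divergence ::
    "'a::euclidean_space set \<Rightarrow> ('a \<Rightarrow> 'c::euclidean_space) \<Rightarrow> ('a \<Rightarrow> 'a) \<Rightarrow> 'a \<Rightarrow> real" where
  "divergence N \<phi> X p =
     (\<Sum>e\<in>(SOME E. orthonormal_basis N \<phi> p E).
        induced_metric N \<phi> p (covariant_derivative N \<phi> X p e) e)"

definition laplacian ::
    "'a::euclidean_space set \<Rightarrow> ('a \<Rightarrow> 'c::euclidean_space) \<Rightarrow> ('a \<Rightarrow> real) \<Rightarrow> 'a \<Rightarrow> real" where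
  "laplacian N \<phi> \<zeta> = divergence N \<phi> (gradient N \<phi> \<zeta>)"


section \<open>Hypersurfaces of the unit sphere\<close>

text \<open>Now \<open>\<phi>\<close> takes values in the unit sphere of \<open>'c\<close> and has codimension one there.\<close>

definition unit_normal_field ::
    "'a::euclidean_space set \<Rightarrow> ('a \<Rightarrow> 'c::euclidean_space) \<Rightarrow> ('a \<Rightarrow> 'c) \<Rightarrow> bool" where
  "unit_normal_field N \<phi> \<nu> \<longleftrightarrow>
     smooth_on N \<nu> \<and>
     (\<forall>p\<in>N. norm (\<nu> p) = 1 \<and> \<nu> p \<bullet> \<phi> p = 0 \<and>
            (\<forall>v\<in>tangent_space N p. \<nu> p \<bullet> tdiff N \<phi> p v = 0))"

text \<open>The shape operator \<open>v \<mapsto> W\<close> with \<open>d\<phi>\<^sub>p W = - D\<^sub>v \<nu>\<close>.\<close>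

definition shape_operator ::
    "'a::euclidean_space set \<Rightarrow> ('a \<Rightarrow> 'c::euclidean_space) \<Rightarrow> ('a \<Rightarrow> 'c) \<Rightarrow> 'a \<Rightarrow> 'a \<Rightarrow> 'a" where
  "shape_operator N \<phi> \<nu> p v =
     (THE W. W \<in> tangent_space N p \<and> tdiff N \<phi> p W = - tdiff N \<nu> p v)"

definition principal_space ::
    "'a::euclidean_space set \<Rightarrow> ('a \<Rightarrow> 'c::euclidean_space) \<Rightarrow> ('a \<Rightarrow> 'c) \<Rightarrow> 'a \<Rightarrow> real \<Rightarrow> 'a set" where
  "principal_space N \<phi> \<nu> p \<mu> =
     {v \<in> tangent_space N p. shape_operator N \<phi> \<nu> p v = \<mu> *\<^sub>R v}"

definition principal_curvatures ::
    "'a::euclidean_space set \<Rightarrow> ('a \<Rightarrow> 'c::euclidean_space) \<Rightarrow> ('a \<Rightarrow> 'c) \<Rightarrow> 'a \<Rightarrow> real set" where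
  "principal_curvatures N \<phi> \<nu> p = {\<mu>. \<exists>v\<in>principal_space N \<phi> \<nu> p \<mu>. v \<noteq> 0}"

text \<open>
  \<open>\<bar>A\<bar>\<^sup>2\<close>: the squares of the principal curvatures, summed with multiplicity.  The unit normal field is
  unique up to a sign that is locally constant on \<open>N\<close>, and the squares do not see this sign.
\<close>

definition sq_norm_A ::
    "'a::euclidean_space set \<Rightarrow> ('a \<Rightarrow> 'c::euclidean_space) \<Rightarrow> 'a \<Rightarrow> real" where
  "sq_norm_A N \<phi> p =
     (let \<nu> = (SOME \<nu>. unit_normal_field N \<phi> \<nu>)
      in \<Sum>\<mu>\<in>principal_curvatures N \<phi> \<nu> p. real (dim (principal_space N \<phi> \<nu> p \<mu>)) * \<mu>\<^sup>2)"


section \<open>Spectra\<close>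

text \<open>
  The eigenvalues of an operator \<open>P\<close> acting on a space \<open>D\<close> of real functions on \<open>N\<close>, with the sign
  convention \<open>P \<zeta> + \<mu> \<zeta> = 0\<close>.  Functions are compared on \<open>N\<close> only.
\<close>

definition spectrum :: "'x set \<Rightarrow> ('x \<Rightarrow> real) set \<Rightarrow> (('x \<Rightarrow> real) \<Rightarrow> 'x \<Rightarrow> real) \<Rightarrow> real set" where
  "spectrum N D P =
     {\<mu>. \<exists>\<zeta>\<in>D. (\<exists>p\<in>N. \<zeta> p \<noteq> 0) \<and> (\<forall>p\<in>N. P \<zeta> p + \<mu> * \<zeta> p = 0)}"

definition periodic_functions :: "real \<Rightarrow> (real \<Rightarrow> real) set" where
  "periodic_functions T = {\<eta>. smooth_on UNIV \<eta> \<and> (\<forall>u. \<eta> (u + T) = \<eta> u)}"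


section \<open>The immersed manifold\<close>

text \<open>
  With \<open>DIM('a) = k + 1\<close> and \<open>DIM('b) = l + 1\<close>, the set \<open>M_dom\<close> is \<open>S\<^sup>k \<times> S\<^sup>l \<times> \<real>\<close>, and the product space
  \<open>'a \<times> 'b \<times> real\<close>, whose inner product is the sum of those of the factors, is the Euclidean space
  of dimension \<open>k + l + 3 = n + 2\<close> that contains \<open>S\<^sup>n\<^sup>+\<^sup>1\<close>.
\<close>

definition M_dom :: "('a::euclidean_space \<times> 'b::euclidean_space \<times> real) set" where
  "M_dom = sphere 0 1 \<times> sphere 0 1 \<times> UNIV"

text \<open>Functions on \<open>S\<^sup>k \<times> S\<^sup>l \<times> \<real>/T\<int>\<close>.\<close>

definition M_functions ::
    "real \<Rightarrow> ('a::euclidean_space \<times> 'b::euclidean_space \<times> real \<Rightarrow> real) set" where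
  "M_functions T =
     {\<zeta>. smooth_on M_dom \<zeta> \<and>
         (\<forall>y\<in>sphere 0 1. \<forall>z\<in>sphere 0 1. \<forall>u. \<zeta> (y, z, u + T) = \<zeta> (y, z, u))}"

definition fun_f :: "(real \<Rightarrow> real) \<Rightarrow> (real \<Rightarrow> real) \<Rightarrow> real \<Rightarrow> real" where
  "fun_f f1 f2 u = sqrt (1 - (f1 u)\<^sup>2 - (f2 u)\<^sup>2)"

definition immersion ::
    "(real \<Rightarrow> real) \<Rightarrow> (real \<Rightarrow> real) \<Rightarrow>
     'a::euclidean_space \<times> 'b::euclidean_space \<times> real \<Rightarrow> 'a \<times> 'b \<times> real" where
  "immersion f1 f2 = (\<lambda>(y, z, u). (fun_f f1 f2 u *\<^sub>R y, f2 u *\<^sub>R z, f1 u))"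

definition stability_operator ::
    "nat \<Rightarrow> nat \<Rightarrow> ('a::euclidean_space \<times> 'b::euclidean_space \<times> real \<Rightarrow> 'c::euclidean_space) \<Rightarrow>
     ('a \<times> 'b \<times> real \<Rightarrow> real) \<Rightarrow> 'a \<times> 'b \<times> real \<Rightarrow> real" where
  "stability_operator k l \<phi> \<zeta> p =
     laplacian M_dom \<phi> \<zeta> p + (real k + real l + 1 + sq_norm_A M_dom \<phi> p) * \<zeta> p"


section \<open>The ordinary differential operators\<close>

definition fun_g :: "(real \<Rightarrow> real) \<Rightarrow> (real \<Rightarrow> real) \<Rightarrow> real \<Rightarrow> real" where
  "fun_g f1 f2 u = f2 u * deriv f1 u - f1 u * deriv f2 u"

definition fun_h :: "(real \<Rightarrow> real) \<Rightarrow> (real \<Rightarrow> real) \<Rightarrow> real \<Rightarrow> real" where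
  "fun_h f1 f2 u = sqrt (1 - (fun_g f1 f2 u)\<^sup>2)"

text \<open>\<open>kappa_a\<close> and \<open>kappa_b\<close> are \<open>\<kappa>\<^sub>1\<close> and \<open>\<kappa>\<^bsub>l+1\<^esub>\<close>.\<close>

definition kappa_a :: "(real \<Rightarrow> real) \<Rightarrow> (real \<Rightarrow> real) \<Rightarrow> real \<Rightarrow> real" where
  "kappa_a f1 f2 u = - deriv f1 u / f2 u"

definition kappa_b :: "(real \<Rightarrow> real) \<Rightarrow> (real \<Rightarrow> real) \<Rightarrow> real \<Rightarrow> real" where
  "kappa_b f1 f2 u = deriv (deriv f2) u * deriv f1 u - deriv (deriv f1) u * deriv f2 u"

text \<open>
  \<open>lambda_a\<close>, \<open>lambda_b\<close>, \<open>lambda_c\<close> are \<open>\<lambda>\<^sub>1\<close>, \<open>\<lambda>\<^bsub>k+1\<^esub>\<close>, \<open>\<lambda>\<^bsub>k+l+1\<^esub>\<close>.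
\<close>

definition lambda_a :: "(real \<Rightarrow> real) \<Rightarrow> (real \<Rightarrow> real) \<Rightarrow> real \<Rightarrow> real" where
  "lambda_a f1 f2 u = fun_g f1 f2 u / fun_h f1 f2 u"

definition lambda_b :: "(real \<Rightarrow> real) \<Rightarrow> (real \<Rightarrow> real) \<Rightarrow> real \<Rightarrow> real" where
  "lambda_b f1 f2 u = (fun_g f1 f2 u + kappa_a f1 f2 u) / fun_h f1 f2 u"

definition lambda_c :: "(real \<Rightarrow> real) \<Rightarrow> (real \<Rightarrow> real) \<Rightarrow> real \<Rightarrow> real" where
  "lambda_c f1 f2 u =
     (fun_g f1 f2 u + kappa_b f1 f2 u) / fun_h f1 f2 u
     - kappa_b f1 f2 u * (fun_f f1 f2 u * deriv (fun_f f1 f2) u)\<^sup>2 / (fun_h f1 f2 u) ^ 3"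

text \<open>The eigenvalue \<open>i (d + i - 1)\<close> of the Laplacian of the unit sphere \<open>S\<^sup>d\<close>.\<close>

definition sphere_eigenvalue :: "nat \<Rightarrow> nat \<Rightarrow> real" where
  "sphere_eigenvalue d i = real i * (real d + real i - 1)"

text \<open>The part that \<open>L\<^sub>i\<^sub>j\<close> and \<open>S\<^sub>i\<^sub>j\<close> have in common.\<close>

definition radial_part ::
    "nat \<Rightarrow> nat \<Rightarrow> (real \<Rightarrow> real) \<Rightarrow> (real \<Rightarrow> real) \<Rightarrow> (real \<Rightarrow> real) \<Rightarrow> real \<Rightarrow> real" where
  "radial_part k l f1 f2 \<eta> u =
     (let f = fun_f f1 f2 in
      1 / (1 + (deriv f u)\<^sup>2) *
      (deriv (deriv \<eta>) u
       + (real k * (deriv f u / f u) + real l * (deriv f2 u / f2 u)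
          - deriv f u * deriv (deriv f) u / (1 + (deriv f u)\<^sup>2)) * deriv \<eta> u))"

definition L_op ::
    "nat \<Rightarrow> nat \<Rightarrow> (real \<Rightarrow> real) \<Rightarrow> (real \<Rightarrow> real) \<Rightarrow> nat \<Rightarrow> nat \<Rightarrow> (real \<Rightarrow> real) \<Rightarrow> real \<Rightarrow> real" where
  "L_op k l f1 f2 i j \<eta> u =
     radial_part k l f1 f2 \<eta> u
     - (sphere_eigenvalue k i / (fun_f f1 f2 u)\<^sup>2 + sphere_eigenvalue l j / (f2 u)\<^sup>2) * \<eta> u"

definition S_op ::
    "nat \<Rightarrow> nat \<Rightarrow> (real \<Rightarrow> real) \<Rightarrow> (real \<Rightarrow> real) \<Rightarrow> nat \<Rightarrow> nat \<Rightarrow> (real \<Rightarrow> real) \<Rightarrow> real \<Rightarrow> real" where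
  "S_op k l f1 f2 i j \<eta> u =
     (let n = k + l + 1 in
      radial_part k l f1 f2 \<eta> u
      - (sphere_eigenvalue k i / (fun_f f1 f2 u)\<^sup>2 + sphere_eigenvalue l j / (f2 u)\<^sup>2 - real n
         - (real k * (lambda_a f1 f2 u)\<^sup>2 + real l * (lambda_b f1 f2 u)\<^sup>2
            + (lambda_c f1 f2 u)\<^sup>2)) * \<eta> u)"

end

theory Submission
  imports Defs "HOL-Computational_Algebra.Polynomial"
begin

text \<open>
  A function on \<open>S\<^sup>k \<times> S\<^sup>l \<times> \<real>\<close> is extended to be homogeneous of degree 0 in both sphere variables. In an
  adapted orthonormal frame the Laplacian of the warped metric \<open>f\<^sup>2 g\<^sub>1 + f\<^sub>2\<^sup>2 g\<^sub>2 + (1 + f'\<^sup>2) du\<^sup>2\<close> then becomes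
  \<open>f\<^sup>-\<^sup>2 \<Delta>\<^sub>x + f\<^sub>2\<^sup>-\<^sup>2 \<Delta>\<^sub>y\<close>, with Euclidean Laplacians, plus an ordinary differential operator in \<open>u\<close>, and
  \<open>\<bar>A\<bar>\<^sup>2\<close> depends on \<open>u\<close> alone.

  Zonal functions \<open>p (v \<bullet> x)\<close> turn the spherical Laplacian into the Gegenbauer operator
  \<open>(1 - t\<^sup>2) p'' - k t p'\<close>. It is triangular on polynomials with the distinct diagonal entries \<open>-\<alpha>\<^sub>i\<close>, so it has an
  eigenpolynomial for each \<open>\<alpha>\<^sub>i\<close>, and every polynomial is a sum of eigenpolynomials. Hence a solution of
  the ordinary equation times two zonal eigenfunctions is an eigenfunction on \<open>M\<close>. Conversely, by Green's
  identity, integrating an eigenfunction on \<open>M\<close> against two zonal eigenfunctions and a radial cutoff gives a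
  solution of the ordinary equation for some \<open>(i, j)\<close>. One of these integrals does not vanish, because powers of
  linear forms generate the exponentials, whose span is dense by the Stone-Weierstrass theorem.
\<close>

section \<open>Calculus of smooth functions\<close>

text \<open>The spectra are sets of eigenvalues, so the converse inclusion concerns one
  eigenfunction at a time: it is enough that one of its components against zonal eigenfunctions is
  nonzero at one \<open>u\<close>. Integration over the spheres is replaced by integration over
  Euclidean space against a radial weight; for functions of degree 0 this differs, by polar
  coordinates, only by a constant factor. The Euclidean Laplacian of a degree 0 function has degree
  -2, so a factor |x|^2 in the weight restores the spherical Laplacian. Since the gradient of a
  degree 0 function is orthogonal to the position vector, a radial weight contributes no extra term
  to Green's identity. Both claims are instances of one statement about the Laplacian plus a
  potential V(u): V = 0, and V = n + |A|^2. A separate obstacle is that gradient, covariant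
  derivative, orthonormal basis, unit normal and the derivative within a set are given by definite
  description or choice; each is first shown to have a unique value, or one that does not depend on
  the choice where it is used, and is then computed in a convenient representative.\<close>

abbreviation dd :: "('a::euclidean_space \<Rightarrow> 'b::real_normed_vector) \<Rightarrow> 'a \<Rightarrow> 'a \<Rightarrow> 'b" where
  "dd F v x \<equiv> frechet_derivative F (at x) v"

lemma has_derivative_dd:
  "F differentiable (at x) \<Longrightarrow> (F has_derivative (\<lambda>v. dd F v x)) (at x)"
  by (simp add: frechet_derivative_works)

lemma dd_eqI: "(F has_derivative F') (at x) \<Longrightarrow> dd F v x = F' v"
  using frechet_derivative_at by metis

lemma has_vector_derivative_line:
  assumes "F differentiable (at (x + t *\<^sub>R v))"
  shows "((\<lambda>s. F (x + s *\<^sub>R v)) has_vector_derivative dd F v (x + t *\<^sub>R v)) (at t)"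
proof -
  have "((\<lambda>s. x + s *\<^sub>R v) has_vector_derivative v) (at t)"
    by (auto intro!: derivative_eq_intros)
  from vector_derivative_diff_chain_within[OF this has_derivative_at_withinI[OF has_derivative_dd[OF assms]]]
  show ?thesis by (simp add: o_def)
qed

lemma has_vector_derivative_line0:
  assumes "F differentiable (at x)"
  shows "((\<lambda>s. F (x + s *\<^sub>R v)) has_vector_derivative dd F v x) (at 0)"
  using has_vector_derivative_line[of F x 0 v] assms by simp

lemma differentiable_cong_open:
  assumes "open U" "x \<in> U" "\<And>y. y \<in> U \<Longrightarrow> F y = G y" "F differentiable (at x)"
  shows "G differentiable (at x)" "dd G v x = dd F v x"
proof -
  have "(G has_derivative (\<lambda>v. dd F v x)) (at x)"
    using has_derivative_transform_within_open[OF has_derivative_dd[OF assms(4)] assms(1,2)] assms(3)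
    by auto
  then show "G differentiable (at x)" "dd G v x = dd F v x"
    by (auto simp: differentiable_def intro: dd_eqI)
qed

lemma Ck_on_cong:
  assumes "open U" "\<And>x. x \<in> U \<Longrightarrow> F x = G x" "Ck_on m F U"
  shows "Ck_on m G U"
  using assms(2,3)
proof (induction m arbitrary: F G)
  case 0
  then show ?case by (metis Ck_on.simps(1) continuous_on_cong)
next
  case (Suc m)
  show ?case
    unfolding Ck_on.simps
  proof (intro conjI ballI allI)
    fix x assume "x \<in> U" then show "G differentiable (at x)"
      using differentiable_cong_open[of U x F G] Suc.prems assms(1) by auto
  next
    fix v show "Ck_on m (\<lambda>x. dd G v x) U"
    proof (rule Suc.IH)
      show "Ck_on m (\<lambda>x. dd F v x) U" using Suc.prems by auto
      show "dd F v x = dd G v x" if "x \<in> U" for x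
        using differentiable_cong_open(2)[of U x F G] Suc.prems assms(1) that by auto
    qed
  qed
qed

lemma Ck_on_SucD: "Ck_on (Suc m) F U \<Longrightarrow> Ck_on m F U"
proof (induction m arbitrary: F)
  case 0
  then show ?case
    by (auto intro!: continuous_at_imp_continuous_on differentiable_imp_continuous_within)
next
  case (Suc m)
  have "Ck_on (Suc m) (dd F v) U" for v using Suc.prems by simp
  then have "Ck_on m (dd F v) U" for v using Suc.IH by blast
  then show ?case using Suc.prems by simp
qed

lemma Ck_on_le: "Ck_on m F U \<Longrightarrow> n \<le> m \<Longrightarrow> Ck_on n F U"
proof (induction m)
  case (Suc m) then show ?case using Ck_on_SucD le_Suc_eq by blast
qed simp

lemma Ck_on_subset: "Ck_on m F U \<Longrightarrow> V \<subseteq> U \<Longrightarrow> Ck_on m F V"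
  by (induction m arbitrary: F) (auto intro: continuous_on_subset)

lemma Ck_on_continuous: "Ck_on m F U \<Longrightarrow> continuous_on U F"
  using Ck_on_le[of m F U 0] by simp

lemma Ck_on_differentiable: "Ck_on (Suc m) F U \<Longrightarrow> x \<in> U \<Longrightarrow> F differentiable (at x)"
  by simp

lemma Ck_on_dd: "Ck_on (Suc m) F U \<Longrightarrow> Ck_on m (dd F v) U"
  by simp

text \<open>\<open>Ck_on\<close> refers to \<open>frechet_derivative\<close>; this rule accepts any
  explicit derivative formula instead, and drives most of the inductions on the order below.\<close>

lemma Ck_on_SucI:
  assumes "open U" and "\<And>x. x \<in> U \<Longrightarrow> (F has_derivative F' x) (at x)"
    and "\<And>v. Ck_on m (\<lambda>x. F' x v) U"
  shows "Ck_on (Suc m) F U"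
  unfolding Ck_on.simps
proof (intro conjI ballI allI)
  show "F differentiable (at x)" if "x \<in> U" for x using assms(2)[OF that] by (auto simp: differentiable_def)
  show "Ck_on m (\<lambda>x. dd F v x) U" for v
    by (rule Ck_on_cong[OF assms(1) _ assms(3)], rule sym, rule dd_eqI, rule assms(2))
qed

text \<open>Smoothness is local: this glues the local representatives that \<open>smooth_on\<close>
  provides.\<close>

lemma Ck_on_local:
  assumes "\<And>x. x \<in> S \<Longrightarrow> \<exists>U. open U \<and> x \<in> U \<and> Ck_on m F U"
  shows "Ck_on m F S"
  using assms
proof (induction m arbitrary: F)
  case 0
  show ?case unfolding Ck_on.simps
  proof (rule continuous_at_imp_continuous_on, rule ballI)
    fix x assume "x \<in> S"
    with 0 obtain U where "open U" "x \<in> U" "continuous_on U F" by auto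
    then show "isCont F x" by (simp add: continuous_on_eq_continuous_at)
  qed
next
  case (Suc m)
  have "Ck_on m (dd F v) S" for v
  proof (rule Suc.IH)
    fix x assume "x \<in> S"
    then obtain U where "open U" "x \<in> U" "Ck_on (Suc m) F U" using Suc.prems by blast
    then show "\<exists>U. open U \<and> x \<in> U \<and> Ck_on m (dd F v) U" by auto
  qed
  moreover have "F differentiable (at x)" if x: "x \<in> S" for x
    using Suc.prems[OF x] by auto
  ultimately show ?case by simp
qed

lemma Ck_on_const: "Ck_on m (\<lambda>x. c) U"
  by (induction m arbitrary: c) auto

lemma Ck_on_bounded_linear: 
  assumes "bounded_linear F" shows "Ck_on m F U"
proof (cases m)
  case 0 then show ?thesis using assms by (simp add: linear_continuous_on)
next
  case (Suc m')
  have *: "frechet_derivative F (at x) = F" for x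
    using assms frechet_derivative_at bounded_linear_imp_has_derivative by metis
  show ?thesis unfolding Suc using assms
    by (auto simp: * Ck_on_const bounded_linear_imp_differentiable)
qed

lemma Ck_on_bounded_linear_compose:
  assumes "bounded_linear L" "open U" shows "Ck_on m F U \<Longrightarrow> Ck_on m (\<lambda>x. L (F x)) U"
proof (induction m arbitrary: F)
  case 0 then show ?case using assms by (auto intro: bounded_linear.continuous_on)
next
  case (Suc m)
  show ?case
  proof (rule Ck_on_SucI[OF assms(2)])
    show "((\<lambda>x. L (F x)) has_derivative (\<lambda>v. L (dd F v x))) (at x)" if "x \<in> U" for x
      using Suc.prems that by (intro bounded_linear.has_derivative[OF assms(1)] has_derivative_dd) simp
    show "Ck_on m (\<lambda>x. L (dd F v x)) U" for v
      using Suc.prems by (intro Suc.IH) simp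
  qed
qed

lemma Ck_on_add:
  assumes "open U" shows "Ck_on m F U \<Longrightarrow> Ck_on m G U \<Longrightarrow> Ck_on m (\<lambda>x. F x + G x) U"
proof (induction m arbitrary: F G)
  case 0 then show ?case by (auto intro: continuous_intros)
next
  case (Suc m)
  show ?case
  proof (rule Ck_on_SucI[OF assms])
    show "((\<lambda>x. F x + G x) has_derivative (\<lambda>v. dd F v x + dd G v x)) (at x)" if "x \<in> U" for x
      using Suc.prems that by (intro has_derivative_add has_derivative_dd) simp_all
    show "Ck_on m (\<lambda>x. dd F v x + dd G v x) U" for v
      using Suc.prems by (intro Suc.IH) simp_all
  qed
qed

lemma Ck_on_sum:
  assumes "open U" "\<And>i. i \<in> I \<Longrightarrow> Ck_on m (F i) U" shows "Ck_on m (\<lambda>x. \<Sum>i\<in>I. F i x) U"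
  using assms(2)
proof (induction I rule: infinite_finite_induct)
  case (insert i I) then show ?case by (simp add: Ck_on_add[OF assms(1)])
qed (auto simp: Ck_on_const)

text \<open>One induction on the Leibniz rule serves scalar multiples, products and inner products
  alike.\<close>

lemma Ck_on_bounded_bilinear:
  assumes "bounded_bilinear pr" "open U"
  shows "Ck_on m F U \<Longrightarrow> Ck_on m G U \<Longrightarrow> Ck_on m (\<lambda>x. pr (F x) (G x)) U"
proof (induction m arbitrary: F G)
  case 0 then show ?case using assms by (auto intro: bounded_bilinear.continuous_on)
next
  case (Suc m)
  show ?case
  proof (rule Ck_on_SucI[OF assms(2)])
    show "((\<lambda>x. pr (F x) (G x)) has_derivative (\<lambda>v. pr (F x) (dd G v x) + pr (dd F v x) (G x))) (at x)"
      if "x \<in> U" for x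
      by (rule bounded_bilinear.FDERIV[OF assms(1)]) (use Suc.prems that in \<open>intro has_derivative_dd; simp\<close>)+
    show "Ck_on m (\<lambda>x. pr (F x) (dd G v x) + pr (dd F v x) (G x)) U" for v
      by (intro Ck_on_add[OF assms(2)] Suc.IH) (use Suc.prems Ck_on_SucD[OF Suc.prems(1)] Ck_on_SucD[OF Suc.prems(2)] in auto)
  qed
qed

lemmas Ck_on_scaleR = Ck_on_bounded_bilinear[OF bounded_bilinear_scaleR]
lemmas Ck_on_mult = Ck_on_bounded_bilinear[OF bounded_bilinear_mult]
lemmas Ck_on_inner = Ck_on_bounded_bilinear[OF bounded_bilinear_inner]

lemma Ck_on_minus: "open U \<Longrightarrow> Ck_on m F U \<Longrightarrow> Ck_on m (\<lambda>x. - F x) U"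
  by (rule Ck_on_bounded_linear_compose[of uminus]) (auto simp: bounded_linear_minus bounded_linear_ident)

lemma Ck_on_diff: "open U \<Longrightarrow> Ck_on m F U \<Longrightarrow> Ck_on m G U \<Longrightarrow> Ck_on m (\<lambda>x. F x - G x) U"
  using Ck_on_add[OF _ _ Ck_on_minus, of U m F G] by simp

lemma Ck_on_Pair:
  assumes "open U" shows "Ck_on m F U \<Longrightarrow> Ck_on m G U \<Longrightarrow> Ck_on m (\<lambda>x. (F x, G x)) U"
proof (induction m arbitrary: F G)
  case 0 then show ?case by (auto intro: continuous_intros)
next
  case (Suc m)
  show ?case
  proof (rule Ck_on_SucI[OF assms])
    show "((\<lambda>x. (F x, G x)) has_derivative (\<lambda>v. (dd F v x, dd G v x))) (at x)" if "x \<in> U" for x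
      using Suc.prems that by (intro has_derivative_Pair has_derivative_dd) simp_all
    show "Ck_on m (\<lambda>x. (dd F v x, dd G v x)) U" for v
      using Suc.prems by (intro Suc.IH) simp_all
  qed
qed

text \<open>The chain rule differentiates the outer function in a direction that varies with the
  point, whereas \<open>Ck_on\<close> speaks of fixed directions. The expansion over the basis
  mediates between the two in \<open>Ck_on_compose\<close>.\<close>

lemma dd_eq_sum_Basis:
  fixes G :: "'a::euclidean_space \<Rightarrow> 'b::real_normed_vector"
  assumes "G differentiable (at x)"
  shows "dd G v x = (\<Sum>b\<in>Basis. (v \<bullet> b) *\<^sub>R dd G b x)"
proof -
  have "linear (\<lambda>v. dd G v x)"
    using has_derivative_dd[OF assms] has_derivative_linear by blast
  from linear_sum[OF this, of "\<lambda>b. (v \<bullet> b) *\<^sub>R b" Basis] linear_cmul[OF this]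
  show ?thesis by (simp add: euclidean_representation)
qed

lemma Ck_on_compose:
  fixes F :: "'a::euclidean_space \<Rightarrow> 'b::euclidean_space" and G :: "'b \<Rightarrow> 'c::real_normed_vector"
  assumes U: "open U" and V: "\<And>x. x \<in> U \<Longrightarrow> F x \<in> V"
  shows "Ck_on m F U \<Longrightarrow> Ck_on m G V \<Longrightarrow> Ck_on m (\<lambda>x. G (F x)) U"
proof (induction m arbitrary: G)
  case 0 then show ?case using V by (auto intro: continuous_on_compose2)
next
  case (Suc m)
  show ?case
  proof (rule Ck_on_SucI[OF U])
    fix x assume x: "x \<in> U"
    have "((\<lambda>x. G (F x)) has_derivative (\<lambda>v. dd G (dd F v x) (F x))) (at x)"
      using diff_chain_at[OF has_derivative_dd has_derivative_dd, of F x G] Suc.prems x V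
      by (auto simp: o_def)
    also have "(\<lambda>v. dd G (dd F v x) (F x)) = (\<lambda>v. \<Sum>b\<in>Basis. (dd F v x \<bullet> b) *\<^sub>R dd G b (F x))"
      by (rule ext, rule dd_eq_sum_Basis) (use Suc.prems x V in auto)
    finally show "((\<lambda>x. G (F x)) has_derivative \<dots>) (at x)" .
  next
    fix v
    show "Ck_on m (\<lambda>x. \<Sum>b\<in>Basis. (dd F v x \<bullet> b) *\<^sub>R dd G b (F x)) U"
      by (intro Ck_on_sum Ck_on_scaleR Ck_on_inner Ck_on_const U Suc.IH)
         (use Suc.prems Ck_on_SucD[OF Suc.prems(1)] in auto)
  qed
qed

lemma Ck_on_inverse: "Ck_on m (inverse :: real \<Rightarrow> real) (- {0})"
proof (induction m)
  case 0 then show ?case by (auto intro!: continuous_intros)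
next
  case (Suc m)
  show ?case
  proof (rule Ck_on_SucI)
    show "(inverse has_derivative (\<lambda>v. - (inverse x * v * inverse x))) (at x)" if "x \<in> - {0}" for x :: real
      using that by (auto intro!: has_derivative_inverse')
    show "Ck_on m (\<lambda>x::real. - (inverse x * v * inverse x)) (- {0})" for v
      by (intro Ck_on_minus Ck_on_mult Ck_on_const Suc) auto
  qed auto
qed

lemma Ck_on_sqrt: "Ck_on m sqrt {0<..}"
proof (induction m)
  case 0 then show ?case by (auto intro!: continuous_intros)
next
  case (Suc m)
  show ?case
  proof (rule Ck_on_SucI)
    \<comment> \<open>In this form the derivative is built from \<open>sqrt\<close> itself and
      \<open>inverse\<close>, so the induction hypothesis applies to it.\<close>
    show "(sqrt has_derivative (\<lambda>v. inverse (sqrt x) * (v / 2))) (at x)" if "x \<in> {0<..}" for x :: real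
    proof -
      have "(*) (inverse (sqrt x) / 2) = (\<lambda>v. inverse (sqrt x) * (v / 2))" by (simp add: fun_eq_iff)
      then show ?thesis using DERIV_real_sqrt[of x] that by (simp add: has_field_derivative_def)
    qed
    show "Ck_on m (\<lambda>x::real. inverse (sqrt x) * (v / 2)) {0<..}" for v
      by (intro Ck_on_mult Ck_on_const Ck_on_compose[OF _ _ Suc Ck_on_inverse]) auto
  qed auto
qed

lemma Ck_on_divide:
  fixes F :: "'a::euclidean_space \<Rightarrow> real"
  assumes "open U" "\<And>x. x \<in> U \<Longrightarrow> G x \<noteq> 0" "Ck_on m F U" "Ck_on m G U"
  shows "Ck_on m (\<lambda>x. F x / G x) U"
  unfolding divide_inverse
  by (intro Ck_on_mult Ck_on_compose[OF _ _ _ Ck_on_inverse]) (use assms in auto)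

lemma Ck_on_power:
  fixes F :: "'a::euclidean_space \<Rightarrow> real"
  assumes "open U" "Ck_on m F U" shows "Ck_on m (\<lambda>x. F x ^ n) U"
  by (induction n) (auto intro!: Ck_on_mult Ck_on_const assms)

lemma Ck_on_fst: "open U \<Longrightarrow> Ck_on m F U \<Longrightarrow> Ck_on m (\<lambda>x. fst (F x)) U"
  by (rule Ck_on_bounded_linear_compose[OF bounded_linear_fst])

lemma Ck_on_snd: "open U \<Longrightarrow> Ck_on m F U \<Longrightarrow> Ck_on m (\<lambda>x. snd (F x)) U"
  by (rule Ck_on_bounded_linear_compose[OF bounded_linear_snd])

lemma Ck_on_ident: "Ck_on m (\<lambda>x. x) U"
  by (rule Ck_on_bounded_linear[OF bounded_linear_ident])

lemma Ck_on_sgn: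
  "Ck_on m (sgn :: 'a::euclidean_space \<Rightarrow> 'a) (- {0})"
  unfolding sgn_div_norm norm_eq_sqrt_inner
  by (intro Ck_on_scaleR Ck_on_ident Ck_on_compose[OF _ _ _ Ck_on_inverse] 
      Ck_on_compose[OF _ _ _ Ck_on_sqrt] Ck_on_inner) auto

lemma Ck_on_poly: "Ck_on m (poly p :: real \<Rightarrow> real) UNIV"
proof (induction m arbitrary: p)
  case 0 then show ?case by (auto intro!: continuous_intros)
next
  case (Suc m)
  show ?case
  proof (rule Ck_on_SucI)
    show "(poly p has_derivative (\<lambda>v. poly (pderiv p) x * v)) (at x)" for x
      using poly_DERIV[of p x] by (simp add: has_field_derivative_def)
    show "Ck_on m (\<lambda>x. poly (pderiv p) x * v) UNIV" for v
      by (intro Ck_on_mult Ck_on_const Suc) auto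
  qed auto
qed

text \<open>\<open>smooth_on\<close> asserts local extensions, which cannot be differentiated
  directly. This form, meant for open \<open>U\<close>, speaks of the function itself and is
  inherited by its derivatives.\<close>

definition Cinf_on :: "('a::euclidean_space \<Rightarrow> 'b::real_normed_vector) \<Rightarrow> 'a set \<Rightarrow> bool" where
  "Cinf_on F U \<longleftrightarrow> (\<forall>m. Ck_on m F U)"

lemma Cinf_onD: "Cinf_on F U \<Longrightarrow> Ck_on m F U"
  by (simp add: Cinf_on_def)

lemma Cinf_on_differentiable: "Cinf_on F U \<Longrightarrow> x \<in> U \<Longrightarrow> F differentiable (at x)"
  using Ck_on_differentiable Cinf_onD by blast

lemma Cinf_on_dd: "Cinf_on F U \<Longrightarrow> Cinf_on (dd F v) U"
  by (metis Cinf_on_def Ck_on_dd)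

lemma Cinf_on_smooth_on: "open U \<Longrightarrow> N \<subseteq> U \<Longrightarrow> Cinf_on F U \<Longrightarrow> smooth_on N F"
  unfolding smooth_on_def Cinf_on_def by blast

lemma smooth_on_UNIV: "smooth_on UNIV F \<longleftrightarrow> Cinf_on F UNIV"
proof
  assume sm: "smooth_on UNIV F"
  show "Cinf_on F UNIV" unfolding Cinf_on_def
  proof (intro allI Ck_on_local)
    fix m x
    obtain U G where "open U" "x \<in> U" "Ck_on m G U" "\<forall>q\<in>U. G q = F q"
      using sm unfolding smooth_on_def by (metis Int_UNIV_right UNIV_I)
    then show "\<exists>U. open U \<and> x \<in> U \<and> Ck_on m F U"
      using Ck_on_cong[of U G F m] by auto
  qed
qed (auto intro: Cinf_on_smooth_on)

lemma dd_real: 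
  fixes F :: "real \<Rightarrow> real"
  assumes "F differentiable (at x)"
  shows "dd F v x = v * deriv F x" "(F has_real_derivative deriv F x) (at x)"
proof -
  show *: "(F has_real_derivative deriv F x) (at x)"
    using assms DERIV_deriv_iff_real_differentiable by blast
  show "dd F v x = v * deriv F x"
    using dd_eqI[OF *[unfolded has_field_derivative_def]] by (simp add: mult.commute)
qed

lemma Cinf_on_deriv:
  fixes F :: "real \<Rightarrow> real"
  assumes "Cinf_on F U" "open U" shows "Cinf_on (deriv F) U"
  unfolding Cinf_on_def
proof
  fix m
  have "Ck_on m (dd F 1) U" using Cinf_on_dd[OF assms(1)] Cinf_onD by blast
  then show "Ck_on m (deriv F) U"
    by (rule Ck_on_cong[OF assms(2), rotated]) 
      (use dd_real(1)[of F] Cinf_on_differentiable[OF assms(1)] in auto)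
qed

lemma Cinf_on_real_derivative:
  fixes F :: "real \<Rightarrow> real"
  assumes "Cinf_on F U" "x \<in> U" shows "(F has_real_derivative deriv F x) (at x)"
  using dd_real(2) Cinf_on_differentiable[OF assms] by blast

section \<open>Zonal functions and the Gegenbauer operator\<close>

definition gegen_op :: "nat \<Rightarrow> real poly \<Rightarrow> real poly" where
  "gegen_op k p = pderiv (pderiv p) - monom 1 2 * pderiv (pderiv p) - smult (real k) (monom 1 1 * pderiv p)"

text \<open>The triangular shape: coefficient \<open>i\<close> of the image involves only
  coefficients \<open>i\<close> and \<open>i + 2\<close>. The diagonal entry collects -i(i - 1) from
  the second order term and -ki from the first order term.\<close>

lemma coeff_gegen_op:
  "coeff (gegen_op k p) i = real ((i + 2) * (i + 1)) * coeff p (i + 2) - sphere_eigenvalue k i * coeff p i"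
proof -
  have "coeff (monom 1 2 * pderiv (pderiv p)) i = real i * (real i - 1) * coeff p i"
  proof (cases "i < 2")
    case True then have "i = 0 \<or> i = 1" by auto
    then show ?thesis by (auto simp: coeff_monom_mult)
  next
    case False 
    then obtain j where "i = j + 2" by (metis add.commute le_Suc_ex not_less)
    then have "coeff (monom 1 2 * pderiv (pderiv p)) i = coeff (pderiv (pderiv p)) j"
      by (simp add: coeff_monom_mult)
    then show ?thesis using \<open>i = j + 2\<close> by (simp add: coeff_pderiv algebra_simps)
  qed
  moreover have "coeff (monom 1 1 * pderiv p) i = real i * coeff p i"
    by (cases i) (auto simp: coeff_monom_mult coeff_pderiv)
  ultimately show ?thesis
    by (simp add: gegen_op_def coeff_pderiv sphere_eigenvalue_def algebra_simps)
qed

lemma gegen_op_add: "gegen_op k (p + q) = gegen_op k p + gegen_op k q"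
  by (rule poly_eqI) (simp add: coeff_gegen_op algebra_simps)

lemma gegen_op_diff: "gegen_op k (p - q) = gegen_op k p - gegen_op k q"
  by (rule poly_eqI) (simp add: coeff_gegen_op algebra_simps)

lemma gegen_op_smult: "gegen_op k (smult c p) = smult c (gegen_op k p)"
  by (rule poly_eqI) (simp add: coeff_gegen_op algebra_simps)

lemma gegen_op_sum: "gegen_op k (\<Sum>i\<in>I. p i) = (\<Sum>i\<in>I. gegen_op k (p i))"
proof (induction I rule: infinite_finite_induct)
  case (insert x F) then show ?case by (simp add: gegen_op_add)
qed (auto simp: gegen_op_def)

text \<open>For \<open>k = 0\<close> the indices 0 and 1 would share the eigenvalue 0. For
  \<open>k \<ge> 1\<close> the eigenvalue gaps are nonzero and can be inverted.\<close>

lemma sphere_eigenvalue_strict_mono: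
  assumes "k \<ge> 1" "i < j" shows "sphere_eigenvalue k i < sphere_eigenvalue k j"
proof -
  have "real i * (real k + real i - 1) < real j * (real k + real j - 1)"
    by (rule mult_strict_mono') (use assms in auto)
  then show ?thesis by (simp add: sphere_eigenvalue_def)
qed

text \<open>A triangular operator with distinct diagonal entries is diagonalized one degree at a
  time: adding the top eigenvalue kills the leading term, the rest is decomposed by induction, and
  division by the eigenvalue gaps leaves a single new eigenpolynomial.\<close>

lemma gegen_decomposition:
  assumes "k \<ge> 1" "degree p \<le> n"
  shows "\<exists>Q. p = (\<Sum>i\<le>n. Q i) \<and>
    (\<forall>i\<le>n. degree (Q i) \<le> i \<and> gegen_op k (Q i) = smult (- sphere_eigenvalue k i) (Q i))"
  using assms(2)
proof (induction n arbitrary: p)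
  case 0
  have "gegen_op k p = 0"
  proof (rule poly_eqI)
    show "coeff (gegen_op k p) i = coeff 0 i" for i
      using 0 by (cases i) (simp_all add: coeff_gegen_op coeff_eq_0 sphere_eigenvalue_def)
  qed
  with 0 show ?case by (intro exI[of _ "\<lambda>_. p"]) (auto simp: sphere_eigenvalue_def)
next
  case (Suc n)
  let ?a = "sphere_eigenvalue k"
  \<comment> \<open>The coefficient of \<open>R\<close> at \<open>Suc n\<close> cancels: the
    diagonal entry there is minus \<open>?a (Suc n)\<close>, and \<open>p\<close> has no coefficient
    of degree \<open>Suc n + 2\<close> that could feed into it.\<close>
  define R where "R = gegen_op k p + smult (?a (Suc n)) p"
  have "degree R \<le> n"
  proof (rule degree_le, intro allI impI)
    fix i assume "n < i"
    then consider "i = Suc n" | "i > Suc n" by linarith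
    then show "coeff R i = 0"
      by cases (use Suc.prems in \<open>auto simp: R_def coeff_gegen_op coeff_eq_0\<close>)
  qed
  then obtain S where S: "R = (\<Sum>i\<le>n. S i)"
    "\<And>i. i \<le> n \<Longrightarrow> degree (S i) \<le> i" "\<And>i. i \<le> n \<Longrightarrow> gegen_op k (S i) = smult (- ?a i) (S i)"
    using Suc.IH by blast
  \<comment> \<open>On the \<open>i\<close>-th component, \<open>gegen_op k\<close> plus
    \<open>?a (Suc n)\<close> is multiplication by the eigenvalue gap. Its inverse
    \<open>c i\<close> therefore makes \<open>W\<close> lie in the kernel of this operator.\<close>
  define c where "c i = 1 / (?a (Suc n) - ?a i)" for i
  define W where "W = p - (\<Sum>i\<le>n. smult (c i) (S i))"
  have c: "c i * (?a (Suc n) - ?a i) = 1" if "i \<le> n" for i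
    using sphere_eigenvalue_strict_mono[OF assms(1), of i "Suc n"] that by (simp add: c_def)
  have "gegen_op k W = R - smult (?a (Suc n)) p - (\<Sum>i\<le>n. smult (c i) (smult (- ?a i) (S i)))"
    by (simp add: W_def gegen_op_diff gegen_op_sum gegen_op_smult R_def S(3))
  also have "R = (\<Sum>i\<le>n. smult (c i * (?a (Suc n) - ?a i)) (S i))"
    by (simp add: c S(1))
  also have "\<dots> - smult (?a (Suc n)) p - (\<Sum>i\<le>n. smult (c i) (smult (- ?a i) (S i))) =
      smult (- ?a (Suc n)) W"
    by (rule poly_eqI)
       (simp add: W_def coeff_sum algebra_simps sum_subtractf sum_negf sum_distrib_left)
  finally have gW: "gegen_op k W = smult (- ?a (Suc n)) W" .
  have dW: "degree W \<le> Suc n"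
  proof -
    have "degree (smult (c i) (S i)) \<le> Suc n" if "i \<le> n" for i
      using S(2)[OF that] that degree_smult_le[of "c i" "S i"] by linarith
    then show ?thesis unfolding W_def
      by (intro degree_diff_le Suc.prems degree_sum_le) auto
  qed
  show ?case
  proof (intro exI[of _ "\<lambda>i. if i = Suc n then W else smult (c i) (S i)"] conjI allI impI)
    show "p = (\<Sum>i\<le>Suc n. if i = Suc n then W else smult (c i) (S i))"
      by (simp add: W_def)
    fix i assume "i \<le> Suc n"
    then show "degree (if i = Suc n then W else smult (c i) (S i)) \<le> i"
      using dW S(2)[of i] degree_smult_le[of "c i" "S i"] by auto
    show "gegen_op k (if i = Suc n then W else smult (c i) (S i)) =
          smult (- sphere_eigenvalue k i) (if i = Suc n then W else smult (c i) (S i))"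
      using gW S(3)[of i] \<open>i \<le> Suc n\<close> by (auto simp: gegen_op_smult mult.commute)
  qed
qed

text \<open>In the decomposition of the monomial of degree \<open>n\<close> only the last component
  has room for that power, so it cannot vanish.\<close>

lemma gegen_exists:
  assumes "k \<ge> 1"
  obtains q where "q \<noteq> 0" "gegen_op k q = smult (- sphere_eigenvalue k n) q"
proof -
  obtain Q where Q: "monom 1 n = (\<Sum>i\<le>n. Q i)"
    and d: "\<And>i. i \<le> n \<Longrightarrow> degree (Q i) \<le> i"
    and g: "\<And>i. i \<le> n \<Longrightarrow> gegen_op k (Q i) = smult (- sphere_eigenvalue k i) (Q i)"
    using gegen_decomposition[OF assms degree_monom_le[of "1::real" n]] by blast
  have "(\<Sum>i<n. coeff (Q i) n) = 0"
  proof (rule sum.neutral, rule ballI, rule coeff_eq_0)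
    show "degree (Q i) < n" if "i \<in> {..<n}" for i using d[of i] that by simp
  qed
  moreover have "coeff (\<Sum>i\<le>n. Q i) n = 1" unfolding Q[symmetric] by simp
  ultimately have "coeff (Q n) n = 1"
    by (simp add: coeff_sum lessThan_Suc_atMost[symmetric])
  then have "Q n \<noteq> 0" by auto
  then show ?thesis using that g by blast
qed

lemma has_derivative_inverse_norm:
  fixes x :: "'a::euclidean_space"
  assumes "x \<noteq> 0"
  shows "((\<lambda>x. inverse (norm x)) has_derivative (\<lambda>h. - (x \<bullet> h) * inverse (norm x) ^ 3)) (at x)"
proof -
  have "((\<lambda>x. inverse (norm x)) has_derivative (\<lambda>h. - (inverse (norm x) * (h \<bullet> sgn x) * inverse (norm x)))) (at x)"
    by (rule Deriv.has_derivative_inverse[OF _ has_derivative_norm[OF assms]]) (use assms in simp)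
  moreover have "- (inverse (norm x) * (h \<bullet> sgn x) * inverse (norm x)) = - (x \<bullet> h) * inverse (norm x) ^ 3" for h
    by (simp add: sgn_div_norm inner_commute power3_eq_cube)
  ultimately show ?thesis by simp
qed

lemma inner_sgn: "v \<bullet> sgn x = (v \<bullet> x) * inverse (norm x)" for v x :: "'a::real_inner"
  by (simp add: sgn_div_norm)

lemma has_derivative_zonal:
  fixes v x :: "'a::euclidean_space"
  assumes "x \<noteq> 0"
  shows "((\<lambda>x. poly p (v \<bullet> sgn x)) has_derivative (\<lambda>w. poly (pderiv p) (v \<bullet> sgn x) *
     ((v \<bullet> w) * inverse (norm x) - (v \<bullet> x) * (x \<bullet> w) * inverse (norm x) ^ 3))) (at x)"
proof -
  have "((\<lambda>x. (v \<bullet> x) * inverse (norm x)) has_derivative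
      (\<lambda>h. (v \<bullet> x) * (- (x \<bullet> h) * inverse (norm x) ^ 3) + (v \<bullet> h) * inverse (norm x))) (at x)"
    by (intro has_derivative_mult has_derivative_inverse_norm[OF assms] has_derivative_inner_right has_derivative_ident)
  then have "((\<lambda>x. v \<bullet> sgn x) has_derivative
      (\<lambda>w. (v \<bullet> w) * inverse (norm x) - (v \<bullet> x) * (x \<bullet> w) * inverse (norm x) ^ 3)) (at x)"
    by (simp add: inner_sgn algebra_simps)
  from has_derivative_compose[OF this poly_DERIV[of p "v \<bullet> sgn x", unfolded has_field_derivative_def]]
  show ?thesis .
qed

text \<open>The sum over the basis sees \<open>v\<close> and \<open>x\<close> only through |v| = 1,
  |x|^2, their inner product and the dimension, so the Laplacian reduces to an operator in the
  single variable t = \<open>v \<bullet> sgn x\<close>, scaled by |x|^-2.\<close>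

lemma laplace_zonal:
  fixes v x :: "'a::euclidean_space"
  assumes dim: "DIM('a) = k + 1" and x: "x \<noteq> 0" and v: "norm v = 1"
  shows "(\<Sum>b\<in>Basis. dd (dd (\<lambda>x. poly p (v \<bullet> sgn x)) b) b x) = poly (gegen_op k p) (v \<bullet> sgn x) / (x \<bullet> x)"
proof -
  define r where "r = inverse (norm x)"
  define s where "s = v \<bullet> x"
  define p1 where "p1 = poly (pderiv p) (v \<bullet> sgn x)"
  define p2 where "p2 = poly (pderiv (pderiv p)) (v \<bullet> sgn x)"
  have *: "dd (dd (\<lambda>x. poly p (v \<bullet> sgn x)) w) w x = 
     p2 * ((v \<bullet> w) * r - s * (x \<bullet> w) * r ^ 3)\<^sup>2 +
     p1 * (- 2 * (v \<bullet> w) * (x \<bullet> w) * r ^ 3 - s * (w \<bullet> w) * r ^ 3 + 3 * s * (x \<bullet> w)\<^sup>2 * r ^ 5)" for w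
  proof -
    let ?G = "\<lambda>x. poly (pderiv p) (v \<bullet> sgn x) *
        ((v \<bullet> w) * inverse (norm x) - (v \<bullet> x) * (x \<bullet> w) * inverse (norm x) ^ 3)"
    have "(?G has_derivative (\<lambda>h. poly (pderiv p) (v \<bullet> sgn x) *
         ((v \<bullet> w) * (- (x \<bullet> h) * inverse (norm x) ^ 3) - 
          ((v \<bullet> x) * (x \<bullet> w) * (real 3 * (- (x \<bullet> h) * inverse (norm x) ^ 3) * inverse (norm x) ^ (3 - 1)) +
           ((v \<bullet> x) * (h \<bullet> w) + (v \<bullet> h) * (x \<bullet> w)) * inverse (norm x) ^ 3)) +
         (poly (pderiv (pderiv p)) (v \<bullet> sgn x) *
          ((v \<bullet> h) * inverse (norm x) - (v \<bullet> x) * (x \<bullet> h) * inverse (norm x) ^ 3)) *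
         ((v \<bullet> w) * inverse (norm x) - (v \<bullet> x) * (x \<bullet> w) * inverse (norm x) ^ 3))) (at x)"
      by (intro has_derivative_mult has_derivative_diff has_derivative_zonal[OF x] has_derivative_power
          has_derivative_mult_right
          has_derivative_inverse_norm[OF x] has_derivative_inner_right has_derivative_inner_left has_derivative_ident)
    then have "(dd (\<lambda>x. poly p (v \<bullet> sgn x)) w has_derivative (\<lambda>h. p1 *
         ((v \<bullet> w) * (- (x \<bullet> h) * r ^ 3) - 
          (s * (x \<bullet> w) * (real 3 * (- (x \<bullet> h) * r ^ 3) * r ^ (3 - 1)) +
           (s * (h \<bullet> w) + (v \<bullet> h) * (x \<bullet> w)) * r ^ 3)) +
         (p2 * ((v \<bullet> h) * r - s * (x \<bullet> h) * r ^ 3)) * ((v \<bullet> w) * r - s * (x \<bullet> w) * r ^ 3))) (at x)"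
      unfolding r_def p1_def p2_def s_def
      by (rule has_derivative_transform_within_open[of _ _ _ UNIV "- {0}"])
         (use x in \<open>auto intro!: dd_eqI[symmetric] has_derivative_zonal\<close>)
    from dd_eqI[OF this, of w] show ?thesis
      by (simp add: power2_eq_square power_numeral_reduce algebra_simps)
  qed
  have sv: "(\<Sum>b\<in>Basis. (v \<bullet> b)\<^sup>2) = 1" 
    using v euclidean_inner[of v v] by (simp add: power2_eq_square norm_eq_1)
  have sx: "(\<Sum>b\<in>Basis. (x \<bullet> b)\<^sup>2) = x \<bullet> x" 
    using euclidean_inner[of x x] by (simp add: power2_eq_square)
  have svx: "(\<Sum>b\<in>Basis. (v \<bullet> b) * (x \<bullet> b)) = s"
    using euclidean_inner[of v x] by (simp add: s_def)
  have sb: "(\<Sum>b\<in>(Basis :: 'a set). b \<bullet> b) = real k + 1"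
    using dim by (simp add: inner_Basis)
  have "(\<Sum>b\<in>Basis. dd (dd (\<lambda>x. poly p (v \<bullet> sgn x)) b) b x) =
    (\<Sum>b\<in>Basis. p2 * r^2 * (v \<bullet> b)\<^sup>2 - 2 * p2 * s * r^4 * ((v \<bullet> b) * (x \<bullet> b)) + p2 * s^2 * r^6 * (x \<bullet> b)\<^sup>2
      - 2 * p1 * r^3 * ((v \<bullet> b) * (x \<bullet> b)) - p1 * s * r^3 * (b \<bullet> b) + 3 * p1 * s * r^5 * (x \<bullet> b)\<^sup>2)"
    unfolding * by (rule sum.cong) (auto simp: power2_eq_square power_numeral_reduce algebra_simps)
  also have "\<dots> = p2 * r^2 - 2 * p2 * s * r^4 * s + p2 * s^2 * r^6 * (x \<bullet> x)
      - 2 * p1 * r^3 * s - p1 * s * r^3 * (real k + 1) + 3 * p1 * s * r^5 * (x \<bullet> x)"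
    by (simp only: sum.distrib sum_subtractf sum_distrib_left[symmetric] sv sx svx sb mult_1_right)
  \<comment> \<open>Once \<open>r^2\<close> cancels \<open>x \<bullet> x\<close>, the coefficients
    of \<open>p1\<close> add up to -2 - (k + 1) + 3 = -k, and those of \<open>p2\<close> to 1 - 2t^2
    + t^2 with t = \<open>s * r\<close>.\<close>
  also have "\<dots> = ((1 - (s * r)\<^sup>2) * p2 - real k * (s * r) * p1) * r^2"
  proof -
    have "r^6 * (x \<bullet> x) = r^4" "r^5 * (x \<bullet> x) = r^3"
      using x by (simp_all add: r_def power2_norm_eq_inner[symmetric] field_simps power_numeral_reduce)
    then have e: "p2 * s^2 * r^6 * (x \<bullet> x) = p2 * s^2 * r^4" "3 * p1 * s * r^5 * (x \<bullet> x) = 3 * p1 * s * r^3"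
      by (simp_all add: mult.assoc)
    show ?thesis unfolding e
      by (simp add: power2_eq_square power_numeral_reduce algebra_simps)
  qed
  also have "\<dots> = poly (gegen_op k p) (v \<bullet> sgn x) / (x \<bullet> x)"
    using x by (simp add: gegen_op_def p1_def p2_def s_def r_def inner_sgn poly_monom dot_square_norm
        divide_inverse power2_eq_square algebra_simps)
  finally show ?thesis .
qed

text \<open>In dimension at least 2 the inner product with \<open>v\<close> takes every value in
  [-1, 1] on the unit sphere, and a nonzero polynomial has only finitely many roots there.\<close>

lemma zonal_nonzero:
  fixes v :: "'a::euclidean_space"
  assumes "DIM('a) \<ge> 2" "norm v = 1" "q \<noteq> 0"
  obtains x :: 'a where "norm x = 1" "poly q (v \<bullet> x) \<noteq> 0"
proof -
  have "infinite {-1..1::real}" by (simp add: infinite_Icc)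
  then obtain t where t: "t \<in> {-1..1}" "poly q t \<noteq> 0"
    using poly_roots_finite[OF assms(3)] by (metis (mono_tags, lifting) finite_subset mem_Collect_eq subsetI)
  obtain w where w: "w \<noteq> 0" "orthogonal v w"
    using orthogonal_to_vector_exists[OF assms(1), of v] by blast
  \<comment> \<open>The unit vector at height \<open>t\<close> over the equator orthogonal to
    \<open>v\<close>.\<close>
  define x where "x = t *\<^sub>R v + sqrt (1 - t\<^sup>2) *\<^sub>R sgn w"
  have t2: "t\<^sup>2 \<le> 1" using t by (simp add: abs_square_le_1 abs_le_iff)
  have vw: "v \<bullet> sgn w = 0" "sgn w \<bullet> v = 0" using w by (simp_all add: orthogonal_def inner_sgn inner_commute[of "sgn w"])
  have vv: "v \<bullet> v = 1" "sgn w \<bullet> sgn w = 1" using assms(2) w by (simp_all add: dot_square_norm norm_sgn)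
  have "x \<bullet> x = 1" 
    using t2 by (simp add: x_def inner_add_left inner_add_right vw vv power2_eq_square[symmetric])
  moreover have "v \<bullet> x = t" by (simp add: x_def inner_add_right vw vv)
  ultimately show ?thesis using that t by (simp add: norm_eq_1)
qed

section \<open>Integration by parts\<close>

lemma integral_compact_support:
  fixes f :: "'a::euclidean_space \<Rightarrow> real"
  assumes "continuous_on UNIV f" "\<And>x. x \<notin> K \<Longrightarrow> f x = 0" "K \<subseteq> cbox a b"
  shows "f integrable_on UNIV" "integral UNIV f = integral (cbox a b) f"
proof -
  have "(f has_integral integral (cbox a b) f) (cbox a b)"
    using assms(1) by (intro integrable_integral integrable_continuous) (auto intro: continuous_on_subset)
  then have "(f has_integral integral (cbox a b) f) UNIV"
    by (rule has_integral_on_superset) (use assms in auto)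
  then show "f integrable_on UNIV" "integral UNIV f = integral (cbox a b) f" by auto
qed

lemma integrable_compact_support:
  fixes f :: "'a::euclidean_space \<Rightarrow> real"
  assumes "continuous_on UNIV f" "\<And>x. x \<notin> K \<Longrightarrow> f x = 0" "compact K"
  shows "f integrable_on UNIV"
proof -
  obtain c where "K \<subseteq> cbox (-c) c" using bounded_subset_cbox_symmetric compact_imp_bounded assms(3) by blast
  then show ?thesis using integral_compact_support(1)[of f K] assms by blast
qed

lemma integral_translate_UNIV:
  fixes f :: "'a::euclidean_space \<Rightarrow> real"
  assumes "continuous_on UNIV f" "\<And>x. x \<notin> K \<Longrightarrow> f x = 0" "compact K"
  shows "integral UNIV (\<lambda>x. f (x + c)) = integral UNIV f"
proof -
  obtain r where "K \<subseteq> cbox (-r) r" using bounded_subset_cbox_symmetric compact_imp_bounded assms(3) by blast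
  moreover from this have "(\<lambda>x. x - c) ` K \<subseteq> cbox (-r - c) (r - c)"
    by (auto simp: mem_box inner_diff_left)
  moreover have "f (x + c) = 0" if "x \<notin> (\<lambda>x. x - c) ` K" for x
    using that by (intro assms(2)) (metis add_diff_cancel_right' rev_image_eqI)
  moreover have "continuous_on UNIV (\<lambda>x. f (x + c))"
    by (rule continuous_on_compose2[OF assms(1)]) (auto intro: continuous_intros)
  ultimately show ?thesis
    using integral_compact_support(2)[of f K] integral_compact_support(2)[of "\<lambda>x. f (x + c)" "(\<lambda>x. x - c) ` K"]
      integral_shift_cbox[of "- r" c r f] assms by simp
qed

text \<open>The integral of the translate of \<open>G\<close> by \<open>t *\<^sub>R b\<close> is
  constant in \<open>t\<close>; its derivative at 0, taken under the integral sign, is the integral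
  in question.\<close>

lemma integral_directional_derivative:
  fixes G :: "'a::euclidean_space \<Rightarrow> real"
  assumes K: "compact K" "\<And>x. x \<notin> K \<Longrightarrow> G x = 0" 
    and G: "\<And>x. G differentiable (at x)" and cont: "continuous_on UNIV (dd G b)"
  shows "integral UNIV (dd G b) = 0"
proof -
  have cG: "continuous_on UNIV G"
    using G by (intro continuous_at_imp_continuous_on ballI differentiable_imp_continuous_within)
  \<comment> \<open>\<open>K\<close> swept out by all translations with parameter in [-1, 1]. A box
    around it contains the supports of all translates near \<open>t = 0\<close>, so one fixed box
    serves for the differentiation under the integral.\<close>
  define K' where "K' = (\<lambda>(x, t). x - t *\<^sub>R b) ` (K \<times> {-1..1::real})"
  have "compact K'" unfolding K'_def
    by (intro compact_continuous_image compact_Times K) (auto intro!: continuous_intros simp: case_prod_beta)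
  then obtain c where c: "K' \<subseteq> cbox (-c) c"
    using bounded_subset_cbox_symmetric compact_imp_bounded by blast
  have KK: "K \<subseteq> K'" unfolding K'_def by (force intro!: image_eqI[of _ _ "(_, 0)"])
  have zero: "G (x + t *\<^sub>R b) = 0" if "x \<notin> K'" "t \<in> {-1..1}" for x t
  proof (rule K(2), rule notI)
    assume "x + t *\<^sub>R b \<in> K"
    then have "x \<in> K'" unfolding K'_def using that(2) by (force intro!: image_eqI[of _ _ "(x + t *\<^sub>R b, t)"])
    with that show False by simp
  qed
  define h where "h t = integral (cbox (-c) c) (\<lambda>x. G (x + t *\<^sub>R b))" for t
  have "(h has_field_derivative integral (cbox (-c) c) (\<lambda>x. dd G b (x + 0 *\<^sub>R b))) (at 0 within UNIV)"
    unfolding h_def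
  proof (rule leibniz_rule_field_derivative)
    show "((\<lambda>t. G (x + t *\<^sub>R b)) has_field_derivative dd G b (x + t *\<^sub>R b)) (at t within UNIV)" for x t
      using has_vector_derivative_line[of G x t b, OF G]
      by (simp add: has_real_derivative_iff_has_vector_derivative)
    show "(\<lambda>x. G (x + t *\<^sub>R b)) integrable_on cbox (-c) c" for t
      by (intro integrable_continuous continuous_on_compose2[OF cG]) (auto intro!: continuous_intros)
    show "continuous_on (UNIV \<times> cbox (-c) c) (\<lambda>(t, x). dd G b (x + t *\<^sub>R b))"
      unfolding case_prod_beta
      by (rule continuous_on_compose2[OF cont]) (auto intro!: continuous_intros)
  qed auto
  then have "(h has_real_derivative integral (cbox (-c) c) (dd G b)) (at 0)" by simp
  moreover have "(h has_real_derivative 0) (at 0)"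
  proof (rule has_field_derivative_transform_within_open[of "\<lambda>_. integral UNIV G"])
    fix t :: real assume t: "t \<in> {-1<..<1}"
    have "continuous_on UNIV (\<lambda>x. G (x + t *\<^sub>R b))"
      by (rule continuous_on_compose2[OF cG]) (auto intro: continuous_intros)
    then have "h t = integral UNIV (\<lambda>x. G (x + t *\<^sub>R b))"
      unfolding h_def using integral_compact_support(2)[of "\<lambda>x. G (x + t *\<^sub>R b)" K', OF _ _ c] zero t by simp
    then show "integral UNIV G = h t"
      using integral_translate_UNIV[OF cG K(2) K(1)] by simp
  qed (auto intro: derivative_eq_intros)
  ultimately have "integral (cbox (-c) c) (dd G b) = 0" by (rule DERIV_unique)
  moreover have "dd G b x = 0" if "x \<notin> K" for x
  proof -
    have "dd G b x = dd (\<lambda>_. 0) b x"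
      by (rule differentiable_cong_open(2)[of "- K"]) (use K that compact_imp_closed in auto)
    then show ?thesis by simp
  qed
  ultimately show ?thesis 
    using integral_compact_support(2)[OF cont, of K "-c" c] KK c by auto
qed

text \<open>The values of \<open>g\<close> outside \<open>U\<close> may be arbitrary, since
  \<open>h\<close> multiplies them by 0. The two open sets \<open>U\<close> and the complement of
  \<open>K\<close> cover the space, and the product is continuous on each.\<close>

lemma continuous_on_cutoff:
  fixes h :: "'a::topological_space \<Rightarrow> real"
  assumes "open U" "closed K" "K \<subseteq> U" "continuous_on U g" "continuous_on U h" "\<And>x. x \<notin> K \<Longrightarrow> h x = 0"
  shows "continuous_on UNIV (\<lambda>x. g x * h x :: real)"
proof -
  have "continuous_on U (\<lambda>x. g x * h x)" using assms by (intro continuous_intros)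
  moreover have "continuous_on (- K) (\<lambda>x. g x * h x)"
    by (rule continuous_on_eq[of _ "\<lambda>_. 0"]) (use assms(6) in auto)
  ultimately have "continuous_on (U \<union> - K) (\<lambda>x. g x * h x)"
    using assms by (intro continuous_on_open_Un) auto
  moreover have "U \<union> - K = UNIV" using assms(3) by auto
  ultimately show ?thesis by simp
qed

text \<open>The integrated field is F2 grad F1 - F1 grad F2 times \<open>W\<close>. The terms in
  which the weight is differentiated vanish by the two orthogonality hypotheses. \<open>B\<close> is
  any finite set of directions, which allows a Laplacian in only one group of variables.\<close>

lemma Green_identity:
  fixes F1 F2 W :: "'a::euclidean_space \<Rightarrow> real"
  assumes U: "open U" and K: "compact K" "K \<subseteq> U" and W0: "\<And>x. x \<notin> K \<Longrightarrow> W x = 0"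
    and F1: "Ck_on 2 F1 U" and F2: "Ck_on 2 F2 U" and W: "Ck_on 1 W U" and B: "finite B"
    and orth1: "\<And>x. x \<in> U \<Longrightarrow> (\<Sum>b\<in>B. dd F1 b x * dd W b x) = 0"
    and orth2: "\<And>x. x \<in> U \<Longrightarrow> (\<Sum>b\<in>B. dd F2 b x * dd W b x) = 0"
  shows "integral UNIV (\<lambda>x. (\<Sum>b\<in>B. dd (dd F1 b) b x) * F2 x * W x) =
         integral UNIV (\<lambda>x. F1 x * (\<Sum>b\<in>B. dd (dd F2 b) b x) * W x)"
proof -
  note clK = compact_imp_closed[OF K(1)]
  have C1: "Ck_on 1 F U" "\<And>b. Ck_on 1 (dd F b) U" "\<And>b c. continuous_on U (dd (dd F b) c)" 
    if "Ck_on 2 F U" for F :: "'a \<Rightarrow> real"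
    using that Ck_on_SucD[of 1 F U] by (simp_all add: numeral_2_eq_2)
  have diff: "F differentiable (at x)" if "Ck_on 1 F U" "x \<in> U" for F :: "'a \<Rightarrow> real" and x
    using that by simp
  define G where "G b x = (dd F1 b x * F2 x - F1 x * dd F2 b x) * W x" for b x
  have CG: "Ck_on 1 (G b) U" for b
    unfolding G_def by (intro Ck_on_mult Ck_on_diff U C1 F1 F2 W)
  have G0: "G b x = 0" if "x \<notin> K" for b x using W0[OF that] by (simp add: G_def)
  have GK: "G b differentiable (at x)" "dd (G b) b x = 0" if "x \<notin> K" for b x
    using differentiable_cong_open[of "- K" x "\<lambda>_. 0" "G b"] clK that G0 by auto
  have Gd: "G b differentiable (at x)" for b x
    using GK diff[OF CG] K(2) by blast
  have cont: "continuous_on UNIV (dd (G b) b)" for b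
  proof -
    have "continuous_on U (dd (G b) b)" using CG[of b] by simp
    moreover have "continuous_on (- K) (dd (G b) b)"
      by (rule continuous_on_eq[of _ "\<lambda>_. 0"]) (use GK in auto)
    ultimately have "continuous_on (U \<union> - K) (dd (G b) b)"
      using U clK by (intro continuous_on_open_Un) auto
    moreover have "U \<union> - K = UNIV" using K(2) by auto
    ultimately show ?thesis by simp
  qed
  have int: "(dd (G b) b has_integral 0) UNIV" for b
    using integral_directional_derivative[OF K(1) G0 Gd cont]
      integrable_compact_support[OF cont _ K(1)] GK(2) by (metis integrable_integral)
  have "((\<lambda>x. \<Sum>b\<in>B. dd (G b) b x) has_integral (\<Sum>b\<in>B. 0)) UNIV"
    by (intro has_integral_sum B int)
  moreover have "(\<Sum>b\<in>B. dd (G b) b x) = 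
      (\<Sum>b\<in>B. dd (dd F1 b) b x) * F2 x * W x - F1 x * (\<Sum>b\<in>B. dd (dd F2 b) b x) * W x" for x
  proof (cases "x \<in> U")
    case False
    then have "x \<notin> K" using K(2) by auto
    then show ?thesis using W0 GK(2) by simp
  next
    case x: True
    \<comment> \<open>The products of first derivatives of \<open>F1\<close> and \<open>F2\<close>
      occur twice with opposite signs.\<close>
    have "dd (G b) b x = (dd F1 b x * F2 x - F1 x * dd F2 b x) * dd W b x +
        ((dd F1 b x * dd F2 b x + dd (dd F1 b) b x * F2 x) - (F1 x * dd (dd F2 b) b x + dd F1 b x * dd F2 b x)) * W x" for b
      unfolding G_def
      by (rule dd_eqI, intro has_derivative_mult has_derivative_diff has_derivative_dd diff[OF _ x] C1 F1 F2 W)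
    then have "dd (G b) b x = F2 x * (dd F1 b x * dd W b x) - F1 x * (dd F2 b x * dd W b x) +
      dd (dd F1 b) b x * (F2 x * W x) - F1 x * W x * dd (dd F2 b) b x" for b
      by (simp add: algebra_simps)
    then show ?thesis
      by (simp add: sum.distrib sum_subtractf sum_distrib_left[symmetric] sum_distrib_right[symmetric] orth1[OF x] orth2[OF x])
  qed
  ultimately have I0: "((\<lambda>x. (\<Sum>b\<in>B. dd (dd F1 b) b x) * F2 x * W x - F1 x * (\<Sum>b\<in>B. dd (dd F2 b) b x) * W x)
     has_integral 0) UNIV" by simp
  have i: "(\<lambda>x. g x * W x) integrable_on UNIV" if "continuous_on U g" for g
    by (rule integrable_compact_support[OF continuous_on_cutoff[OF U clK K(2) that _ W0] _ K(1)])
       (use W0 Ck_on_continuous[OF W] in auto)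
  have cF: "continuous_on U F1" "continuous_on U F2" using Ck_on_continuous F1 F2 by auto
  have "integral UNIV (\<lambda>x. (\<Sum>b\<in>B. dd (dd F1 b) b x) * F2 x * W x) -
         integral UNIV (\<lambda>x. F1 x * (\<Sum>b\<in>B. dd (dd F2 b) b x) * W x) = 0"
    using I0
    by (subst Henstock_Kurzweil_Integration.integral_diff[symmetric])
       (auto intro!: i continuous_intros C1 F1 F2 cF)
  then show ?thesis by simp
qed

section \<open>Moments of a function on a product of spheres\<close>

text \<open>Being \<open>C\<^sup>1\<close> is enough here: integration by parts differentiates the cutoff once.\<close>

definition bump :: "real \<Rightarrow> real" where
  "bump r = (max 0 ((r - 1/4) * (4 - r)))\<^sup>2"

lemma Ck_on_max_squared: "Ck_on 1 (\<lambda>r::real. (max 0 r)\<^sup>2) UNIV"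
  unfolding One_nat_def
proof (rule Ck_on_SucI)
  fix x :: real
  have "((\<lambda>r. (max 0 r)\<^sup>2) has_real_derivative 2 * max 0 x) (at x)"
  proof -
    consider "x > 0" | "x < 0" | "x = 0" by linarith
    then show ?thesis
    proof cases
      case 1
      show ?thesis
        by (rule has_field_derivative_transform_within_open[of "\<lambda>r. r^2" _ _ "{0<..}"])
           (use 1 in \<open>auto intro!: derivative_eq_intros\<close>)
    next
      case 2
      show ?thesis
        by (rule has_field_derivative_transform_within_open[of "\<lambda>r. 0" _ _ "{..<0}"])
           (use 2 in \<open>auto intro!: derivative_eq_intros\<close>)
    next
      case 3
      have "((\<lambda>h::real. max 0 h) \<longlongrightarrow> max 0 0) (at 0)" by (intro tendsto_intros)
      \<comment> \<open>At 0 the difference quotient of the squared positive part is the positive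
        part itself, which tends to 0.\<close>
      moreover have "\<forall>\<^sub>F h in at (0::real). max 0 h = ((max 0 (0 + h))\<^sup>2 - (max 0 0)\<^sup>2) / h"
        unfolding eventually_at_filter
        by (rule always_eventually) (auto simp: max_def power2_eq_square)
      ultimately show ?thesis
        unfolding 3 DERIV_def using Lim_transform_eventually by fastforce
    qed
  qed
  then show "((\<lambda>r. (max 0 r)\<^sup>2) has_derivative (\<lambda>v. 2 * max 0 x * v)) (at x)"
    by (simp add: has_field_derivative_def)
qed (auto intro!: continuous_intros)

lemma Ck_on_bump: "Ck_on 1 bump UNIV"
  unfolding bump_def
  by (rule Ck_on_compose[OF _ _ _ Ck_on_max_squared], simp, simp)
     (intro Ck_on_mult Ck_on_diff Ck_on_const Ck_on_ident open_UNIV)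

definition pair_dom :: "('a::euclidean_space \<times> 'b::euclidean_space) set" where
  "pair_dom = (- {0}) \<times> (- {0})"

text \<open>The radii 1/2 and 2 are the square roots of 1/4 and 4, the zeros in \<open>bump\<close>,
  which is evaluated at squared norms. Both unit spheres lie inside and both origins
  outside.\<close>

definition pair_shell :: "('a::euclidean_space \<times> 'b::euclidean_space) set" where
  "pair_shell = (cball 0 2 - ball 0 (1/2)) \<times> (cball 0 2 - ball 0 (1/2))"

lemma open_pair_dom: "open pair_dom"
  by (auto simp: pair_dom_def intro: open_Times)

lemma compact_pair_shell: "compact pair_shell"
  by (auto simp: pair_shell_def intro!: compact_Times compact_diff)

lemma pair_shell_subset: "pair_shell \<subseteq> pair_dom"
  by (auto simp: pair_shell_def pair_dom_def)

lemma bump_eq_0: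
  assumes "x \<notin> cball 0 2 - ball 0 (1/2)" shows "bump (x \<bullet> x) = 0"
proof -
  have "norm x > 2 \<or> norm x < 1/2" using assms by auto
  then have "(norm x)\<^sup>2 > 2\<^sup>2 \<or> (norm x)\<^sup>2 < (1/2)\<^sup>2"
    by (metis norm_ge_zero power_strict_mono zero_less_numeral pos2 zero_le_numeral)
  then have "(norm x)\<^sup>2 > 4 \<or> (norm x)\<^sup>2 < 1/4" by (simp add: power2_eq_square)
  then have "((norm x)\<^sup>2 - 1/4) * (4 - (norm x)\<^sup>2) \<le> 0"
    by (auto simp: mult_le_0_iff)
  then show ?thesis by (simp add: bump_def dot_square_norm)
qed

text \<open>Radial in each variable separately, so that its partial gradients are multiples of the
  position vectors.\<close>

definition cutoff :: "'a::euclidean_space \<times> 'b::euclidean_space \<Rightarrow> real" where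
  "cutoff p = bump (fst p \<bullet> fst p) * bump (snd p \<bullet> snd p)"

lemma cutoff_eq_0: "p \<notin> pair_shell \<Longrightarrow> cutoff p = 0"
  using bump_eq_0[of "fst p"] bump_eq_0[of "snd p"]
  by (cases p) (auto simp: pair_shell_def cutoff_def simp del: mem_ball_0 mem_cball_0 mem_cball mem_ball)

lemma Ck_on_cutoff: "Ck_on 1 cutoff UNIV"
  unfolding cutoff_def
  by (intro Ck_on_mult Ck_on_compose[OF _ _ _ Ck_on_bump] Ck_on_inner Ck_on_fst Ck_on_snd Ck_on_ident) auto

lemma cutoff_nonneg: "cutoff p \<ge> 0" by (simp add: cutoff_def bump_def)

lemma cutoff_pos: "norm (fst p) = 1 \<Longrightarrow> norm (snd p) = 1 \<Longrightarrow> cutoff p > 0"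
  by (simp add: cutoff_def bump_def dot_square_norm)

section \<open>Weighted integrals over the two sphere variables at fixed \<open>u\<close>\<close>

definition dom3 :: "('a::euclidean_space \<times> 'b::euclidean_space \<times> real) set" where
  "dom3 = (- {0}) \<times> (- {0}) \<times> UNIV"

lemma open_dom3: "open dom3"
  by (auto simp: dom3_def intro!: open_Times)

lemma mem_dom3: "(x, y, u) \<in> dom3 \<longleftrightarrow> x \<noteq> 0 \<and> y \<noteq> 0"
  by (simp add: dom3_def)

text \<open>This stands for an integral over the product of the unit spheres: if \<open>F\<close>
  has degree 0 in both variables and \<open>W\<close> is a degree 0 function times
  \<open>cutoff\<close>, polar coordinates show that the two agree up to a positive
  constant.\<close>

definition slice_integral ::
    "('a::euclidean_space \<times> 'b::euclidean_space \<Rightarrow> real) \<Rightarrow> ('a \<times> 'b \<times> real \<Rightarrow> real) \<Rightarrow> real \<Rightarrow> real" where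
  "slice_integral W F u = integral UNIV (\<lambda>p. F (fst p, snd p, u) * W p)"

lemma slice_integrable:
  fixes W :: "'a::euclidean_space \<times> 'b::euclidean_space \<Rightarrow> real"
  assumes W: "continuous_on pair_dom W" "\<And>p. p \<notin> pair_shell \<Longrightarrow> W p = 0" and F: "continuous_on dom3 F"
  shows "(\<lambda>p. F (fst p, snd p, u) * W p) integrable_on UNIV"
    "continuous_on UNIV (\<lambda>p. F (fst p, snd p, u) * W p)"
proof -
  show "continuous_on UNIV (\<lambda>p. F (fst p, snd p, u) * W p)"
  proof (rule continuous_on_cutoff[of pair_dom pair_shell])
    show "continuous_on pair_dom (\<lambda>p. F (fst p, snd p, u))"
      by (auto intro!: continuous_on_compose2[OF F] continuous_intros simp: dom3_def pair_dom_def)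
  qed (fact open_pair_dom compact_imp_closed[OF compact_pair_shell] pair_shell_subset W)+
  then show "(\<lambda>p. F (fst p, snd p, u) * W p) integrable_on UNIV"
    by (rule integrable_compact_support[OF _ _ compact_pair_shell]) (use W in auto)
qed

lemma slice_integral_derivative:
  assumes W: "continuous_on pair_dom W" "\<And>p. p \<notin> pair_shell \<Longrightarrow> W p = 0" and F: "Cinf_on F dom3"
  shows "(slice_integral W F has_real_derivative slice_integral W (dd F (0, 0, 1)) u) (at u)"
proof -
  obtain c where c: "pair_shell \<subseteq> cbox (-c) (c :: 'a \<times> 'b)"
    using bounded_subset_cbox_symmetric compact_imp_bounded compact_pair_shell by blast
  note contF = Ck_on_continuous[OF Cinf_onD[OF F]] Ck_on_continuous[OF Cinf_onD[OF Cinf_on_dd[OF F]]]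
  have *: "slice_integral W F u = integral (cbox (-c) c) (\<lambda>p. F (fst p, snd p, u) * W p)"
    if "continuous_on dom3 F" for F u
    unfolding slice_integral_def
    by (rule integral_compact_support(2)[OF slice_integrable(2)[OF W that] _ c]) (use W in auto)
  have "((\<lambda>u. integral (cbox (-c) c) (\<lambda>p. F (fst p, snd p, u) * W p)) has_field_derivative
    integral (cbox (-c) c) (\<lambda>p. dd F (0, 0, 1) (fst p, snd p, u) * W p)) (at u within UNIV)"
  proof (rule leibniz_rule_field_derivative)
    show "((\<lambda>u. F (fst p, snd p, u) * W p) has_field_derivative dd F (0, 0, 1) (fst p, snd p, t) * W p) (at t within UNIV)"
      for p t
    proof (cases "p \<in> pair_dom")
      case False 
      \<comment> \<open>Off \<open>pair_dom\<close> nothing is known about \<open>F\<close>, but the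
        weight vanishes there.\<close>
      then have "W p = 0" using W(2) pair_shell_subset by blast
      then show ?thesis by simp
    next
      case True
      then have "F differentiable at ((fst p, snd p, 0) + t *\<^sub>R (0, 0, 1))"
        by (intro Cinf_on_differentiable[OF F]) (auto simp: dom3_def pair_dom_def)
      from has_vector_derivative_line[OF this]
      have "((\<lambda>u. F (fst p, snd p, u)) has_field_derivative dd F (0, 0, 1) (fst p, snd p, t)) (at t)"
        by (simp add: has_real_derivative_iff_has_vector_derivative)
      then show ?thesis by (auto intro!: derivative_eq_intros)
    qed
    show "(\<lambda>p. F (fst p, snd p, t) * W p) integrable_on cbox (-c) c" for t
      using slice_integrable(2)[OF W contF(1)]
      by (intro integrable_continuous) (auto intro: continuous_on_subset)
    \<comment> \<open>Joint continuity in the parameter and the point: the set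
      \<open>UNIV \<times> pair_shell\<close> is closed, though not compact, as
      \<open>continuous_on_cutoff\<close> asks.\<close>
    have "continuous_on UNIV (\<lambda>q. dd F (0, 0, 1) (fst (snd q), snd (snd q), fst q) * W (snd q))"
    proof (rule continuous_on_cutoff[of "UNIV \<times> pair_dom" "UNIV \<times> pair_shell"])
      show "continuous_on (UNIV \<times> pair_dom) (\<lambda>q. dd F (0, 0, 1) (fst (snd q), snd (snd q), fst q))"
        by (rule continuous_on_compose2[OF contF(2)]) (auto intro!: continuous_intros simp: dom3_def pair_dom_def)
      show "continuous_on (UNIV \<times> pair_dom) (\<lambda>q. W (snd q))"
        by (rule continuous_on_compose2[OF W(1)]) (auto intro!: continuous_intros)
      show "W (snd q) = 0" if "q \<notin> UNIV \<times> pair_shell" for q :: "real \<times> 'a \<times> 'b"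
        using that by (intro W(2)) (simp add: mem_Times_iff)
    qed (use pair_shell_subset open_pair_dom compact_imp_closed[OF compact_pair_shell] in 
         \<open>auto intro!: open_Times closed_Times\<close>)
    then show "continuous_on (UNIV \<times> cbox (-c) c) (\<lambda>(t, p). dd F (0, 0, 1) (fst p, snd p, t) * W p)"
      unfolding case_prod_beta by (rule continuous_on_subset) auto
  qed auto
  moreover have "slice_integral W F = (\<lambda>u. integral (cbox (-c) c) (\<lambda>p. F (fst p, snd p, u) * W p))"
    using *[OF contF(1)] by auto
  ultimately show ?thesis by (simp add: *[OF contF(2)])
qed

text \<open>Differentiation under the integral returns a slice integral of
  \<open>dd F (0, 0, 1)\<close>, so the induction on the order has to keep \<open>F\<close>
  general.\<close>

lemma Cinf_on_slice_integral:
  assumes W: "continuous_on pair_dom W" "\<And>p. p \<notin> pair_shell \<Longrightarrow> W p = 0" and F: "Cinf_on F dom3"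
  shows "Cinf_on (slice_integral W F) UNIV"
proof -
  have "Ck_on m (slice_integral W F) UNIV" if "Cinf_on F dom3" for m F
    using that
  proof (induction m arbitrary: F)
    case 0
    show ?case using slice_integral_derivative[OF W 0] DERIV_isCont
      by (auto intro!: continuous_at_imp_continuous_on)
  next
    case (Suc m)
    show ?case
      by (rule Ck_on_SucI[where F' = "\<lambda>u v. slice_integral W (dd F (0, 0, 1)) u * v"])
         (use slice_integral_derivative[OF W Suc.prems] in 
           \<open>auto simp: has_field_derivative_def intro!: Ck_on_mult Ck_on_const Suc.IH Cinf_on_dd[OF Suc.prems]\<close>)
  qed
  then show ?thesis using F by (simp add: Cinf_on_def)
qed

section \<open>Density of exponential sums and nonvanishing moments\<close>

inductive exp_sum :: "('a::euclidean_space \<Rightarrow> real) \<Rightarrow> bool" where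
  single: "exp_sum (\<lambda>p. c * exp (\<xi> \<bullet> p))"
| add: "exp_sum f \<Longrightarrow> exp_sum g \<Longrightarrow> exp_sum (\<lambda>p. f p + g p)"

lemma exp_sum_continuous: "exp_sum f \<Longrightarrow> continuous_on S f"
  by (induction rule: exp_sum.induct) (auto intro!: continuous_intros)

text \<open>Exponentials of linear forms are closed under multiplication, so their span is an
  algebra. They also split into a factor in each sphere variable, which powers of a joint linear
  form do not.\<close>

lemma exp_sum_mult: "exp_sum f \<Longrightarrow> exp_sum g \<Longrightarrow> exp_sum (\<lambda>p. f p * g p)"
proof (induction rule: exp_sum.induct)
  case (single c \<xi>)
  then show ?case
  proof (induction rule: exp_sum.induct)
    case (single d \<eta>)
    have "exp_sum (\<lambda>p. (c * d) * exp ((\<xi> + \<eta>) \<bullet> p))" by (rule exp_sum.single)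
    then show ?case by (simp add: inner_add_left exp_add ac_simps)
  next
    case (add f g)
    from exp_sum.add[OF add.IH] show ?case by (simp add: distrib_left)
  qed
next
  case (add f h)
  from exp_sum.add[OF add.IH(1)[OF add.prems] add.IH(2)[OF add.prems]] show ?case by (simp add: distrib_right)
qed

lemma exp_sum_dense:
  fixes S :: "'a::euclidean_space set"
  assumes "compact S" "continuous_on S f" "e > 0"
  shows "\<exists>g. exp_sum g \<and> (\<forall>x\<in>S. \<bar>f x - g x\<bar> < e)"
proof (rule Stone_Weierstrass_HOL[of S exp_sum, OF assms(1) _ _ _ _ _ assms(2,3)])
  show "exp_sum (\<lambda>x. c)" for c using exp_sum.single[of c 0] by simp
  show "exp_sum f \<Longrightarrow> continuous_on S f" for f by (rule exp_sum_continuous)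
  show "\<exists>f. exp_sum f \<and> f x \<noteq> f y" if "x \<in> S \<and> y \<in> S \<and> x \<noteq> y" for x y
  proof (intro exI[of _ "\<lambda>p. 1 * exp ((x - y) \<bullet> p)"] conjI exp_sum.single)
    have "(x - y) \<bullet> (x - y) \<noteq> 0" using that by simp
    then have "(x - y) \<bullet> x \<noteq> (x - y) \<bullet> y" by (simp add: inner_diff_right)
    then show "1 * exp ((x - y) \<bullet> x) \<noteq> 1 * exp ((x - y) \<bullet> y)" by simp
  qed
qed (auto intro: exp_sum.add exp_sum_mult)

text \<open>If all these moments vanished, the functional \<open>A\<close> of integration against
  \<open>F\<close> would vanish on exponentials, by density on all continuous functions, and so on
  \<open>F\<close> itself; but there it integrates a nonnegative function that is positive at
  \<open>(x0, y0)\<close>.\<close>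

lemma exists_nonzero_moment:
  fixes F :: "'a::euclidean_space \<times> 'b::euclidean_space \<Rightarrow> real"
  assumes F: "continuous_on (sphere 0 1 \<times> sphere 0 1) F"
    and p0: "x0 \<in> sphere 0 1" "y0 \<in> sphere 0 1" "F (x0, y0) \<noteq> 0"
  obtains (moment) v w n m where "norm v = 1" "norm w = 1"
    "integral UNIV (\<lambda>p. F (sgn (fst p), sgn (snd p)) * ((v \<bullet> sgn (fst p)) ^ n * (w \<bullet> sgn (snd p)) ^ m * cutoff p)) \<noteq> 0"
proof -
  define S where "S = sphere (0::'a) 1 \<times> sphere (0::'b) 1"
  have S: "compact S" by (simp add: S_def compact_Times)
  define \<sigma> :: "'a \<times> 'b \<Rightarrow> 'a \<times> 'b" where "\<sigma> p = (sgn (fst p), sgn (snd p))" for p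
  have sgn_cont: "continuous_on (- {0}) (sgn :: 'c::euclidean_space \<Rightarrow> 'c)"
    using Ck_on_continuous[OF Ck_on_sgn] .
  have \<sigma>S: "\<sigma> p \<in> S" if "p \<in> pair_dom" for p
    using that by (auto simp: \<sigma>_def S_def pair_dom_def norm_sgn)
  have \<sigma>c: "continuous_on pair_dom \<sigma>"
    unfolding \<sigma>_def pair_dom_def
    by (intro continuous_intros continuous_on_compose2[OF sgn_cont]) auto
  have cc: "continuous_on pair_dom cutoff"
    using Ck_on_continuous[OF Ck_on_cutoff] by (rule continuous_on_subset) simp
  have cont: "continuous_on UNIV (\<lambda>p. g (\<sigma> p) * cutoff p)" if "continuous_on S g" for g
    by (rule continuous_on_cutoff[OF open_pair_dom compact_imp_closed[OF compact_pair_shell] pair_shell_subset _ cc cutoff_eq_0])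
       (auto intro!: continuous_on_compose2[OF that \<sigma>c] \<sigma>S)
  have int: "(\<lambda>p. g (\<sigma> p) * cutoff p) integrable_on UNIV" if "continuous_on S g" for g
    by (rule integrable_compact_support[OF cont[OF that] _ compact_pair_shell]) (simp add: cutoff_eq_0)
  note F = F[folded S_def]
  define A where "A g = integral UNIV (\<lambda>p. F (\<sigma> p) * g (\<sigma> p) * cutoff p)" for g
  have intA: "(\<lambda>p. F (\<sigma> p) * g (\<sigma> p) * cutoff p) integrable_on UNIV" if "continuous_on S g" for g
    using int[of "\<lambda>q. F q * g q"] continuous_on_mult[OF F that] by simp
  have Aadd: "A (\<lambda>p. f p + g p) = A f + A g" if "continuous_on S f" "continuous_on S g" for f g
    unfolding A_def using Henstock_Kurzweil_Integration.integral_add[OF intA[OF that(1)] intA[OF that(2)]]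
    by (simp add: algebra_simps)
  have Acm: "A (\<lambda>p. c * f p) = c * A f" for c f
    unfolding A_def using Henstock_Kurzweil_Integration.integral_mult_right[of UNIV c "\<lambda>p. F (\<sigma> p) * f (\<sigma> p) * cutoff p"]
    by (simp add: ac_simps)
  have Asum: "A (\<lambda>p. \<Sum>i\<in>I. f i p) = (\<Sum>i\<in>I. A (f i))" if "\<And>i. i \<in> I \<Longrightarrow> continuous_on S (f i)" "finite I"
    for I :: "nat set" and f
    using that(2,1)
  proof (induction I rule: finite_induct)
    case empty then show ?case by (simp add: A_def)
  next
    case (insert i I) then show ?case by (simp add: Aadd continuous_on_sum)
  qed
  \<comment> \<open>\<open>A\<close> is bounded by the constant \<open>C\<close> times the supremum
    over \<open>S\<close>, so its kernel is closed under uniform approximation.\<close>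
  have Acl: "A g = 0" 
    if g: "continuous_on S g" and ap: "\<And>e. e > 0 \<Longrightarrow> \<exists>h. continuous_on S h \<and> A h = 0 \<and> (\<forall>p\<in>S. \<bar>g p - h p\<bar> \<le> e)" for g
  proof -
    define C where "C = integral UNIV (\<lambda>p. \<bar>F (\<sigma> p)\<bar> * cutoff p)"
    have iC: "(\<lambda>p. \<bar>F (\<sigma> p)\<bar> * cutoff p) integrable_on UNIV"
      using int[of "\<lambda>q. \<bar>F q\<bar>"] F by (simp add: continuous_on_rabs)
    have bound: "\<bar>A g\<bar> \<le> e * C" if "e > 0" for e
    proof -
      obtain h where h: "continuous_on S h" "A h = 0" "\<And>p. p \<in> S \<Longrightarrow> \<bar>g p - h p\<bar> \<le> e" using ap[OF \<open>e > 0\<close>] by blast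
      have "A (\<lambda>p. g p + (-1) * h p) = A g"
        by (subst Aadd) (use h g Acm[of "-1" h] in \<open>auto intro!: continuous_intros\<close>)
      then have "\<bar>A g\<bar> = norm (integral UNIV (\<lambda>p. F (\<sigma> p) * (g (\<sigma> p) + (-1) * h (\<sigma> p)) * cutoff p))"
        by (simp add: A_def)
      also have "\<dots> \<le> integral UNIV (\<lambda>p. e * (\<bar>F (\<sigma> p)\<bar> * cutoff p))"
      proof (rule Henstock_Kurzweil_Integration.integral_norm_bound_integral)
        show "(\<lambda>p. F (\<sigma> p) * (g (\<sigma> p) + (-1) * h (\<sigma> p)) * cutoff p) integrable_on UNIV"
          using intA[of "\<lambda>p. g p + (-1) * h p"] g h by (auto intro!: continuous_intros)
        show "(\<lambda>p. e * (\<bar>F (\<sigma> p)\<bar> * cutoff p)) integrable_on UNIV"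
          using iC integrable_on_cmult_left[of "\<lambda>p. \<bar>F (\<sigma> p)\<bar> * cutoff p" UNIV e] by simp
        show "norm (F (\<sigma> p) * (g (\<sigma> p) + (-1) * h (\<sigma> p)) * cutoff p) \<le> e * (\<bar>F (\<sigma> p)\<bar> * cutoff p)" for p
        proof (cases "p \<in> pair_dom")
          case True
          have "\<bar>F (\<sigma> p)\<bar> * \<bar>g (\<sigma> p) - h (\<sigma> p)\<bar> * cutoff p \<le> \<bar>F (\<sigma> p)\<bar> * e * cutoff p"
            by (intro mult_right_mono mult_left_mono h(3) \<sigma>S True cutoff_nonneg) auto
          then show ?thesis by (simp add: abs_mult cutoff_nonneg ac_simps)
        next
          case False
          then have "cutoff p = 0" using cutoff_eq_0 pair_shell_subset by blast
          then show ?thesis by simp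
        qed
      qed
      also have "\<dots> = e * C" by (simp add: C_def)
      finally show ?thesis .
    qed
    have "((\<lambda>e. e * C) \<longlongrightarrow> 0 * C) (at_right 0)" by (intro tendsto_intros)
    moreover have "\<forall>\<^sub>F e in at_right 0. \<bar>A g\<bar> \<le> e * C"
      using eventually_at_right_less[of 0] by eventually_elim (rule bound)
    ultimately have "\<bar>A g\<bar> \<le> 0 * C" by (intro tendsto_lowerbound[of "\<lambda>e. e * C"]) auto
    then show ?thesis by simp
  qed
  \<comment> \<open>On the compact image of \<open>t\<close> the exponential is a uniform limit of
    polynomials, which leads from the powers of \<open>t\<close> to \<open>exp t\<close>. The factor
    \<open>c\<close> carries the other variable, so that the step can be used once for each
    sphere.\<close>
  have Aexp: "A (\<lambda>p. c p * exp (t p)) = 0"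
    if ct: "continuous_on S c" "continuous_on S t" and pw: "\<And>n. A (\<lambda>p. c p * t p ^ n) = 0" for c t
  proof (rule Acl)
    show "continuous_on S (\<lambda>p. c p * exp (t p))" using ct by (intro continuous_intros)
    fix e :: real assume "e > 0"
    obtain M where M: "M > 0" "\<And>p. p \<in> S \<Longrightarrow> \<bar>c p\<bar> \<le> M"
      using compact_imp_bounded[OF compact_continuous_image[OF ct(1) S]] by (auto simp: bounded_pos)
    have "compact (t ` S)" using ct(2) S by (rule compact_continuous_image)
    moreover have "continuous_on (t ` S) exp" by (intro continuous_intros)
    moreover have "e / M > 0" using \<open>e > 0\<close> M by simp
    ultimately have "\<exists>q. real_polynomial_function q \<and> (\<forall>s\<in>t ` S. \<bar>exp s - q s\<bar> < e / M)"
      by (rule Stone_Weierstrass_real_polynomial_function) blast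
    then obtain q where q: "real_polynomial_function q" "\<And>s. s \<in> t ` S \<Longrightarrow> \<bar>exp s - q s\<bar> < e / M"
      by blast
    obtain a N where a: "q = (\<lambda>s. \<Sum>i\<le>(N::nat). a i * s ^ i)"
      using q(1) unfolding real_polynomial_function_iff_sum by blast
    show "\<exists>h. continuous_on S h \<and> A h = 0 \<and> (\<forall>p\<in>S. \<bar>c p * exp (t p) - h p\<bar> \<le> e)"
    proof (intro exI conjI ballI)
      show "continuous_on S (\<lambda>p. \<Sum>i\<le>N. a i * (c p * t p ^ i))" using ct by (intro continuous_intros)
      show "A (\<lambda>p. \<Sum>i\<le>N. a i * (c p * t p ^ i)) = 0"
        by (subst Asum) (use ct in \<open>auto intro!: continuous_intros simp: Acm pw\<close>)
      fix p assume p: "p \<in> S"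
      have "(\<Sum>i\<le>N. a i * (c p * t p ^ i)) = c p * q (t p)"
        by (simp add: a sum_distrib_left ac_simps)
      then have "\<bar>c p * exp (t p) - (\<Sum>i\<le>N. a i * (c p * t p ^ i))\<bar> = \<bar>c p\<bar> * \<bar>exp (t p) - q (t p)\<bar>"
        by (simp add: abs_mult[symmetric] right_diff_distrib)
      also have "\<dots> \<le> M * (e / M)"
        by (intro mult_mono M p less_imp_le[OF q(2)]) (use p M in auto)
      finally show "\<bar>c p * exp (t p) - (\<Sum>i\<le>N. a i * (c p * t p ^ i))\<bar> \<le> e" using M by simp
    qed
  qed
  show ?thesis
  proof (rule ccontr)
    assume "\<not> thesis"
    then have M0: "A (\<lambda>p. (v \<bullet> fst p) ^ n * (w \<bullet> snd p) ^ m) = 0" if "norm v = 1" "norm w = 1" for v w n m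
      using moment[of v w n m] that by (auto simp: A_def \<sigma>_def mult.assoc)
    \<comment> \<open>Scaling passes from unit vectors to all vectors. The zero vector is 0 times
      any unit vector, and \<open>0 ^ 0 = 1\<close> makes this correct for exponent 0 as
      well.\<close>
    have M1: "A (\<lambda>p. (v \<bullet> fst p) ^ n * (w \<bullet> snd p) ^ m) = 0" for v w n m
    proof -
      have unit: "\<exists>e. norm e = 1 \<and> v = norm v *\<^sub>R e" for v :: "'c::euclidean_space"
      proof (cases "v = 0")
        case True 
        obtain e :: 'c where "e \<in> Basis" using nonempty_Basis by blast
        with True show ?thesis by (intro exI[of _ e]) simp
      next
        case False then show ?thesis by (intro exI[of _ "sgn v"]) (simp add: norm_sgn sgn_div_norm)
      qed
      obtain e where e: "norm e = 1" "v = norm v *\<^sub>R e" using unit by blast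
      obtain d where d: "norm d = 1" "w = norm w *\<^sub>R d" using unit by blast
      have eq: "(\<lambda>p. (v \<bullet> fst p) ^ n * (w \<bullet> snd p) ^ m) = 
          (\<lambda>p. (norm v ^ n * norm w ^ m) * ((e \<bullet> fst p) ^ n * (d \<bullet> snd p) ^ m))"
      proof
        fix p :: "'a \<times> 'b"
        have "v \<bullet> fst p = norm v * (e \<bullet> fst p)" "w \<bullet> snd p = norm w * (d \<bullet> snd p)"
          using e(2) d(2) inner_scaleR_left by metis+
        then show "(v \<bullet> fst p) ^ n * (w \<bullet> snd p) ^ m = 
          (norm v ^ n * norm w ^ m) * ((e \<bullet> fst p) ^ n * (d \<bullet> snd p) ^ m)"
          by (simp add: power_mult_distrib)
      qed
      show ?thesis unfolding eq Acm M0[OF e(1) d(1)] by simp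
    qed
    \<comment> \<open>\<open>Aexp\<close> is used in the second variable here, with a power of the
      first as the factor \<open>c\<close>, and then in the first variable, with the exponential
      just obtained as \<open>c\<close>.\<close>
    have M2: "A (\<lambda>p. (v \<bullet> fst p) ^ n * exp (w \<bullet> snd p)) = 0" for v w n
      by (rule Aexp) (auto intro!: continuous_intros M1)
    have M3: "A (\<lambda>p. exp (w \<bullet> snd p) * exp (v \<bullet> fst p)) = 0" for v w
      by (rule Aexp) (use M2 in \<open>auto intro!: continuous_intros simp: mult.commute\<close>)
    have M4: "A f = 0" if "exp_sum f" for f
      using that
    proof (induction rule: exp_sum.induct)
      case (single c \<xi>)
      show ?case using M3[of "snd \<xi>" "fst \<xi>"]
        by (simp add: Acm inner_prod_def exp_add mult.commute)
    next
      case (add f g) then show ?case by (simp add: Aadd exp_sum_continuous)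
    qed
    have "A F = 0"
    proof (rule Acl[OF F])
      fix e :: real assume "e > 0"
      from exp_sum_dense[OF S F this] obtain g where g: "exp_sum g" "\<And>p. p \<in> S \<Longrightarrow> \<bar>F p - g p\<bar> < e"
        by blast
      show "\<exists>h. continuous_on S h \<and> A h = 0 \<and> (\<forall>p\<in>S. \<bar>F p - h p\<bar> \<le> e)"
        by (intro exI[of _ g] conjI ballI exp_sum_continuous g(1) M4 less_imp_le g(2))
    qed
    \<comment> \<open>The integrand of \<open>A F\<close>: continuous, nonnegative and of integral
      0, hence zero at \<open>(x0, y0)\<close>, where however both \<open>F\<close> and
      \<open>cutoff\<close> are nonzero.\<close>
    define H where "H p = F (\<sigma> p) * F (\<sigma> p) * cutoff p" for p
    have "integral UNIV H = 0" using \<open>A F = 0\<close> by (simp add: A_def H_def[abs_def])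
    obtain c where c: "pair_shell \<subseteq> box (-c) (c :: 'a \<times> 'b)"
      using bounded_subset_box_symmetric compact_imp_bounded compact_pair_shell by blast
    have cH: "continuous_on UNIV H"
      unfolding H_def using cont[of "\<lambda>q. F q * F q"] continuous_on_mult[OF F F] by simp
    have "pair_shell \<subseteq> cbox (-c) c" using c box_subset_cbox[of "-c" c] by blast
    then have "integral (cbox (-c) c) H = 0"
      using integral_compact_support(2)[OF cH, of pair_shell "-c" c] \<open>integral UNIV H = 0\<close>
      by (simp add: H_def cutoff_eq_0)
    moreover have "H integrable_on cbox (-c) c"
      using cH by (intro integrable_continuous) (auto intro: continuous_on_subset)
    ultimately have "(H has_integral 0) (cbox (-c) c)" by (metis integrable_integral)
    moreover have "(x0, y0) \<in> pair_shell" using p0 by (simp add: pair_shell_def)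
    ultimately have "H (x0, y0) = 0"
      using c cH box_subset_cbox[of "-c" c]
      by (intro has_integral_0_cbox_imp_0[of "-c" c H]) 
         (auto intro: continuous_on_subset simp: H_def cutoff_nonneg)
    moreover have "\<sigma> (x0, y0) = (x0, y0)" using p0 by (simp add: \<sigma>_def sgn_div_norm)
    moreover have "cutoff (x0, y0) > 0" using p0 by (intro cutoff_pos) auto
    ultimately show False using p0 by (simp add: H_def)
  qed
qed

section \<open>Tangent vectors and traces\<close>

text \<open>Expanding the vectors of either basis in the other, with coefficients given by
  \<open>g\<close>, turns both traces into the same double sum. This removes the choice of a basis
  from \<open>divergence\<close>.\<close>

lemma trace_independent_of_basis:
  fixes g B :: "'v::real_vector \<Rightarrow> 'v \<Rightarrow> real"
  assumes g: "bilinear g" and B: "bilinear B" and fin: "finite E" "finite E'"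
    and sp: "span E = span E'"
    and on: "\<And>e d. e \<in> E \<Longrightarrow> d \<in> E \<Longrightarrow> g e d = (if e = d then 1 else 0)"
      "\<And>e d. e \<in> E' \<Longrightarrow> d \<in> E' \<Longrightarrow> g e d = (if e = d then 1 else 0)"
    and sym: "\<And>v w. g v w = g w v"
  shows "(\<Sum>e\<in>E. B e e) = (\<Sum>e\<in>E'. B e e)"
proof -
  have lin: "linear (g v)" "linear (\<lambda>v. g v w)" "linear (B v)" "linear (\<lambda>v. B v w)" for v w
    using g B by (auto simp: bilinear_def eta_contract_eq)
  have expand: "v = (\<Sum>e\<in>D. g v e *\<^sub>R e)"
    if D: "finite D" "v \<in> span D" and onD: "\<And>e d. e \<in> D \<Longrightarrow> d \<in> D \<Longrightarrow> g e d = (if e = d then 1 else 0)" for D v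
  proof -
    obtain c where c: "v = (\<Sum>e\<in>D. c e *\<^sub>R e)" using D by (auto simp: span_finite)
    have "g v d = c d" if "d \<in> D" for d
    proof -
      have "g v d = (\<Sum>e\<in>D. c e * g e d)"
        unfolding c linear_sum[OF lin(2)] by (simp add: linear_cmul[OF lin(2)])
      also have "\<dots> = (\<Sum>e\<in>D. if e = d then c e else 0)"
        by (rule sum.cong) (use onD that in auto)
      finally show ?thesis using that D(1) by simp
    qed
    then show ?thesis using c by simp
  qed
  have "(\<Sum>e\<in>E. B e e) = (\<Sum>e\<in>E. \<Sum>d\<in>E'. g e d * B d e)"
  proof (rule sum.cong[OF refl])
    fix e assume "e \<in> E"
    then have "e \<in> span E'" using sp span_base by blast
    from expand[OF fin(2) this on(2)] have "B e e = B (\<Sum>d\<in>E'. g e d *\<^sub>R d) e" by simp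
    also have "\<dots> = (\<Sum>d\<in>E'. g e d * B d e)"
      unfolding linear_sum[OF lin(4)] by (simp add: linear_cmul[OF lin(4)])
    finally show "B e e = \<dots>" .
  qed
  also have "\<dots> = (\<Sum>d\<in>E'. \<Sum>e\<in>E. g e d * B d e)" by (rule sum.swap)
  also have "\<dots> = (\<Sum>d\<in>E'. B d d)"
  proof (rule sum.cong[OF refl])
    fix d assume "d \<in> E'"
    then have "d \<in> span E" using sp span_base by blast
    from expand[OF fin(1) this on(1)] have "B d d = B d (\<Sum>e\<in>E. g d e *\<^sub>R e)" by simp
    also have "\<dots> = (\<Sum>e\<in>E. g d e * B d e)"
      unfolding linear_sum[OF lin(3)] by (simp add: linear_cmul[OF lin(3)])
    finally show "(\<Sum>e\<in>E. g e d * B d e) = B d d" by (simp add: sym)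
  qed
  finally show ?thesis .
qed

lemma bilinear_inner: "bilinear (inner :: 'a::euclidean_space \<Rightarrow> _)"
  by (auto simp: bilinear_def intro!: bounded_linear.linear bounded_linear_inner_left bounded_linear_inner_right)

text \<open>Adding \<open>e\<close> to \<open>A\<close> gives an orthonormal basis of the whole
  space. Applied to a Hessian whose radial entry vanishes, this identifies the trace along the
  sphere with the full Euclidean Laplacian.\<close>

lemma trace_perp:
  fixes e :: "'c::euclidean_space" and H :: "'c \<Rightarrow> 'c \<Rightarrow> real"
  assumes "norm e = 1" "finite A" "span A = {v. e \<bullet> v = 0}"
    "\<And>a b. a \<in> A \<Longrightarrow> b \<in> A \<Longrightarrow> a \<bullet> b = (if a = b then 1 else 0)" and H: "bilinear H"
  shows "(\<Sum>a\<in>A. H a a) = (\<Sum>b\<in>Basis. H b b) - H e e"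
proof -
  have perp: "e \<bullet> a = 0" if "a \<in> A" for a using span_base[OF that] assms(3) by auto
  have ee: "e \<bullet> e = 1" using assms(1) by (simp add: dot_square_norm)
  have eA: "e \<notin> A" using perp[of e] ee by auto
  have "(\<Sum>a\<in>insert e A. H a a) = (\<Sum>b\<in>Basis. H b b)"
  proof (rule trace_independent_of_basis[of inner H])
    show "bilinear (inner :: 'c \<Rightarrow> 'c \<Rightarrow> real)" by (rule bilinear_inner)
    show "bilinear H" by (rule H)
    have "x \<in> span (insert e A)" for x
    proof -
      have "x - (e \<bullet> x) *\<^sub>R e \<in> span A" unfolding assms(3) by (simp add: inner_diff_right ee)
      then show ?thesis unfolding span_insert by blast
    qed
    then show "span (insert e A) = span Basis" by auto
    show "a \<bullet> b = (if a = b then 1 else 0)" if "a \<in> insert e A" "b \<in> insert e A" for a b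
      using that assms(4) perp ee eA by (auto simp: inner_commute)
  qed (use assms(2) in \<open>auto simp: inner_Basis inner_commute\<close>)
  then show ?thesis using assms(2) eA by simp
qed

text \<open>Linearity in the first direction has to hold for \<open>dd F v\<close> near
  \<open>p\<close>, not only at \<open>p\<close>, because that function is differentiated once
  more.\<close>

lemma bilinear_hessian:
  assumes "open U" "p \<in> U" "Ck_on 2 F U"
  shows "bilinear (\<lambda>v w. dd (dd F v) w p)"
proof -
  have d: "dd F v differentiable (at p)" for v
    using assms by (simp add: numeral_2_eq_2)
  have d1: "F differentiable (at q)" if "q \<in> U" for q
    using assms that by (simp add: numeral_2_eq_2)
  have lin: "linear (\<lambda>v. dd F v q)" if "q \<in> U" for q
    using has_derivative_linear[OF has_derivative_dd[OF d1[OF that]]] .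
  have w: "linear (\<lambda>w. dd (dd F v) w p)" for v
    using has_derivative_linear[OF has_derivative_dd[OF d]] .
  have v: "linear (\<lambda>v. dd (dd F v) w p)" for w
  proof (rule linearI)
    fix v v' and r :: real
    have "dd (dd F (v + v')) w p = dd (\<lambda>q. dd F v q + dd F v' q) w p"
      by (rule differentiable_cong_open(2)[OF assms(1,2)])
         (simp_all add: linear_add[OF lin] d differentiable_add)
    also have "\<dots> = dd (dd F v) w p + dd (dd F v') w p"
      by (rule dd_eqI, intro has_derivative_add has_derivative_dd d)
    finally show "dd (dd F (v + v')) w p = dd (dd F v) w p + dd (dd F v') w p" .
    have "dd (dd F (r *\<^sub>R v)) w p = dd (\<lambda>q. r *\<^sub>R dd F v q) w p"
      by (rule differentiable_cong_open(2)[OF assms(1,2)])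
         (simp_all add: linear_cmul[OF lin] d)
    also have "\<dots> = r *\<^sub>R dd (dd F v) w p"
      by (rule dd_eqI, intro has_derivative_scaleR_right has_derivative_dd d)
    finally show "dd (dd F (r *\<^sub>R v)) w p = r *\<^sub>R dd (dd F v) w p" .
  qed
  show ?thesis using v w by (simp add: bilinear_def)
qed

section \<open>Differentials and tangent spaces on the product manifold\<close>

lemma tdiff_curve:
  assumes "F differentiable (at p within N)" "\<And>t. c t \<in> N" "c 0 = p" "(c has_vector_derivative v) (at 0)"
  shows "((\<lambda>t. F (c t)) has_vector_derivative tdiff N F p v) (at 0)"
proof -
  have "(F has_derivative frechet_derivative F (at p within N)) (at p within N)"
    using assms(1) by (simp add: frechet_derivative_works)
  then have "(F has_derivative frechet_derivative F (at p within N)) (at (c 0) within range c)"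
    using assms(2,3) by (auto intro: has_derivative_subset)
  from vector_derivative_diff_chain_within[OF assms(4) this]
  show ?thesis by (simp add: o_def tdiff_def)
qed

text \<open>The derivative within \<open>N\<close> need not be a unique linear map, but on a tangent
  vector every candidate gives the derivative along a curve in \<open>N\<close>. An ambient
  extension has the same derivative along that curve.\<close>

lemma tdiff_eq_dd:
  assumes G: "G differentiable (at p)" "\<And>q. q \<in> N \<Longrightarrow> G q = F q" and p: "p \<in> N" and v: "v \<in> tangent_space N p"
  shows "tdiff N F p v = dd G v p"
proof -
  obtain c where c: "\<And>t. c t \<in> N" "c 0 = p" "(c has_vector_derivative v) (at 0)"
    using v unfolding tangent_space_def by blast
  have "(F has_derivative (\<lambda>v. dd G v p)) (at p within N)"
    by (rule has_derivative_transform[OF p _ has_derivative_at_withinI[OF has_derivative_dd[OF G(1)]]])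
       (use G(2) in simp)
  then have "F differentiable (at p within N)" unfolding differentiable_def by blast
  from tdiff_curve[OF this c] have "((\<lambda>t. F (c t)) has_vector_derivative tdiff N F p v) (at 0)" .
  moreover have "((\<lambda>t. G (c t)) has_vector_derivative dd G v p) (at 0)"
    using vector_derivative_diff_chain_within[OF c(3) has_derivative_at_withinI[OF has_derivative_dd[OF G(1)], folded c(2)]]
    by (simp add: o_def c(2))
  ultimately show ?thesis using vector_derivative_unique_at c(1) G(2) by simp
qed

lemma M_dom_iff: "(y, z, u) \<in> M_dom \<longleftrightarrow> norm y = 1 \<and> norm z = 1"
  by (simp add: M_dom_def)

lemma M_dom_subset_dom3: "M_dom \<subseteq> dom3"
  by (auto simp: M_dom_def dom3_def)

lemma has_vector_derivative_sgn_line: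
  fixes y v :: "'a::euclidean_space"
  assumes "norm y = 1" "y \<bullet> v = 0"
  shows "((\<lambda>t. sgn (y + t *\<^sub>R v)) has_vector_derivative v) (at 0)"
proof -
  have y: "y \<noteq> 0" using assms by auto
  have "sgn differentiable (at y)"
    using Ck_on_differentiable[OF Ck_on_sgn] y by blast
  from has_vector_derivative_line0[OF this, of v]
  have "((\<lambda>t. sgn (y + t *\<^sub>R v)) has_vector_derivative dd sgn v y) (at 0)" .
  moreover have "dd sgn v y = v"
  proof -
    have "((\<lambda>x. inverse (norm x) *\<^sub>R x) has_derivative (\<lambda>h. inverse (norm y) *\<^sub>R h + (- (y \<bullet> h) * inverse (norm y) ^ 3) *\<^sub>R y)) (at y)"
      by (intro has_derivative_scaleR has_derivative_inverse_norm[OF y] has_derivative_ident)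
    then have "(sgn has_derivative (\<lambda>h. inverse (norm y) *\<^sub>R h + (- (y \<bullet> h) * inverse (norm y) ^ 3) *\<^sub>R y)) (at y)"
      by (simp add: sgn_div_norm[abs_def])
    from dd_eqI[OF this] show ?thesis using assms by simp
  qed
  ultimately show ?thesis by simp
qed

lemma inner_eq_0_of_norm_const:
  fixes c :: "real \<Rightarrow> 'a::euclidean_space"
  assumes "\<And>t. norm (c t) = 1" "(c has_vector_derivative v) (at 0)"
  shows "c 0 \<bullet> v = 0"
proof -
  have "((\<lambda>t. c t \<bullet> c t) has_vector_derivative (c 0 \<bullet> v + v \<bullet> c 0)) (at 0)"
    by (rule bounded_bilinear.has_vector_derivative[OF bounded_bilinear_inner assms(2) assms(2)])
  moreover have "((\<lambda>t. c t \<bullet> c t) has_vector_derivative 0) (at 0)"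
    using assms(1) by (simp add: dot_square_norm)
  ultimately have "c 0 \<bullet> v + v \<bullet> c 0 = 0" by (rule vector_derivative_unique_at)
  then show ?thesis by (simp add: inner_commute)
qed

lemma nonzero_line:
  fixes a b :: "'c::real_inner"
  assumes "norm a = 1" "a \<bullet> b = 0" shows "a + t *\<^sub>R b \<noteq> 0"
proof
  assume "a + t *\<^sub>R b = 0"
  then have "a \<bullet> (a + t *\<^sub>R b) = 0" by simp
  then show False using assms by (simp add: inner_add_right dot_square_norm)
qed

lemma tangent_space_M_dom:
  fixes y :: "'a::euclidean_space" and z :: "'b::euclidean_space"
  assumes "norm y = 1" "norm z = 1"
  shows "tangent_space M_dom (y, z, u) = {(v, w, s). y \<bullet> v = 0 \<and> z \<bullet> w = 0}"
proof (rule set_eqI, clarify)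
  fix v :: 'a and w :: 'b and s
  show "(v, w, s) \<in> tangent_space M_dom (y, z, u) \<longleftrightarrow> (v, w, s) \<in> {(v, w, s). y \<bullet> v = 0 \<and> z \<bullet> w = 0}"
  proof
    assume "(v, w, s) \<in> tangent_space M_dom (y, z, u)"
    then obtain c where c: "\<And>t. c t \<in> M_dom" "c 0 = (y, z, u)" "(c has_vector_derivative (v, w, s)) (at 0)"
      unfolding tangent_space_def by blast
    have n: "norm (fst (c t)) = 1" "norm (fst (snd (c t))) = 1" for t
      using c(1)[of t] by (auto simp: M_dom_def)
    have "((\<lambda>t. fst (c t)) has_vector_derivative v) (at 0)" "((\<lambda>t. fst (snd (c t))) has_vector_derivative w) (at 0)"
      using bounded_linear.has_vector_derivative[OF bounded_linear_fst c(3)]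
        bounded_linear.has_vector_derivative[OF bounded_linear_fst 
          bounded_linear.has_vector_derivative[OF bounded_linear_snd c(3)]] by simp_all
    from inner_eq_0_of_norm_const[OF n(1) this(1)] inner_eq_0_of_norm_const[OF n(2) this(2)]
    show "(v, w, s) \<in> {(v, w, s). y \<bullet> v = 0 \<and> z \<bullet> w = 0}" by (simp add: c(2))
  next
    assume "(v, w, s) \<in> {(v, w, s). y \<bullet> v = 0 \<and> z \<bullet> w = 0}"
    then have o: "y \<bullet> v = 0" "z \<bullet> w = 0" by auto
    show "(v, w, s) \<in> tangent_space M_dom (y, z, u)"
      unfolding tangent_space_def mem_Collect_eq
    \<comment> \<open>\<open>tangent_space\<close> asks for curves that stay on the manifold for all
      times, so straight lines are projected back to the spheres. They avoid the origin by
      \<open>nonzero_line\<close>.\<close>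
    proof (intro exI[of _ "\<lambda>t. (sgn (y + t *\<^sub>R v), sgn (z + t *\<^sub>R w), u + t * s)"] conjI allI)
      show "(sgn (y + t *\<^sub>R v), sgn (z + t *\<^sub>R w), u + t * s) \<in> M_dom" for t
        using nonzero_line[OF assms(1) o(1), of t] nonzero_line[OF assms(2) o(2), of t] by (simp add: M_dom_iff norm_sgn)
      show "(sgn (y + 0 *\<^sub>R v), sgn (z + 0 *\<^sub>R w), u + 0 * s) = (y, z, u)"
        using assms by (simp add: sgn_div_norm)
      have "((\<lambda>t. u + t * s) has_vector_derivative s) (at 0)"
        by (auto intro!: derivative_eq_intros simp: has_real_derivative_iff_has_vector_derivative[symmetric])
      then show "((\<lambda>t. (sgn (y + t *\<^sub>R v), sgn (z + t *\<^sub>R w), u + t * s)) has_vector_derivative (v, w, s)) (at 0)"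
        by (intro has_vector_derivative_Pair has_vector_derivative_sgn_line assms o)
    qed
  qed
qed

lemma orthonormal_basis_perp:
  fixes y :: "'a::euclidean_space"
  assumes "norm y = 1"
  obtains A where "finite A" "\<And>a. a \<in> A \<Longrightarrow> y \<bullet> a = 0"
    "\<And>a b. a \<in> A \<Longrightarrow> b \<in> A \<Longrightarrow> a \<bullet> b = (if a = b then 1 else 0)"
    "span A = {v. y \<bullet> v = 0}" "card A = DIM('a) - 1"
proof -
  obtain A where A: "A \<subseteq> {v. y \<bullet> v = 0}" "pairwise orthogonal A" "\<And>x. x \<in> A \<Longrightarrow> norm x = 1"
    "independent A" "card A = dim {v. y \<bullet> v = 0}" "span A = {v. y \<bullet> v = 0}"
    using orthonormal_basis_subspace[OF subspace_hyperplane[of y]] by metis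
  moreover have "y \<noteq> 0" using assms by auto
  ultimately show ?thesis
    by (intro that[of A])
       (auto simp: independent_imp_finite dim_hyperplane pairwise_def orthogonal_def dot_square_norm)
qed

section \<open>The induced metric\<close>

locale profile =
  fixes f1 f2 :: "real \<Rightarrow> real"
  assumes f1_smooth: "Cinf_on f1 UNIV" and f2_smooth: "Cinf_on f2 UNIV"
    and unit_speed: "\<And>u. (deriv f1 u)\<^sup>2 + (deriv f2 u)\<^sup>2 = 1"
    and f2_pos: "\<And>u. f2 u > 0" and inside: "\<And>u. (f1 u)\<^sup>2 + (f2 u)\<^sup>2 < 1"
begin

abbreviation "f \<equiv> fun_f f1 f2"
abbreviation "f' \<equiv> deriv f"
abbreviation "f'' \<equiv> deriv f'"
abbreviation "f1' \<equiv> deriv f1"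
abbreviation "f1'' \<equiv> deriv f1'"
abbreviation "f2' \<equiv> deriv f2"
abbreviation "f2'' \<equiv> deriv f2'"
abbreviation "w2 u \<equiv> 1 + (f' u)\<^sup>2"

lemma f_pos: "f u > 0" using inside[of u] by (simp add: fun_f_def)

lemma f_sq: "(f u)\<^sup>2 = 1 - (f1 u)\<^sup>2 - (f2 u)\<^sup>2"
  using inside[of u] by (simp add: fun_f_def)

lemma w2_pos: "w2 u > 0" by (simp add: add_pos_nonneg)

lemma f_smooth: "Cinf_on f UNIV"
  unfolding Cinf_on_def fun_f_def
proof
  fix m
  show "Ck_on m (\<lambda>u. sqrt (1 - (f1 u)\<^sup>2 - (f2 u)\<^sup>2)) UNIV"
  proof (rule Ck_on_compose[OF open_UNIV _ _ Ck_on_sqrt])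
    show "1 - (f1 u)\<^sup>2 - (f2 u)\<^sup>2 \<in> {0<..}" for u using inside[of u] by simp
    show "Ck_on m (\<lambda>u. 1 - (f1 u)\<^sup>2 - (f2 u)\<^sup>2) UNIV"
      by (intro Ck_on_diff Ck_on_power Ck_on_const open_UNIV Cinf_onD f1_smooth f2_smooth)
  qed
qed

lemma profile_DERIV: "(f1 has_real_derivative f1' u) (at u)" "(f2 has_real_derivative f2' u) (at u)"
    "(f has_real_derivative f' u) (at u)"
    "(f1' has_real_derivative f1'' u) (at u)" 
    "(f2' has_real_derivative f2'' u) (at u)"
    "(f' has_real_derivative f'' u) (at u)"
  by (rule Cinf_on_real_derivative[of _ UNIV]; intro Cinf_on_deriv f1_smooth f2_smooth f_smooth open_UNIV UNIV_I)+

lemma unit_speed': "f1' u * f1'' u + f2' u * f2'' u = 0"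
proof -
  have "((\<lambda>u. (f1' u)\<^sup>2 + (f2' u)\<^sup>2) has_real_derivative
      2 * f1' u * f1'' u + 2 * f2' u * f2'' u) (at u)"
    by (rule derivative_eq_intros profile_DERIV refl | simp)+
  then have "((\<lambda>u. 1) has_real_derivative
      2 * f1' u * f1'' u + 2 * f2' u * f2'' u) (at u)"
    by (simp add: unit_speed)
  from DERIV_unique[OF this DERIV_const] show ?thesis by simp
qed

lemma has_derivative_radial:
  assumes "(h has_real_derivative h') (at u)"
  shows "((\<lambda>q. h (snd (snd q))) has_derivative (\<lambda>V. h' * snd (snd V))) (at (y, z, u))"
proof -
  have "((\<lambda>q. snd (snd q)) has_derivative (\<lambda>V. snd (snd V))) (at (y, z, u))"
    by (intro has_derivative_snd has_derivative_ident)
  from has_derivative_compose[OF this, of h "(*) h'"] assms show ?thesis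
    by (simp add: has_field_derivative_def)
qed

lemma has_derivative_immersion:
  "(immersion f1 f2 has_derivative 
     (\<lambda>V. (f u *\<^sub>R fst V + (f' u * snd (snd V)) *\<^sub>R y, f2 u *\<^sub>R fst (snd V) + (f2' u * snd (snd V)) *\<^sub>R z,
           f1' u * snd (snd V)))) (at (y :: 'a::euclidean_space, z :: 'b::euclidean_space, u))"
proof -
  have "((\<lambda>q. (f (snd (snd q)) *\<^sub>R fst q, f2 (snd (snd q)) *\<^sub>R fst (snd q), f1 (snd (snd q)))) has_derivative
     (\<lambda>V. (f (snd (snd (y, z, u))) *\<^sub>R fst V + (f' u * snd (snd V)) *\<^sub>R fst (y, z, u), 
           f2 (snd (snd (y, z, u))) *\<^sub>R fst (snd V) + (f2' u * snd (snd V)) *\<^sub>R fst (snd (y, z, u)),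
           f1' u * snd (snd V)))) (at (y, z, u))"
    by (intro has_derivative_Pair has_derivative_scaleR has_derivative_radial profile_DERIV has_derivative_fst has_derivative_snd has_derivative_ident)
  then show ?thesis unfolding immersion_def case_prod_unfold by simp
qed

lemma dd_immersion:
  "dd (immersion f1 f2) (v, w, s) (y :: 'a::euclidean_space, z :: 'b::euclidean_space, u) =
    (f u *\<^sub>R v + (f' u * s) *\<^sub>R y, f2 u *\<^sub>R w + (f2' u * s) *\<^sub>R z, f1' u * s)"
  by (subst dd_eqI[OF has_derivative_immersion]) simp

lemma differentiable_immersion: "immersion f1 f2 differentiable (at p)"
  using has_derivative_immersion by (cases p) (auto simp: differentiable_def)

lemma tdiff_immersion:
  "p \<in> M_dom \<Longrightarrow> V \<in> tangent_space M_dom p \<Longrightarrow> tdiff M_dom (immersion f1 f2) p V = dd (immersion f1 f2) V p"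
  by (rule tdiff_eq_dd) (auto simp: differentiable_immersion)

lemma induced_metric_immersion:
  fixes y :: "'a::euclidean_space" and z :: "'b::euclidean_space"
  assumes "norm y = 1" "norm z = 1" "y \<bullet> v = 0" "z \<bullet> w = 0" "y \<bullet> v' = 0" "z \<bullet> w' = 0"
  shows "induced_metric M_dom (immersion f1 f2) (y, z, u) (v, w, s) (v', w', s') =
    (f u)\<^sup>2 * (v \<bullet> v') + (f2 u)\<^sup>2 * (w \<bullet> w') + w2 u * (s * s')"
proof -
  have "induced_metric M_dom (immersion f1 f2) (y, z, u) (v, w, s) (v', w', s') =
     dd (immersion f1 f2) (v, w, s) (y, z, u) \<bullet> dd (immersion f1 f2) (v', w', s') (y, z, u)"
    unfolding induced_metric_def
    by (subst (1 2) tdiff_immersion) (use assms in \<open>auto simp: M_dom_iff tangent_space_M_dom\<close>)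
  \<comment> \<open>The coefficient of \<open>s * s'\<close> is the squared speed of the curve (f,
    f2, f1); by \<open>unit_speed\<close> it equals \<open>w2 u\<close>.\<close>
  also have "\<dots> = (f u)\<^sup>2 * (v \<bullet> v') + (f2 u)\<^sup>2 * (w \<bullet> w') + 
      ((f' u)\<^sup>2 + ((f1' u)\<^sup>2 + (f2' u)\<^sup>2)) * (s * s')"
    using assms by (simp add: dd_immersion inner_add_left inner_add_right inner_commute[of v y] inner_commute[of w z] 
       dot_square_norm power2_eq_square algebra_simps)
  finally show ?thesis by (simp add: unit_speed algebra_simps)
qed

text \<open>\<open>gradient\<close> and \<open>covariant_derivative\<close> both pick the vector
  that represents a linear functional in the induced metric; this solves the problem once for both.
  The metric is block diagonal, so \<open>a\<close> and \<open>b\<close> are projected to the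
  tangent spaces and each block is divided by its weight.\<close>

lemma riesz_representative:
  fixes y a :: "'a::euclidean_space" and z b :: "'b::euclidean_space" and c u :: real
  defines "X \<equiv> ((a - (a \<bullet> y) *\<^sub>R y) /\<^sub>R (f u)\<^sup>2, (b - (b \<bullet> z) *\<^sub>R z) /\<^sub>R (f2 u)\<^sup>2, c / w2 u)"
  assumes yz: "norm y = 1" "norm z = 1"
    and L: "\<And>v w s. y \<bullet> v = 0 \<Longrightarrow> z \<bullet> w = 0 \<Longrightarrow> L (v, w, s) = a \<bullet> v + b \<bullet> w + c * s"
  shows "(THE W. W \<in> tangent_space M_dom (y, z, u) \<and> (\<forall>V\<in>tangent_space M_dom (y, z, u).
           induced_metric M_dom (immersion f1 f2) (y, z, u) W V = L V)) = X"
    "X \<in> tangent_space M_dom (y, z, u)"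
    "\<And>V. V \<in> tangent_space M_dom (y, z, u) \<Longrightarrow> induced_metric M_dom (immersion f1 f2) (y, z, u) X V = L V"
proof -
  let ?g = "induced_metric M_dom (immersion f1 f2) (y, z, u)"
  note T = tangent_space_M_dom[OF yz]
  note nz = f_pos[of u] f2_pos[of u] w2_pos[of u]
  have X: "y \<bullet> ((a - (a \<bullet> y) *\<^sub>R y) /\<^sub>R (f u)\<^sup>2) = 0" "z \<bullet> ((b - (b \<bullet> z) *\<^sub>R z) /\<^sub>R (f2 u)\<^sup>2) = 0"
    using yz by (simp_all add: inner_diff_right inner_commute dot_square_norm)
  then show XT: "X \<in> tangent_space M_dom (y, z, u)" by (simp add: T X_def)
  show gX: "?g X V = L V" if "V \<in> tangent_space M_dom (y, z, u)" for V
  proof -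
    obtain v w s where V: "V = (v, w, s)" "y \<bullet> v = 0" "z \<bullet> w = 0" using \<open>V \<in> _\<close> T by auto
    have "?g X V = (a - (a \<bullet> y) *\<^sub>R y) \<bullet> v + (b - (b \<bullet> z) *\<^sub>R z) \<bullet> w + c * s"
      unfolding X_def V(1) using nz
      by (subst induced_metric_immersion[OF yz X V(2,3)]) (simp add: mult.assoc[symmetric])
    then show ?thesis using V L by (simp add: inner_diff_left)
  qed
  show "(THE W. W \<in> tangent_space M_dom (y, z, u) \<and> (\<forall>V\<in>tangent_space M_dom (y, z, u). ?g W V = L V)) = X"
  proof (rule the_equality)
    fix W assume W: "W \<in> tangent_space M_dom (y, z, u) \<and> (\<forall>V\<in>tangent_space M_dom (y, z, u). ?g W V = L V)"
    obtain w1 w2' w3 where We: "W = (w1, w2', w3)" "y \<bullet> w1 = 0" "z \<bullet> w2' = 0" using W T by auto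
    obtain x1 x2 x3 where Xe: "X = (x1, x2, x3)" "y \<bullet> x1 = 0" "z \<bullet> x2 = 0" using XT T by auto
    \<comment> \<open>Testing the difference of two representatives on itself yields three
      nonnegative terms with sum 0, so the difference vanishes.\<close>
    define V where "V = (w1 - x1, w2' - x2, w3 - x3)"
    have VT: "V \<in> tangent_space M_dom (y, z, u)" using We Xe by (simp add: V_def T inner_diff_right)
    have "?g W V - ?g X V = 0" using W VT gX by simp
    then have "(f u)\<^sup>2 * ((w1 - x1) \<bullet> (w1 - x1)) + (f2 u)\<^sup>2 * ((w2' - x2) \<bullet> (w2' - x2)) + w2 u * ((w3 - x3) * (w3 - x3)) = 0"
      unfolding V_def We(1) Xe(1)
      by (subst (asm) (1 2) induced_metric_immersion[OF yz]) (use We Xe in \<open>simp_all add: inner_diff_left inner_diff_right algebra_simps\<close>)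
    moreover have "(f u)\<^sup>2 * ((w1 - x1) \<bullet> (w1 - x1)) \<ge> 0" "(f2 u)\<^sup>2 * ((w2' - x2) \<bullet> (w2' - x2)) \<ge> 0" "w2 u * ((w3 - x3) * (w3 - x3)) \<ge> 0"
      using nz by (simp_all add: zero_le_mult_iff)
    ultimately have "(f u)\<^sup>2 * ((w1 - x1) \<bullet> (w1 - x1)) = 0" "(f2 u)\<^sup>2 * ((w2' - x2) \<bullet> (w2' - x2)) = 0" "w2 u * ((w3 - x3) * (w3 - x3)) = 0"
      by linarith+
    then show "W = X" using nz by (simp add: We Xe)
  qed (use XT gX in auto)
qed

text \<open>The orthogonal projection in the Levi-Civita connection is invisible after pairing with
  a tangent vector, so each summand of the divergence is an ambient derivative paired with the
  differential of the immersion.\<close>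

lemma divergence_summand:
  fixes y :: "'a::euclidean_space" and z :: "'b::euclidean_space"
    and Y :: "'a \<times> 'b \<times> real \<Rightarrow> 'a \<times> 'b \<times> real"
  assumes yz: "norm y = 1" "norm z = 1" and Y: "Y differentiable (at (y, z, u))"
    and XY: "\<And>q. q \<in> M_dom \<Longrightarrow> tdiff M_dom (immersion f1 f2) q (X q) = Y q"
    and e: "e \<in> tangent_space M_dom (y, z, u)"
  shows "induced_metric M_dom (immersion f1 f2) (y, z, u) (covariant_derivative M_dom (immersion f1 f2) X (y, z, u) e) e =
    dd Y e (y, z, u) \<bullet> dd (immersion f1 f2) e (y, z, u)"
proof -
  let ?p = "(y, z, u)" and ?\<phi> = "immersion f1 f2 :: 'a \<times> 'b \<times> real \<Rightarrow> _"
  have p: "?p \<in> M_dom" using yz by (simp add: M_dom_iff)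
  obtain Z1 Z2 Z3 where Z: "dd Y e ?p = (Z1, Z2, Z3)" by (metis prod_cases3)
  have tY: "tdiff M_dom (\<lambda>q. tdiff M_dom ?\<phi> q (X q)) ?p e = dd Y e ?p"
    by (rule tdiff_eq_dd[OF Y _ p e]) (simp add: XY)
  let ?L = "\<lambda>V. tdiff M_dom (\<lambda>q. tdiff M_dom ?\<phi> q (X q)) ?p e \<bullet> tdiff M_dom ?\<phi> ?p V"
  have L: "?L (v, w, s) = (f u *\<^sub>R Z1) \<bullet> v + (f2 u *\<^sub>R Z2) \<bullet> w + 
     (f' u * (Z1 \<bullet> y) + f2' u * (Z2 \<bullet> z) + f1' u * Z3) * s"
    if "y \<bullet> v = 0" "z \<bullet> w = 0" for v w s
  proof -
    have "tdiff M_dom ?\<phi> ?p (v, w, s) = dd ?\<phi> (v, w, s) ?p"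
      by (rule tdiff_immersion[OF p]) (use that in \<open>simp add: tangent_space_M_dom[OF yz]\<close>)
    then show ?thesis unfolding tY Z by (simp add: dd_immersion inner_add_right algebra_simps)
  qed
  show ?thesis
    unfolding covariant_derivative_def
    by (subst riesz_representative(1)[OF yz L], assumption, assumption,
        subst riesz_representative(3)[OF yz L e], assumption, assumption)
       (simp add: tY tdiff_immersion[OF p e])
qed

end

lemma bilinear_inner_linear:
  fixes F G :: "'v::real_vector \<Rightarrow> 'c::real_inner"
  assumes "linear F" "linear G" shows "bilinear (\<lambda>v w. F v \<bullet> G w)"
  using assms
  by (auto simp: bilinear_def linear_add linear_cmul inner_add_left inner_add_right intro!: linearI)

context profile
begin

lemma Ck_on_radial:
  fixes U :: "('a::euclidean_space \<times> 'b::euclidean_space \<times> real) set"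
  assumes "open U" "Cinf_on h UNIV" shows "Ck_on m (\<lambda>q. h (snd (snd q))) U"
  by (rule Ck_on_compose[OF assms(1) _ _ Cinf_onD[OF assms(2)]], rule UNIV_I)
     (intro Ck_on_snd Ck_on_ident assms(1))

text \<open>Euclidean orthonormal bases of the two sphere tangent spaces and the \<open>u\<close>
  direction, rescaled, form a metric orthonormal basis. By independence of the basis, this computes
  the trace of \<open>B\<close> in whichever basis the choice operator returns.\<close>

lemma exists_orthonormal_basis:
  fixes y :: "'a::euclidean_space" and z :: "'b::euclidean_space"
  assumes yz: "norm y = 1" "norm z = 1" and B: "bilinear B"
  obtains A A' where "finite A" "span A = {v. y \<bullet> v = 0}" "card A = DIM('a) - 1"
    "\<And>a b. a \<in> A \<Longrightarrow> b \<in> A \<Longrightarrow> a \<bullet> b = (if a = b then 1 else 0)"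
    "finite A'" "span A' = {v. z \<bullet> v = 0}" "card A' = DIM('b) - 1"
    "\<And>a b. a \<in> A' \<Longrightarrow> b \<in> A' \<Longrightarrow> a \<bullet> b = (if a = b then 1 else 0)"
    "\<And>E. orthonormal_basis M_dom (immersion f1 f2) (y, z, u) E \<Longrightarrow>
      (\<Sum>e\<in>E. B e e) = (\<Sum>a\<in>A. B (a, 0, 0) (a, 0, 0)) / (f u)\<^sup>2 +
        (\<Sum>a\<in>A'. B (0, a, 0) (0, a, 0)) / (f2 u)\<^sup>2 + B (0, 0, 1) (0, 0, 1) / w2 u"
    "\<exists>E. orthonormal_basis M_dom (immersion f1 f2) (y, z, u) E"
proof -
  let ?p = "(y, z, u)" and ?\<phi> = "immersion f1 f2 :: 'a \<times> 'b \<times> real \<Rightarrow> _"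
  obtain A where A: "finite A" "\<And>a. a \<in> A \<Longrightarrow> y \<bullet> a = 0"
    "\<And>a b. a \<in> A \<Longrightarrow> b \<in> A \<Longrightarrow> a \<bullet> b = (if a = b then 1 else 0)"
    "span A = {v. y \<bullet> v = 0}" "card A = DIM('a) - 1"
    using orthonormal_basis_perp[OF yz(1)] by blast
  obtain A' where A': "finite A'" "\<And>a. a \<in> A' \<Longrightarrow> z \<bullet> a = 0"
    "\<And>a b. a \<in> A' \<Longrightarrow> b \<in> A' \<Longrightarrow> a \<bullet> b = (if a = b then 1 else 0)"
    "span A' = {v. z \<bullet> v = 0}" "card A' = DIM('b) - 1"
    using orthonormal_basis_perp[OF yz(2)] by blast
  note T = tangent_space_M_dom[OF yz, of u]
  note nz = f_pos[of u] f2_pos[of u] w2_pos[of u]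
  have p: "?p \<in> M_dom" using yz by (simp add: M_dom_iff)
  \<comment> \<open>Division by the square roots of the three metric weights carries the Euclidean
    inner product of tangent vectors to the induced metric.\<close>
  define S :: "'a \<times> 'b \<times> real \<Rightarrow> 'a \<times> 'b \<times> real" where
    "S V = (fst V /\<^sub>R f u, fst (snd V) /\<^sub>R f2 u, snd (snd V) / sqrt (w2 u))" for V
  define E1 :: "('a \<times> 'b \<times> real) set" where
    "E1 = (\<lambda>a. (a, 0, 0)) ` A \<union> (\<lambda>b. (0, b, 0)) ` A' \<union> {(0, 0, 1)}"
  have linS: "linear S" by (auto simp: S_def scaleR_right_distrib add_divide_distrib intro!: linearI)
  have injS: "inj S" using nz by (auto simp: S_def inj_on_def)
  have Anz: "a \<noteq> 0" if "a \<in> A" for a using A(3)[OF that that] by auto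
  have A'nz: "a \<noteq> 0" if "a \<in> A'" for a using A'(3)[OF that that] by auto
  have E1: "E1 \<subseteq> tangent_space M_dom ?p" using A(2) A'(2) by (auto simp: E1_def T)
  have on1: "e \<bullet> d = (if e = d then 1 else 0)" if "e \<in> E1" "d \<in> E1" for e d
    using that A(3) A'(3) Anz[of 0] A'nz[of 0] unfolding E1_def by (auto split: if_splits)
  have ST: "S V \<in> tangent_space M_dom ?p" if "V \<in> tangent_space M_dom ?p" for V
    using that by (auto simp: T S_def)
  have metS: "induced_metric M_dom ?\<phi> ?p (S V) (S V') = V \<bullet> V'"
    if V: "V \<in> tangent_space M_dom ?p" "V' \<in> tangent_space M_dom ?p" for V V'
  proof -
    obtain a b s a' b' s' where "V = (a, b, s)" "V' = (a', b', s')" by (cases V, cases V')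
    then show ?thesis
      using V nz by (simp add: S_def T induced_metric_immersion[OF yz] power2_eq_square) (simp add: field_simps)
  qed
  define E0 where "E0 = S ` E1"
  have fin: "finite E0" using A A' by (simp add: E0_def E1_def)
  have E0T: "E0 \<subseteq> tangent_space M_dom ?p" using E1 ST by (auto simp: E0_def)
  have subT: "subspace (tangent_space M_dom ?p)"
    by (auto simp: T subspace_def inner_add_right zero_prod_def)
  have span0: "span E0 = tangent_space M_dom ?p"
  proof
    show "span E0 \<subseteq> tangent_space M_dom ?p" by (rule span_minimal[OF E0T subT])
    show "tangent_space M_dom ?p \<subseteq> span E0"
    proof
      fix V assume "V \<in> tangent_space M_dom ?p"
      then obtain v w s where V: "V = (v, w, s)" "y \<bullet> v = 0" "z \<bullet> w = 0" using T by auto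
      have lin: "linear (\<lambda>a. (a, 0, 0) :: 'a \<times> 'b \<times> real)" "linear (\<lambda>b. (0, b, 0) :: 'a \<times> 'b \<times> real)"
        by (auto intro!: linearI)
      have "f u *\<^sub>R v \<in> span A" "f2 u *\<^sub>R w \<in> span A'" using V A(4) A'(4) by auto
      then have "(f u *\<^sub>R v, 0 :: 'b, 0 :: real) \<in> span ((\<lambda>a. (a, 0, 0)) ` A)" "(0 :: 'a, f2 u *\<^sub>R w, 0 :: real) \<in> span ((\<lambda>b. (0, b, 0)) ` A')"
        unfolding linear_span_image[OF lin(1)] linear_span_image[OF lin(2)] by blast+
      then have "(f u *\<^sub>R v, 0, 0) \<in> span E1" "(0, f2 u *\<^sub>R w, 0) \<in> span E1"
        using span_mono[of "(\<lambda>a. (a, 0, 0)) ` A" E1] span_mono[of "(\<lambda>b. (0, b, 0)) ` A'" E1] by (auto simp: E1_def)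
      moreover have "(sqrt (w2 u) * s) *\<^sub>R (0, 0, 1) \<in> span E1" by (intro span_mul span_base) (simp add: E1_def)
      ultimately have "(f u *\<^sub>R v, 0, 0) + (0, f2 u *\<^sub>R w, 0) + (sqrt (w2 u) * s) *\<^sub>R (0, 0, 1) \<in> span E1"
        by (intro span_add)
      then have "S ((f u *\<^sub>R v, 0, 0) + (0, f2 u *\<^sub>R w, 0) + (sqrt (w2 u) * s) *\<^sub>R (0, 0, 1)) \<in> span E0"
        unfolding E0_def linear_span_image[OF linS] by (rule imageI)
      then show "V \<in> span E0" using nz by (simp add: S_def V)
    qed
  qed
  \<comment> \<open>\<open>induced_metric\<close> is controlled only on tangent vectors. This form
    agrees with it there and is bilinear on the whole ambient space, as
    \<open>trace_independent_of_basis\<close> requires.\<close>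
  let ?g = "\<lambda>v w. dd ?\<phi> v ?p \<bullet> dd ?\<phi> w ?p"
  have linphi: "linear (\<lambda>v. dd ?\<phi> v ?p)"
    using has_derivative_linear[OF has_derivative_dd[OF differentiable_immersion]] .
  have g_eq: "?g v w = induced_metric M_dom ?\<phi> ?p v w" if "v \<in> tangent_space M_dom ?p" "w \<in> tangent_space M_dom ?p" for v w
    using that by (simp add: induced_metric_def tdiff_immersion[OF p])
  have onE0: "induced_metric M_dom ?\<phi> ?p e d = (if e = d then 1 else 0)" if "e \<in> E0" "d \<in> E0" for e d
    using that E1 on1 by (auto simp: E0_def metS subset_iff inj_eq[OF injS])
  have E0: "orthonormal_basis M_dom ?\<phi> ?p E0"
    unfolding orthonormal_basis_def using fin span0 E0T onE0 by blast
  have linB: "linear (B v)" "linear (\<lambda>v. B v w)" for v w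
    using B unfolding bilinear_def eta_contract_eq by blast+
  have Bsc: "B (c *\<^sub>R V) (c *\<^sub>R V) = (c * c) * B V V" for c V
    using linear_cmul[OF linB(1), of "c *\<^sub>R V" c V] linear_cmul[OF linB(2), of c V V] by simp
  show ?thesis
  proof (rule that[OF A(1,4,5,3) A'(1,4,5,3)])
    show "\<exists>E. orthonormal_basis M_dom ?\<phi> ?p E" using E0 by blast
    fix E assume E: "orthonormal_basis M_dom ?\<phi> ?p E"
    have "(\<Sum>e\<in>E. B e e) = (\<Sum>e\<in>E0. B e e)"
    proof (rule trace_independent_of_basis[of ?g B])
      show "?g e d = (if e = d then 1 else 0)" if "e \<in> E" "d \<in> E" for e d
      proof -
        have "e \<in> tangent_space M_dom ?p" "d \<in> tangent_space M_dom ?p"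
          using E that unfolding orthonormal_basis_def by blast+
        from g_eq[OF this] show ?thesis using E that unfolding orthonormal_basis_def by simp
      qed
      show "?g e d = (if e = d then 1 else 0)" if "e \<in> E0" "d \<in> E0" for e d
      proof -
        have "e \<in> tangent_space M_dom ?p" "d \<in> tangent_space M_dom ?p"
          using that E0T by blast+
        from g_eq[OF this] show ?thesis using onE0[OF that] by simp
      qed
      show "span E = span E0" using E E0 unfolding orthonormal_basis_def by simp
      show "bilinear ?g" by (rule bilinear_inner_linear[OF linphi linphi])
      show "finite E" using E unfolding orthonormal_basis_def by simp
      show "?g v w = ?g w v" for v w by (rule inner_commute)
    qed (use B fin in auto)
    also have "\<dots> = (\<Sum>e\<in>E1. B (S e) (S e))"
      unfolding E0_def using injS by (simp add: sum.reindex inj_on_subset)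
    also have "\<dots> = (\<Sum>e\<in>(\<lambda>a. (a, 0, 0)) ` A. B (S e) (S e)) + (\<Sum>e\<in>(\<lambda>b. (0, b, 0)) ` A'. B (S e) (S e)) +
        B (S (0, 0, 1)) (S (0, 0, 1))"
    proof -
      have "(\<lambda>a. (a, 0, 0 :: real)) ` A \<inter> (\<lambda>b. (0, b, 0)) ` A' = {}" 
        "((\<lambda>a. (a, 0, 0)) ` A \<union> (\<lambda>b. (0, b, 0)) ` A') \<inter> {(0, 0, 1::real)} = {}"
        using Anz A'nz by auto
      then show ?thesis unfolding E1_def using A(1) A'(1) by (subst sum.union_disjoint; simp)+
    qed
    also have "\<dots> = (\<Sum>a\<in>A. B (S (a, 0, 0)) (S (a, 0, 0))) + (\<Sum>a\<in>A'. B (S (0, a, 0)) (S (0, a, 0))) +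
        B (S (0, 0, 1)) (S (0, 0, 1))"
      by (simp add: sum.reindex inj_on_def)
    also have "\<dots> = (\<Sum>a\<in>A. B (a, 0, 0) (a, 0, 0)) / (f u)\<^sup>2 +
        (\<Sum>a\<in>A'. B (0, a, 0) (0, a, 0)) / (f2 u)\<^sup>2 + B (0, 0, 1) (0, 0, 1) / w2 u"
    proof -
      have "S (a, 0, 0) = inverse (f u) *\<^sub>R (a, 0, 0)" "S (0, b, 0) = inverse (f2 u) *\<^sub>R (0, b, 0)"
        "S (0, 0, 1) = inverse (sqrt (w2 u)) *\<^sub>R (0, 0, 1)" for a b
        by (simp_all add: S_def divide_inverse)
      moreover have "inverse (sqrt (w2 u)) * inverse (sqrt (w2 u)) = inverse (w2 u)"
        using nz by (metis inverse_mult_distrib less_imp_le real_sqrt_mult_self abs_of_pos)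
      ultimately show ?thesis
        unfolding Bsc sum_distrib_left[symmetric] 
        by (simp only: Bsc sum_distrib_left[symmetric]) (simp add: divide_inverse power2_eq_square mult.commute)
    qed
    finally show "(\<Sum>e\<in>E. B e e) = \<dots>" .
  qed
qed

end

section \<open>The Laplacian\<close>

definition laplace_x :: "('a::euclidean_space \<times> 'b::euclidean_space \<times> real \<Rightarrow> real) \<Rightarrow> 'a \<times> 'b \<times> real \<Rightarrow> real" where
  "laplace_x Z q = (\<Sum>b\<in>Basis. dd (dd Z (b, 0, 0)) (b, 0, 0) q)"

definition laplace_y :: "('a::euclidean_space \<times> 'b::euclidean_space \<times> real \<Rightarrow> real) \<Rightarrow> 'a \<times> 'b \<times> real \<Rightarrow> real" where
  "laplace_y Z q = (\<Sum>b\<in>Basis. dd (dd Z (0, b, 0)) (0, b, 0) q)"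

definition grad_x :: "('a::euclidean_space \<times> 'b::euclidean_space \<times> real \<Rightarrow> real) \<Rightarrow> 'a \<times> 'b \<times> real \<Rightarrow> 'a" where
  "grad_x Z q = (\<Sum>b\<in>Basis. dd Z (b, 0, 0) q *\<^sub>R b)"

definition grad_y :: "('a::euclidean_space \<times> 'b::euclidean_space \<times> real \<Rightarrow> real) \<Rightarrow> 'a \<times> 'b \<times> real \<Rightarrow> 'b" where
  "grad_y Z q = (\<Sum>b\<in>Basis. dd Z (0, b, 0) q *\<^sub>R b)"

lemma inner_grad:
  assumes "Z differentiable (at q)"
  shows "grad_x Z q \<bullet> v = dd Z (v, 0, 0) q" "grad_y Z q \<bullet> w = dd Z (0, w, 0) q"
proof -
  have lin: "linear (\<lambda>V. dd Z V q)" using has_derivative_linear[OF has_derivative_dd[OF assms]] .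
  have l1: "linear (\<lambda>v. dd Z (v, 0, 0) q)" and l2: "linear (\<lambda>w. dd Z (0, w, 0) q)"
    using linear_add[OF lin, of "(_, 0, 0)" "(_, 0, 0)"] linear_cmul[OF lin, of _ "(_, 0, 0)"]
      linear_add[OF lin, of "(0, _, 0)" "(0, _, 0)"] linear_cmul[OF lin, of _ "(0, _, 0)"]
    by (auto intro!: linearI)
  have "dd Z (\<Sum>b\<in>Basis. (v \<bullet> b) *\<^sub>R b, 0, 0) q = (\<Sum>b\<in>Basis. (v \<bullet> b) * dd Z (b, 0, 0) q)"
    unfolding linear_sum[OF l1] by (simp add: linear_cmul[OF l1])
  then show "grad_x Z q \<bullet> v = dd Z (v, 0, 0) q"
    by (simp only: euclidean_representation) (simp add: grad_x_def inner_sum_left inner_sum_right inner_commute mult.commute)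
  have "dd Z (0, \<Sum>b\<in>Basis. (w \<bullet> b) *\<^sub>R b, 0) q = (\<Sum>b\<in>Basis. (w \<bullet> b) * dd Z (0, b, 0) q)"
    unfolding linear_sum[OF l2] by (simp add: linear_cmul[OF l2])
  then show "grad_y Z q \<bullet> w = dd Z (0, w, 0) q"
    by (simp only: euclidean_representation) (simp add: grad_y_def inner_sum_left inner_sum_right inner_commute mult.commute)
qed

locale homogeneous =
  fixes Z :: "'a::euclidean_space \<times> 'b::euclidean_space \<times> real \<Rightarrow> real"
  assumes smooth: "Cinf_on Z dom3"
    and hom: "\<And>x y u r s. x \<noteq> 0 \<Longrightarrow> y \<noteq> 0 \<Longrightarrow> r > 0 \<Longrightarrow> s > 0 \<Longrightarrow> Z (r *\<^sub>R x, s *\<^sub>R y, u) = Z (x, y, u)"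
begin

abbreviation "Zu \<equiv> dd Z (0, 0, 1)"
abbreviation "Zuu \<equiv> dd Zu (0, 0, 1)"

lemma diff: "q \<in> dom3 \<Longrightarrow> Z differentiable (at q)"
  by (rule Cinf_on_differentiable[OF smooth])

lemma diff2: "q \<in> dom3 \<Longrightarrow> dd Z V differentiable (at q)"
  by (rule Cinf_on_differentiable[OF Cinf_on_dd[OF smooth]])

text \<open>Meant for \<open>V\<close> equal to the position vector of one sphere variable: then
  \<open>q + s *\<^sub>R V\<close> runs along a ray, and the bound -1 is the parameter at which the
  ray reaches the origin.\<close>

lemma derivative_of_constant_line:
  assumes "\<And>s. s > -1 \<Longrightarrow> q + s *\<^sub>R V \<in> dom3" "\<And>s. s > -1 \<Longrightarrow> Z (q + s *\<^sub>R V) = Z q"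
  shows "dd Z V q = 0" "dd (dd Z V) V q = 0"
proof -
  have z: "dd Z V (q + s *\<^sub>R V) = 0" if s: "s > -1" for s
  proof -
    have "((\<lambda>s. Z (q + s *\<^sub>R V)) has_vector_derivative 0) (at s)"
      by (rule has_vector_derivative_transform_within_open[of "\<lambda>s. Z q" _ _ "{-1<..}"])
         (use s assms(2) in auto)
    with has_vector_derivative_line[OF diff[OF assms(1)[OF s]]] show ?thesis
      by (rule vector_derivative_unique_at)
  qed
  show "dd Z V q = 0" using z[of 0] by simp
  have "((\<lambda>s. dd Z V (q + s *\<^sub>R V)) has_vector_derivative 0) (at 0)"
    by (rule has_vector_derivative_transform_within_open[of "\<lambda>s. 0" _ _ "{-1<..}"]) (use z in auto)
  moreover have "q \<in> dom3" using assms(1)[of 0] by simp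
  ultimately show "dd (dd Z V) V q = 0"
    using vector_derivative_unique_at[OF has_vector_derivative_line0[OF diff2]] by blast
qed

lemma radial_derivative:
  assumes "x \<noteq> 0" "y \<noteq> 0"
  shows "dd Z (x, 0, 0) (x, y, u) = 0" "dd (dd Z (x, 0, 0)) (x, 0, 0) (x, y, u) = 0"
    "dd Z (0, y, 0) (x, y, u) = 0" "dd (dd Z (0, y, 0)) (0, y, 0) (x, y, u) = 0"
proof -
  have e: "(x, y, u) + s *\<^sub>R (x, 0, 0) = ((1 + s) *\<^sub>R x, y, u)" "(x, y, u) + s *\<^sub>R (0, y, 0) = (x, (1 + s) *\<^sub>R y, u)" for s
    by (simp_all add: scaleR_add_left)
  have x: "Z ((x, y, u) + s *\<^sub>R (x, 0, 0)) = Z (x, y, u)" and y: "Z ((x, y, u) + s *\<^sub>R (0, y, 0)) = Z (x, y, u)"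
    if "s > -1" for s
    unfolding e using hom[OF assms, of "1 + s" 1 u] hom[OF assms, of 1 "1 + s" u] that by simp_all
  have d: "(x, y, u) + s *\<^sub>R (x, 0, 0) \<in> dom3" "(x, y, u) + s *\<^sub>R (0, y, 0) \<in> dom3" if "s > -1" for s
    unfolding e using assms that by (simp_all add: mem_dom3)
  show "dd Z (x, 0, 0) (x, y, u) = 0" "dd (dd Z (x, 0, 0)) (x, 0, 0) (x, y, u) = 0"
    "dd Z (0, y, 0) (x, y, u) = 0" "dd (dd Z (0, y, 0)) (0, y, 0) (x, y, u) = 0"
    using derivative_of_constant_line[OF d(1) x] derivative_of_constant_line[OF d(2) y] by simp_all
qed

lemma deriv_u:
  assumes "x \<noteq> 0" "y \<noteq> 0"
  shows "deriv (\<lambda>u. Z (x, y, u)) = (\<lambda>u. Zu (x, y, u))"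
    "deriv (\<lambda>u. Zu (x, y, u)) = (\<lambda>u. Zuu (x, y, u))"
proof -
  have q: "(x, y, v) \<in> dom3" for v using assms by (simp add: mem_dom3)
  have 1: "((\<lambda>u. F (x, y, u)) has_real_derivative dd F (0, 0, 1) (x, y, v)) (at v)" 
    if "F differentiable (at (x, y, v))" for F v
    using has_vector_derivative_line[of F "(x, y, 0)" v "(0, 0, 1)"] that
    by (simp add: has_real_derivative_iff_has_vector_derivative)
  show "deriv (\<lambda>u. Z (x, y, u)) = (\<lambda>u. Zu (x, y, u))"
    by (intro ext DERIV_imp_deriv 1 diff q)
  show "deriv (\<lambda>u. Zu (x, y, u)) = (\<lambda>u. Zuu (x, y, u))"
    by (intro ext DERIV_imp_deriv 1 diff2 q)
qed

lemma continuous_on_laplace: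
  "continuous_on dom3 (laplace_x Z)" "continuous_on dom3 (laplace_y Z)"
proof -
  have c: "continuous_on dom3 (dd (dd Z V) W)" for V W
    by (rule Ck_on_continuous[OF Cinf_onD[OF Cinf_on_dd[OF Cinf_on_dd[OF smooth]]]])
  show "continuous_on dom3 (laplace_x Z)" "continuous_on dom3 (laplace_y Z)"
    unfolding laplace_x_def[abs_def] laplace_y_def[abs_def] by (intro continuous_on_sum c)+
qed

text \<open>A degree 0 function is constant along rays, so the radial entry of its Hessian is 0 and
  \<open>trace_perp\<close> loses nothing.\<close>

lemma trace_hessian:
  assumes "norm y = 1" "norm z = 1"
  shows "finite A \<Longrightarrow> span A = {v. y \<bullet> v = 0} \<Longrightarrow>
     (\<And>a b. a \<in> A \<Longrightarrow> b \<in> A \<Longrightarrow> a \<bullet> b = (if a = b then 1 else 0)) \<Longrightarrow>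
     (\<Sum>a\<in>A. dd (dd Z (a, 0, 0)) (a, 0, 0) (y, z, u)) = laplace_x Z (y, z, u)"
    "finite A' \<Longrightarrow> span A' = {v. z \<bullet> v = 0} \<Longrightarrow>
     (\<And>a b. a \<in> A' \<Longrightarrow> b \<in> A' \<Longrightarrow> a \<bullet> b = (if a = b then 1 else 0)) \<Longrightarrow>
     (\<Sum>a\<in>A'. dd (dd Z (0, a, 0)) (0, a, 0) (y, z, u)) = laplace_y Z (y, z, u)"
proof -
  have yz: "y \<noteq> 0" "z \<noteq> 0" using assms by auto
  have H: "bilinear (\<lambda>v w. dd (dd Z v) w (y, z, u))"
    by (rule bilinear_hessian[OF open_dom3 _ Cinf_onD[OF smooth]]) (use yz in \<open>simp add: mem_dom3\<close>)
  then have lin: "linear (\<lambda>v. dd (dd Z v) w (y, z, u))" "linear (\<lambda>w. dd (dd Z v) w (y, z, u))" for v w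
    unfolding bilinear_def by blast+
  have Hx: "bilinear (\<lambda>v w. dd (dd Z (v, 0, 0)) (w, 0, 0) (y, z, u))"
    using linear_add[OF lin(1), of "(_, 0, 0)" "(_, 0, 0)"] linear_cmul[OF lin(1), of _ "(_, 0, 0)"]
      linear_add[OF lin(2), of _ "(_, 0, 0)" "(_, 0, 0)"] linear_cmul[OF lin(2), of _ _ "(_, 0, 0)"]
    by (auto simp: bilinear_def intro!: linearI)
  have Hy: "bilinear (\<lambda>v w. dd (dd Z (0, v, 0)) (0, w, 0) (y, z, u))"
    using linear_add[OF lin(1), of "(0, _, 0)" "(0, _, 0)"] linear_cmul[OF lin(1), of _ "(0, _, 0)"]
      linear_add[OF lin(2), of _ "(0, _, 0)" "(0, _, 0)"] linear_cmul[OF lin(2), of _ _ "(0, _, 0)"]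
    by (auto simp: bilinear_def intro!: linearI)
  show "(\<Sum>a\<in>A. dd (dd Z (a, 0, 0)) (a, 0, 0) (y, z, u)) = laplace_x Z (y, z, u)"
    if "finite A" "span A = {v. y \<bullet> v = 0}" "\<And>a b. a \<in> A \<Longrightarrow> b \<in> A \<Longrightarrow> a \<bullet> b = (if a = b then 1 else 0)"
    using trace_perp[OF assms(1) that Hx] radial_derivative(2)[OF yz] by (simp add: laplace_x_def)
  show "(\<Sum>a\<in>A'. dd (dd Z (0, a, 0)) (0, a, 0) (y, z, u)) = laplace_y Z (y, z, u)"
    if "finite A'" "span A' = {v. z \<bullet> v = 0}" "\<And>a b. a \<in> A' \<Longrightarrow> b \<in> A' \<Longrightarrow> a \<bullet> b = (if a = b then 1 else 0)"
    using trace_perp[OF assms(2) that Hy] radial_derivative(4)[OF yz] by (simp add: laplace_y_def)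
qed

end

locale profile_function = profile f1 f2 + homogeneous Z
  for f1 f2 and Z :: "'a::euclidean_space \<times> 'b::euclidean_space \<times> real \<Rightarrow> real"
begin

text \<open>\<open>Y\<close> is \<open>d\<phi> (\<nabla>Z)\<close>, extended from \<open>M_dom\<close> to a neighbourhood so that it can be differentiated.\<close>

definition XU :: "'a \<times> 'b \<times> real \<Rightarrow> real" where
  "XU q = Zu q / w2 (snd (snd q))"

definition Y :: "'a \<times> 'b \<times> real \<Rightarrow> 'a \<times> 'b \<times> real" where
  "Y q = ((1 / f (snd (snd q))) *\<^sub>R grad_x Z q + (XU q * f' (snd (snd q))) *\<^sub>R fst q,
          (1 / f2 (snd (snd q))) *\<^sub>R grad_y Z q + (XU q * f2' (snd (snd q))) *\<^sub>R fst (snd q),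
          XU q * f1' (snd (snd q)))"

lemma Ck_on_XU: "Ck_on m XU dom3"
proof -
  have "Ck_on m (\<lambda>q. f' (snd (snd q))) (dom3 :: ('a \<times> 'b \<times> real) set)"
    by (intro Ck_on_radial open_dom3 Cinf_on_deriv f_smooth open_UNIV)
  then show ?thesis
    unfolding XU_def using w2_pos
    by (intro Ck_on_divide Ck_on_add Ck_on_power Ck_on_const open_dom3 Cinf_onD[OF Cinf_on_dd[OF smooth]])
       (auto simp: less_le)
qed

lemma Ck_on_Y: "Ck_on m Y dom3"
proof -
  have r: "Ck_on m (\<lambda>q. h (snd (snd q))) (dom3 :: ('a \<times> 'b \<times> real) set)" if "Cinf_on h UNIV" for h
    by (intro Ck_on_radial open_dom3 that)
  show ?thesis
    unfolding Y_def grad_x_def grad_y_def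
    using f_pos f2_pos
    by (intro Ck_on_Pair Ck_on_add Ck_on_scaleR Ck_on_mult Ck_on_divide Ck_on_sum Ck_on_const Ck_on_fst Ck_on_snd Ck_on_ident
        open_dom3 r Ck_on_XU Cinf_on_deriv f_smooth f1_smooth f2_smooth open_UNIV Cinf_onD[OF Cinf_on_dd[OF smooth]])
       (auto simp: less_le)
qed

lemma gradient_formula:
  assumes yz: "norm y = 1" "norm z = 1" and \<zeta>: "\<And>q. q \<in> M_dom \<Longrightarrow> Z q = \<zeta> q"
  shows "gradient M_dom (immersion f1 f2) \<zeta> (y, z, u) =
     (grad_x Z (y, z, u) /\<^sub>R (f u)\<^sup>2, grad_y Z (y, z, u) /\<^sub>R (f2 u)\<^sup>2, XU (y, z, u))"
proof -
  let ?p = "(y, z, u)"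
  have p: "?p \<in> M_dom" "?p \<in> dom3" using yz M_dom_subset_dom3 by (auto simp: M_dom_iff)
  have nz: "y \<noteq> 0" "z \<noteq> 0" using yz by auto
  note d = diff[OF p(2)]
  have L: "tdiff M_dom \<zeta> ?p (v, w, s) = grad_x Z ?p \<bullet> v + grad_y Z ?p \<bullet> w + Zu ?p * s"
    if "y \<bullet> v = 0" "z \<bullet> w = 0" for v w s
  proof -
    have lin: "linear (\<lambda>V. dd Z V ?p)" using has_derivative_linear[OF has_derivative_dd[OF d]] .
    have "tdiff M_dom \<zeta> ?p (v, w, s) = dd Z (v, w, s) ?p"
      by (rule tdiff_eq_dd[OF d \<zeta> p(1)]) (use that in \<open>simp_all add: tangent_space_M_dom[OF yz]\<close>)
    also have "(v, w, s) = (v, 0, 0) + (0, w, 0) + s *\<^sub>R (0, 0, 1)" by simp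
    also have "dd Z ((v, 0, 0) + (0, w, 0) + s *\<^sub>R (0, 0, 1)) ?p = dd Z (v, 0, 0) ?p + dd Z (0, w, 0) ?p + s * Zu ?p"
      unfolding linear_add[OF lin] linear_cmul[OF lin] by simp
    finally show ?thesis by (simp add: inner_grad[OF d] mult.commute)
  qed
  \<comment> \<open>By homogeneity the Euclidean partial gradients are already tangent to the
    spheres, so the projections in \<open>riesz_representative\<close> leave them unchanged.\<close>
  have "grad_x Z ?p \<bullet> y = 0" "grad_y Z ?p \<bullet> z = 0"
    by (simp_all add: inner_grad[OF d] radial_derivative[OF nz])
  then show ?thesis
    unfolding gradient_def
    by (subst riesz_representative(1)[OF yz L]) (simp_all add: XU_def)
qed

lemma tdiff_gradient:
  assumes q: "q \<in> M_dom" and \<zeta>: "\<And>q. q \<in> M_dom \<Longrightarrow> Z q = \<zeta> q"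
  shows "tdiff M_dom (immersion f1 f2) q (gradient M_dom (immersion f1 f2) \<zeta> q) = Y q"
proof -
  obtain y z u where qe: "q = (y, z, u)" by (cases q)
  have yz: "norm y = 1" "norm z = 1" using q by (auto simp: qe M_dom_iff)
  have nz: "y \<noteq> 0" "z \<noteq> 0" using yz by auto
  have d: "Z differentiable (at (y, z, u))" using diff nz by (simp add: mem_dom3)
  have gr: "gradient M_dom (immersion f1 f2) \<zeta> q =
     (grad_x Z q /\<^sub>R (f u)\<^sup>2, grad_y Z q /\<^sub>R (f2 u)\<^sup>2, XU q)"
    unfolding qe by (rule gradient_formula[OF yz \<zeta>])
  have "grad_x Z q \<bullet> y = 0" "grad_y Z q \<bullet> z = 0"
    unfolding qe by (simp_all add: inner_grad[OF d] radial_derivative[OF nz])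
  then have T: "gradient M_dom (immersion f1 f2) \<zeta> q \<in> tangent_space M_dom q"
    unfolding gr unfolding qe tangent_space_M_dom[OF yz] by (simp add: inner_commute)
  have "(f u) * inverse ((f u)\<^sup>2) = 1 / f u" "(f2 u) * inverse ((f2 u)\<^sup>2) = 1 / f2 u"
    using f_pos[of u] f2_pos[of u] by (simp_all add: power2_eq_square field_simps)
  then show ?thesis
    unfolding tdiff_immersion[OF q T] unfolding gr unfolding qe dd_immersion Y_def
    by (simp add: mult.commute)
qed

lemma Y_line_derivative:
  assumes "p \<in> dom3" and h: "\<And>t. Y (p + t *\<^sub>R V) \<bullet> c = h t" "(h has_real_derivative h') (at 0)"
  shows "dd Y V p \<bullet> c = h'"
proof -
  have "Y differentiable (at p)" using Ck_on_differentiable[OF Ck_on_Y assms(1)] .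
  from bounded_linear.has_vector_derivative[OF bounded_linear_inner_left has_vector_derivative_line0[OF this], of V c]
  have "((\<lambda>t. Y (p + t *\<^sub>R V) \<bullet> c) has_real_derivative dd Y V p \<bullet> c) (at 0)"
    unfolding has_real_derivative_iff_has_vector_derivative .
  then have "(h has_real_derivative dd Y V p \<bullet> c) (at 0)"
    unfolding h(1) by (simp add: eta_contract_eq)
  then show ?thesis using h(2) DERIV_unique by blast
qed

lemma real_line_derivative:
  assumes "F differentiable (at p)"
  shows "((\<lambda>t. F (p + t *\<^sub>R V)) has_real_derivative dd F V p) (at 0)"
  using has_vector_derivative_line0[OF assms, of V] by (simp add: has_real_derivative_iff_has_vector_derivative)

text \<open>\<open>Y\<close> contains the position vector multiplied by \<open>XU * f'\<close>. Its
  derivative along a tangent direction \<open>a\<close> returns the multiple \<open>XU * f'\<close>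
  of \<open>a\<close>, which is the source of the warping term \<open>f * f' * XU\<close>; the
  second sphere is analogous.\<close>

lemma divergence_terms:
  fixes u :: real
  assumes yz: "norm y = 1" "norm z = 1"
  defines "p \<equiv> (y, z, u)" and "\<phi> \<equiv> immersion f1 f2 :: 'a \<times> 'b \<times> real \<Rightarrow> _"
  shows "y \<bullet> a = 0 \<Longrightarrow> a \<bullet> a = 1 \<Longrightarrow> dd Y (a, 0, 0) p \<bullet> dd \<phi> (a, 0, 0) p =
      dd (dd Z (a, 0, 0)) (a, 0, 0) p + f u * f' u * XU p"
    "z \<bullet> b = 0 \<Longrightarrow> b \<bullet> b = 1 \<Longrightarrow> dd Y (0, b, 0) p \<bullet> dd \<phi> (0, b, 0) p =
      dd (dd Z (0, b, 0)) (0, b, 0) p + f2 u * f2' u * XU p"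
    "dd Y (0, 0, 1) p \<bullet> dd \<phi> (0, 0, 1) p = 
      Zuu p - f' u * f'' u * XU p"
proof -
  have nz: "y \<noteq> 0" "z \<noteq> 0" using yz by auto
  have p: "p \<in> dom3" using nz by (simp add: p_def mem_dom3)
  have dXU: "XU differentiable (at p)" using Ck_on_differentiable[OF Ck_on_XU p] .
  note fp = f_pos[of u] f2_pos[of u]
  show "dd Y (a, 0, 0) p \<bullet> dd \<phi> (a, 0, 0) p = dd (dd Z (a, 0, 0)) (a, 0, 0) p + f u * f' u * XU p"
    if a: "y \<bullet> a = 0" "a \<bullet> a = 1"
  proof (rule Y_line_derivative[OF p])
    let ?q = "\<lambda>t. p + t *\<^sub>R (a, 0, 0)"
    fix t
    have q: "?q t \<in> dom3" using nonzero_line[OF yz(1) a(1)] nz by (simp add: p_def mem_dom3)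
    have "Y (?q t) \<bullet> dd \<phi> (a, 0, 0) p =
       f u * (1 / f u * (grad_x Z (?q t) \<bullet> a) + XU (?q t) * f' u * ((y + t *\<^sub>R a) \<bullet> a))"
      by (simp add: Y_def p_def \<phi>_def dd_immersion inner_add_left)
    also have "(y + t *\<^sub>R a) \<bullet> a = t" using a by (simp add: inner_add_left)
    also have "grad_x Z (?q t) \<bullet> a = dd Z (a, 0, 0) (?q t)" by (rule inner_grad[OF diff[OF q]])
    finally show "Y (?q t) \<bullet> dd \<phi> (a, 0, 0) p = dd Z (a, 0, 0) (?q t) + f u * f' u * (XU (?q t) * t)"
      using fp by (simp add: distrib_left ac_simps)
  next
    show "((\<lambda>t. dd Z (a, 0, 0) (p + t *\<^sub>R (a, 0, 0)) + f u * f' u * (XU (p + t *\<^sub>R (a, 0, 0)) * t))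
       has_real_derivative dd (dd Z (a, 0, 0)) (a, 0, 0) p + f u * f' u * XU p) (at 0)"
      by (rule derivative_eq_intros real_line_derivative[OF diff2[OF p]] real_line_derivative[OF dXU] refl)+ (simp add: zero_prod_def[symmetric])
  qed
  show "dd Y (0, b, 0) p \<bullet> dd \<phi> (0, b, 0) p = dd (dd Z (0, b, 0)) (0, b, 0) p + f2 u * f2' u * XU p"
    if b: "z \<bullet> b = 0" "b \<bullet> b = 1"
  proof (rule Y_line_derivative[OF p])
    let ?q = "\<lambda>t. p + t *\<^sub>R (0, b, 0)"
    fix t
    have q: "?q t \<in> dom3" using nonzero_line[OF yz(2) b(1)] nz by (simp add: p_def mem_dom3)
    have "Y (?q t) \<bullet> dd \<phi> (0, b, 0) p =
       f2 u * (1 / f2 u * (grad_y Z (?q t) \<bullet> b) + XU (?q t) * f2' u * ((z + t *\<^sub>R b) \<bullet> b))"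
      by (simp add: Y_def p_def \<phi>_def dd_immersion inner_add_left)
    also have "(z + t *\<^sub>R b) \<bullet> b = t" using b by (simp add: inner_add_left)
    also have "grad_y Z (?q t) \<bullet> b = dd Z (0, b, 0) (?q t)" by (rule inner_grad[OF diff[OF q]])
    finally show "Y (?q t) \<bullet> dd \<phi> (0, b, 0) p = dd Z (0, b, 0) (?q t) + f2 u * f2' u * (XU (?q t) * t)"
      using fp by (simp add: distrib_left ac_simps)
  next
    show "((\<lambda>t. dd Z (0, b, 0) (p + t *\<^sub>R (0, b, 0)) + f2 u * f2' u * (XU (p + t *\<^sub>R (0, b, 0)) * t))
       has_real_derivative dd (dd Z (0, b, 0)) (0, b, 0) p + f2 u * f2' u * XU p) (at 0)"
      by (rule derivative_eq_intros real_line_derivative[OF diff2[OF p]] real_line_derivative[OF dXU] refl)+ (simp add: zero_prod_def[symmetric])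
  qed
  have sh: "((\<lambda>t. h (u + t)) has_real_derivative h') (at 0)" if "(h has_real_derivative h') (at u)" for h h'
    using that DERIV_shift[of h h' 0 u] by (simp add: add.commute)
  have XUp: "((\<lambda>t. XU (p + t *\<^sub>R (0, 0, 1))) has_real_derivative 
      Zuu p / w2 u - 2 * f' u * f'' u * XU p / w2 u) (at 0)"
  proof -
    have w: "((\<lambda>t. w2 (u + t)) has_real_derivative 2 * f' u * f'' u) (at 0)"
      by (rule derivative_eq_intros sh[OF profile_DERIV(6)] refl)+ simp
    have W: "w2 (u + 0) = w2 u" "w2 u \<noteq> 0" "p + 0 *\<^sub>R (0, 0, 1) = p" using w2_pos[of u] by (simp_all add: zero_prod_def[symmetric])
    have "((\<lambda>t. Zu (p + t *\<^sub>R (0, 0, 1)) / w2 (u + t)) has_real_derivative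
       (Zuu p * w2 u - Zu p * (2 * f' u * f'' u)) / (w2 u * w2 u)) (at 0)"
      using DERIV_divide[OF real_line_derivative[OF diff2[OF p], of "(0, 0, 1)" "(0, 0, 1)"] w] W by simp
    also have "(Zuu p * w2 u - Zu p * (2 * f' u * f'' u)) / (w2 u * w2 u) =
       Zuu p / w2 u - 2 * f' u * f'' u * XU p / w2 u"
      using W(2) by (simp add: XU_def p_def diff_divide_distrib mult.commute)
    finally have "((\<lambda>t. Zu (p + t *\<^sub>R (0, 0, 1)) / w2 (u + t)) has_real_derivative
       Zuu p / w2 u - 2 * f' u * f'' u * XU p / w2 u) (at 0)" .
    then show ?thesis by (simp add: XU_def p_def)
  qed
  show "dd Y (0, 0, 1) p \<bullet> dd \<phi> (0, 0, 1) p = 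
      Zuu p - f' u * f'' u * XU p"
  proof (rule Y_line_derivative[OF p])
    let ?q = "\<lambda>t. p + t *\<^sub>R (0, 0, 1)"
    fix t
    have q: "?q t \<in> dom3" "?q t = (y, z, u + t)" using nz by (auto simp: p_def mem_dom3)
    have "grad_x Z (?q t) \<bullet> y = 0" "grad_y Z (?q t) \<bullet> z = 0"
      using inner_grad[OF diff[OF q(1)]] radial_derivative[OF nz] q(2) by simp_all
    then show "Y (?q t) \<bullet> dd \<phi> (0, 0, 1) p = XU (?q t) * 
        (f' (u + t) * f' u + f2' (u + t) * f2' u + f1' (u + t) * f1' u)"
      using yz by (simp add: Y_def p_def \<phi>_def dd_immersion inner_add_left dot_square_norm algebra_simps)
  next
    \<comment> \<open>The derivative of the velocity vector contributes +1 times
      \<open>f' u * f'' u * XU p\<close>, and the derivative of 1 / \<open>w2\<close> inside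
      \<open>XU\<close> contributes -2 times it. The terms from \<open>f1\<close> and
      \<open>f2\<close> drop out because a unit speed curve has acceleration orthogonal to its
      velocity.\<close>
    have e: "XU p * (f'' u * f' u + f2'' u * f2' u + f1'' u * f1' u) +
       (Zuu p / w2 u - 2 * f' u * f'' u * XU p / w2 u) * 
        (f' u * f' u + f2' u * f2' u + f1' u * f1' u) = 
        Zuu p - f' u * f'' u * XU p" (is "XU p * ?s1 + (?m / w2 u - ?n / w2 u) * ?s2 = _")
    proof -
      have e1: "?s1 = f'' u * f' u" using unit_speed'[of u] by (simp add: algebra_simps)
      have e2: "?s2 = w2 u" using unit_speed[of u] by (simp add: power2_eq_square)
      have e3: "(?m / w2 u - ?n / w2 u) * w2 u = ?m - ?n" 
        using w2_pos[of u] by (simp add: diff_divide_distrib[symmetric])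
      show ?thesis unfolding e1 e2 e3 by (simp add: algebra_simps)
    qed
    show "((\<lambda>t. XU (p + t *\<^sub>R (0, 0, 1)) * 
        (f' (u + t) * f' u + f2' (u + t) * f2' u + f1' (u + t) * f1' u))
       has_real_derivative Zuu p - f' u * f'' u * XU p) (at 0)"
    proof -
      have "((\<lambda>t. f' (u + t) * f' u + f2' (u + t) * f2' u + f1' (u + t) * f1' u)
         has_real_derivative (f'' u * f' u + f2'' u * f2' u + f1'' u * f1' u)) (at 0)"
        by (intro DERIV_add DERIV_cmult_right sh profile_DERIV)
      from DERIV_mult'[OF XUp this] show ?thesis
        unfolding e[symmetric] by (simp add: zero_prod_def[symmetric])
    qed
  qed
qed

lemma laplacian_formula:
  assumes yz: "norm y = 1" "norm z = 1" and \<zeta>: "\<And>q. q \<in> M_dom \<Longrightarrow> Z q = \<zeta> q"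
    and dim: "DIM('a) = k + 1" "DIM('b) = l + 1"
  shows "laplacian M_dom (immersion f1 f2) \<zeta> (y, z, u) =
    laplace_x Z (y, z, u) / (f u)\<^sup>2 + laplace_y Z (y, z, u) / (f2 u)\<^sup>2 + radial_part k l f1 f2 (\<lambda>u. Z (y, z, u)) u"
proof -
  let ?p = "(y, z, u)" and ?\<phi> = "immersion f1 f2 :: 'a \<times> 'b \<times> real \<Rightarrow> _"
  have nz: "y \<noteq> 0" "z \<noteq> 0" using yz by auto
  have p: "?p \<in> dom3" using nz by (simp add: mem_dom3)
  note Yd = Ck_on_differentiable[OF Ck_on_Y p]
  have B: "bilinear (\<lambda>v w. dd Y v ?p \<bullet> dd ?\<phi> w ?p)"
    by (intro bilinear_inner_linear has_derivative_linear[OF has_derivative_dd] Yd differentiable_immersion)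
  obtain A A' where A: "finite A" "span A = {v. y \<bullet> v = 0}" "card A = DIM('a) - 1"
    "\<And>a b. a \<in> A \<Longrightarrow> b \<in> A \<Longrightarrow> a \<bullet> b = (if a = b then 1 else 0)"
    and A': "finite A'" "span A' = {v. z \<bullet> v = 0}" "card A' = DIM('b) - 1"
    "\<And>a b. a \<in> A' \<Longrightarrow> b \<in> A' \<Longrightarrow> a \<bullet> b = (if a = b then 1 else 0)"
    and tr: "\<And>E. orthonormal_basis M_dom (immersion f1 f2) ?p E \<Longrightarrow>
      (\<Sum>e\<in>E. dd Y e ?p \<bullet> dd ?\<phi> e ?p) = (\<Sum>a\<in>A. dd Y (a, 0, 0) ?p \<bullet> dd ?\<phi> (a, 0, 0) ?p) / (f u)\<^sup>2 +
        (\<Sum>a\<in>A'. dd Y (0, a, 0) ?p \<bullet> dd ?\<phi> (0, a, 0) ?p) / (f2 u)\<^sup>2 + dd Y (0, 0, 1) ?p \<bullet> dd ?\<phi> (0, 0, 1) ?p / w2 u"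
    and ex: "\<exists>E. orthonormal_basis M_dom ?\<phi> ?p E"
    by (rule exists_orthonormal_basis[OF yz B, of u]) blast
  define E where "E = (SOME E. orthonormal_basis M_dom ?\<phi> ?p E)"
  have E: "orthonormal_basis M_dom ?\<phi> ?p E" unfolding E_def using ex by (rule someI_ex)
  have pA: "y \<bullet> a = 0" if "a \<in> A" for a using span_base[OF that] A(2) by auto
  have pA': "z \<bullet> a = 0" if "a \<in> A'" for a using span_base[OF that] A'(2) by auto
  note fp = f_pos[of u] f2_pos[of u]
  have "laplacian M_dom ?\<phi> \<zeta> ?p = (\<Sum>e\<in>E. dd Y e ?p \<bullet> dd ?\<phi> e ?p)"
    unfolding laplacian_def divergence_def E_def[symmetric]
    by (rule sum.cong[OF refl], rule divergence_summand[OF yz Yd tdiff_gradient[OF _ \<zeta>]])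
       (use E in \<open>auto simp: orthonormal_basis_def\<close>)
  also have "\<dots> = (\<Sum>a\<in>A. dd (dd Z (a, 0, 0)) (a, 0, 0) ?p + f u * f' u * XU ?p) / (f u)\<^sup>2 +
        (\<Sum>a\<in>A'. dd (dd Z (0, a, 0)) (0, a, 0) ?p + f2 u * f2' u * XU ?p) / (f2 u)\<^sup>2 + 
        (Zuu ?p - f' u * f'' u * XU ?p) / w2 u"
    unfolding tr[OF E] using divergence_terms[OF yz, where u = u] A(4) A'(4) pA pA' by simp
  \<comment> \<open>The warping terms are the same for every frame vector, so the cardinalities
    \<open>k\<close> and \<open>l\<close> of the frames become the factors of the first order
    coefficients.\<close>
  also have "\<dots> = laplace_x Z ?p / (f u)\<^sup>2 + laplace_y Z ?p / (f2 u)\<^sup>2 +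
     (real k * (f u * f' u * XU ?p) / (f u)\<^sup>2 + real l * (f2 u * f2' u * XU ?p) / (f2 u)\<^sup>2 +
      (Zuu ?p - f' u * f'' u * XU ?p) / w2 u)"
    using trace_hessian(1)[OF yz A(1,2,4), of u] trace_hessian(2)[OF yz A'(1,2,4), of u] A(3) A'(3) dim
    by (simp add: sum.distrib add_divide_distrib)
  also have "real k * (f u * f' u * XU ?p) / (f u)\<^sup>2 + real l * (f2 u * f2' u * XU ?p) / (f2 u)\<^sup>2 +
      (Zuu ?p - f' u * f'' u * XU ?p) / w2 u = 
      radial_part k l f1 f2 (\<lambda>u. Z (y, z, u)) u"
  proof -
    have "radial_part k l f1 f2 (\<lambda>u. Z (y, z, u)) u = 1 / w2 u *
      (Zuu ?p + (real k * (f' u / f u) + real l * (f2' u / f2 u) - 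
          f' u * f'' u / w2 u) * Zu ?p)"
      unfolding radial_part_def Let_def deriv_u[OF nz] ..
    moreover have "Zu ?p = w2 u * XU ?p" using w2_pos[of u] by (simp add: XU_def)
    ultimately show ?thesis using w2_pos[of u] fp 
      by (simp add: divide_simps power2_eq_square) (simp add: algebra_simps)
  qed
  finally show ?thesis .
qed

end

section \<open>The principal curvatures\<close>

text \<open>With a a unit vector orthogonal to b and m = a x b, the vectors b and m are orthogonal
  of squared length \<open>W\<close> and span the plane orthogonal to a, in which x lies.\<close>

lemma cross_expansion:
  fixes a1 a2 a3 b1 b2 b3 x1 x2 x3 :: real
  assumes "a1\<^sup>2 + a2\<^sup>2 + a3\<^sup>2 = 1" "a1 * b1 + a2 * b2 + a3 * b3 = 0" "b1\<^sup>2 + b2\<^sup>2 + b3\<^sup>2 = W"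
    and "x1 * a1 + x2 * a2 + x3 * a3 = 0"
  defines "m1 \<equiv> a2 * b3 - a3 * b2" and "m2 \<equiv> a3 * b1 - a1 * b3" and "m3 \<equiv> a1 * b2 - a2 * b1"
  shows "W * x1 = (x1 * b1 + x2 * b2 + x3 * b3) * b1 + (x1 * m1 + x2 * m2 + x3 * m3) * m1"
    "W * x2 = (x1 * b1 + x2 * b2 + x3 * b3) * b2 + (x1 * m1 + x2 * m2 + x3 * m3) * m2"
    "W * x3 = (x1 * b1 + x2 * b2 + x3 * b3) * b3 + (x1 * m1 + x2 * m2 + x3 * m3) * m3"
  using assms(1-4) unfolding m1_def m2_def m3_def by algebra+

context profile
begin

abbreviation "g \<equiv> fun_g f1 f2"
abbreviation "wd u \<equiv> sqrt (w2 u)"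

text \<open>(N1, N2, N3) is the cross product of the curve (f, f2, f1) in the unit 2-sphere with its
  velocity, divided by the speed \<open>wd\<close>: the unit normal of the profile curve in that
  sphere.\<close>

definition N1 where "N1 u = (f2 u * f1' u - f1 u * f2' u) / wd u"
definition N2 where "N2 u = (f1 u * f' u - f u * f1' u) / wd u"
definition N3 where "N3 u = (f u * f2' u - f2 u * f' u) / wd u"

lemma wd_pos: "wd u > 0" "wd u * wd u = w2 u" using w2_pos[of u] by auto

lemma ff': "f u * f' u = - (f1 u * f1' u + f2 u * f2' u)"
proof -
  have "((\<lambda>u. (f u)\<^sup>2) has_real_derivative 2 * f u * f' u) (at u)"
    by (rule derivative_eq_intros profile_DERIV refl | simp)+
  moreover have "((\<lambda>u. 1 - (f1 u)\<^sup>2 - (f2 u)\<^sup>2) has_real_derivative - 2 * f1 u * f1' u - 2 * f2 u * f2' u) (at u)"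
    by (rule derivative_eq_intros profile_DERIV refl | simp)+
  ultimately have "2 * f u * f' u = - 2 * f1 u * f1' u - 2 * f2 u * f2' u"
    unfolding f_sq by (rule DERIV_unique)
  then show ?thesis by simp
qed

text \<open>The Frenet equations of the plane unit speed curve (f1, f2), with \<open>kappa_b\<close>
  as its signed curvature.\<close>

lemma second_derivatives: 
  "f2'' u = kappa_b f1 f2 u * f1' u" "f1'' u = - kappa_b f1 f2 u * f2' u"
  using unit_speed[of u] unit_speed'[of u] unfolding kappa_b_def by algebra+

lemma ff'': "f u * f'' u = - (w2 u + kappa_b f1 f2 u * g u)"
proof -
  have "((\<lambda>u. f u * f' u) has_real_derivative f u * f'' u + f' u * f' u) (at u)"
    by (rule DERIV_mult'[OF profile_DERIV(3) profile_DERIV(6)])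
  moreover have "((\<lambda>u. - (f1 u * f1' u + f2 u * f2' u)) has_real_derivative
      - ((f1 u * f1'' u + f1' u * f1' u) + (f2 u * f2'' u + f2' u * f2' u))) (at u)"
    by (intro DERIV_minus DERIV_add DERIV_mult' profile_DERIV)
  ultimately have "f u * f'' u + f' u * f' u = 
     - ((f1 u * f1'' u + f1' u * f1' u) + (f2 u * f2'' u + f2' u * f2' u))"
    unfolding ff' by (rule DERIV_unique)
  then show ?thesis
    using unit_speed[of u] by (simp add: second_derivatives fun_g_def power2_eq_square algebra_simps)
qed

text \<open>Lagrange's identity in the plane: \<open>g\<close> is the determinant of (f1, f2) with
  its unit velocity up to sign, and \<open>f * f'\<close> is minus their inner product, so the two
  squares add up to f1^2 + f2^2.\<close>

lemma one_minus_g_sq: "1 - (g u)\<^sup>2 = (f u)\<^sup>2 * w2 u"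
proof -
  have "(f u)\<^sup>2 * w2 u = (f u)\<^sup>2 + (f u * f' u)\<^sup>2" by (simp add: power2_eq_square algebra_simps)
  also have "\<dots> = 1 - (f1 u)\<^sup>2 - (f2 u)\<^sup>2 + (f1 u * f1' u + f2 u * f2' u)\<^sup>2"
    by (simp only: ff' power2_minus f_sq)
  also have "\<dots> = 1 - (g u)\<^sup>2" using unit_speed[of u] unfolding fun_g_def by algebra
  finally show ?thesis by simp
qed

lemma h_eq: "fun_h f1 f2 u = f u * wd u"
  unfolding fun_h_def one_minus_g_sq using f_pos[of u] by (simp add: real_sqrt_mult)

text \<open>Along the first sphere the normal field is differentiated to \<open>N1\<close> times the
  direction and the immersion to \<open>f\<close> times it; the ratio is the principal curvature.
  \<open>N2_eq\<close> is its counterpart for the second sphere.\<close>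

lemma N1_eq: "N1 u = lambda_a f1 f2 u * f u"
  using f_pos[of u] by (simp add: N1_def lambda_a_def h_eq fun_g_def)

lemma N2_eq: "N2 u = lambda_b f1 f2 u * f2 u"
proof -
  have "f u * (f1 u * f' u - f u * f1' u) = g u * f2 u - f1' u"
    using ff'[of u] f_sq[of u] unit_speed[of u] unfolding fun_g_def by algebra
  then have "N2 u = (g u * f2 u - f1' u) / (f u * wd u)"
    unfolding N2_def using f_pos[of u] by (metis less_irrefl mult_divide_mult_cancel_left)
  moreover have "lambda_b f1 f2 u * f2 u = (g u * f2 u - f1' u) / (f u * wd u)"
    using f2_pos[of u] by (simp add: lambda_b_def h_eq kappa_a_def distrib_right left_diff_distrib)
  ultimately show ?thesis by simp
qed

text \<open>The subtracted term is absorbed by \<open>h^2 = f^2 * w2\<close>. What remains is, up to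
  sign, the geodesic curvature of (f, f2, f1) in the 2-sphere.\<close>

lemma lambda_c_eq: "lambda_c f1 f2 u = (g u * w2 u + kappa_b f1 f2 u) / (f u * wd u ^ 3)"
proof -
  let ?k = "kappa_b f1 f2 u" and ?h = "f u * wd u"
  have h: "?h > 0" using f_pos wd_pos by simp
  have h2: "?h\<^sup>2 = (f u)\<^sup>2 * w2 u" using wd_pos(2)[of u] by (simp add: power2_eq_square)
  have "lambda_c f1 f2 u = ((g u + ?k) * ?h\<^sup>2 - ?k * (f u * f' u)\<^sup>2) / ?h ^ 3"
    using h by (simp add: lambda_c_def h_eq diff_divide_distrib power3_eq_cube power2_eq_square)
  also have "(g u + ?k) * ?h\<^sup>2 - ?k * (f u * f' u)\<^sup>2 = (f u)\<^sup>2 * (g u * w2 u + ?k)"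
    unfolding h2 by (simp add: power2_eq_square algebra_simps)
  also have "\<dots> / ?h ^ 3 = (g u * w2 u + ?k) / (f u * wd u ^ 3)"
    using f_pos[of u] by (simp add: power3_eq_cube power2_eq_square)
  finally show ?thesis .
qed

lemma C_wd: "Cinf_on wd UNIV"
  unfolding Cinf_on_def
proof
  fix m
  show "Ck_on m wd UNIV"
  proof (rule Ck_on_compose[OF open_UNIV _ _ Ck_on_sqrt])
    show "w2 u \<in> {0<..}" for u using w2_pos[of u] by simp
    show "Ck_on m w2 UNIV"
      by (intro Ck_on_add Ck_on_power Ck_on_const open_UNIV Cinf_onD Cinf_on_deriv f_smooth)
  qed
qed

lemma C_N: "Cinf_on N1 UNIV" "Cinf_on N2 UNIV" "Cinf_on N3 UNIV"
proof -
  have w: "wd u \<noteq> 0" for u using wd_pos(1)[of u] by simp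
  show "Cinf_on N1 UNIV" "Cinf_on N2 UNIV" "Cinf_on N3 UNIV"
    unfolding Cinf_on_def N1_def N2_def N3_def
    by (intro allI Ck_on_divide Ck_on_diff Ck_on_mult open_UNIV w Cinf_onD C_wd Cinf_on_deriv f1_smooth f2_smooth f_smooth)+
qed

lemma normal_DERIV: "(N1 has_real_derivative deriv N1 u) (at u)" "(N2 has_real_derivative deriv N2 u) (at u)"
  "(N3 has_real_derivative deriv N3 u) (at u)"
  by (rule Cinf_on_real_derivative[of _ UNIV]; intro C_N UNIV_I)+

lemma gamma_sq: "(f u)\<^sup>2 + (f2 u)\<^sup>2 + (f1 u)\<^sup>2 = 1" by (simp add: f_sq)

lemma gamma_orth: "f u * f' u + f2 u * f2' u + f1 u * f1' u = 0" by (simp add: ff')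

lemma gamma'_sq: "(f' u)\<^sup>2 + (f2' u)\<^sup>2 + (f1' u)\<^sup>2 = w2 u" using unit_speed[of u] by simp

lemma N_perp: 
  "N1 u * f u + N2 u * f2 u + N3 u * f1 u = 0"
  "N1 u * f' u + N2 u * f2' u + N3 u * f1' u = 0"
  "(N1 u)\<^sup>2 + (N2 u)\<^sup>2 + (N3 u)\<^sup>2 = 1"
proof -
  let ?m1 = "f2 u * f1' u - f1 u * f2' u" and ?m2 = "f1 u * f' u - f u * f1' u"
    and ?m3 = "f u * f2' u - f2 u * f' u"
  have "?m1 * f u + ?m2 * f2 u + ?m3 * f1 u = 0" by (simp add: algebra_simps)
  then show "N1 u * f u + N2 u * f2 u + N3 u * f1 u = 0"
    unfolding N1_def N2_def N3_def by (simp add: add_divide_distrib[symmetric])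
  have "?m1 * f' u + ?m2 * f2' u + ?m3 * f1' u = 0" by (simp add: algebra_simps)
  then show "N1 u * f' u + N2 u * f2' u + N3 u * f1' u = 0"
    unfolding N1_def N2_def N3_def by (simp add: add_divide_distrib[symmetric])
  have "?m1\<^sup>2 + ?m2\<^sup>2 + ?m3\<^sup>2 = w2 u" 
    using gamma_sq[of u] gamma_orth[of u] gamma'_sq[of u] by algebra
  then have "(?m1\<^sup>2 + ?m2\<^sup>2 + ?m3\<^sup>2) / w2 u = 1" using w2_pos[of u] by simp
  then show "(N1 u)\<^sup>2 + (N2 u)\<^sup>2 + (N3 u)\<^sup>2 = 1"
    unfolding N1_def N2_def N3_def power_divide using w2_pos[of u] 
    by (simp add: add_divide_distrib[symmetric])
qed

lemma normal_multiple:
  assumes "x1 * f u + x2 * f2 u + x3 * f1 u = 0" "x1 * f' u + x2 * f2' u + x3 * f1' u = 0"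
  defines "s \<equiv> x1 * N1 u + x2 * N2 u + x3 * N3 u"
  shows "x1 = s * N1 u" "x2 = s * N2 u" "x3 = s * N3 u"
proof -
  have N: "f2 u * f1' u - f1 u * f2' u = wd u * N1 u" "f1 u * f' u - f u * f1' u = wd u * N2 u"
    "f u * f2' u - f2 u * f' u = wd u * N3 u"
    using wd_pos(1)[of u] by (auto simp: N1_def N2_def N3_def)
  have S: "x1 * (wd u * N1 u) + x2 * (wd u * N2 u) + x3 * (wd u * N3 u) = wd u * s"
    by (simp add: s_def algebra_simps)
  have W: "wd u * s * (wd u * c) = w2 u * (s * c)" for c using wd_pos(2)[of u] by (simp add: algebra_simps)
  have "w2 u * x1 = w2 u * (s * N1 u)" "w2 u * x2 = w2 u * (s * N2 u)" "w2 u * x3 = w2 u * (s * N3 u)"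
    using cross_expansion[OF gamma_sq[of u] gamma_orth[of u] gamma'_sq[of u] assms(1)]
    unfolding N S assms(2) W by simp_all
  then show "x1 = s * N1 u" "x2 = s * N2 u" "x3 = s * N3 u" using w2_pos[of u] by simp_all
qed

text \<open>The derivative of the normal is orthogonal to the normal and to the curve, so it is a
  multiple of the velocity. The multiple is found by differentiating the orthogonality of normal and
  velocity.\<close>

lemma N_derivative:
  "deriv N1 u = lambda_c f1 f2 u * f' u" "deriv N2 u = lambda_c f1 f2 u * f2' u"
  "deriv N3 u = lambda_c f1 f2 u * f1' u"
proof -
  let ?k = "kappa_b f1 f2 u"
  have a: "deriv N1 u * f u + deriv N2 u * f2 u + deriv N3 u * f1 u = 0"
  proof -
    have "((\<lambda>u. N1 u * f u + N2 u * f2 u + N3 u * f1 u) has_real_derivative 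
      (N1 u * f' u + deriv N1 u * f u) + (N2 u * f2' u + deriv N2 u * f2 u) + (N3 u * f1' u + deriv N3 u * f1 u)) (at u)"
      by (intro DERIV_add DERIV_mult' profile_DERIV normal_DERIV)
    from DERIV_unique[OF this[unfolded N_perp] DERIV_const] N_perp(2)[of u] show ?thesis by simp
  qed
  have b: "deriv N1 u * f' u + deriv N2 u * f2' u + deriv N3 u * f1' u = 
     - (N1 u * f'' u + N2 u * f2'' u + N3 u * f1'' u)"
  proof -
    have "((\<lambda>u. N1 u * f' u + N2 u * f2' u + N3 u * f1' u) has_real_derivative 
      (N1 u * f'' u + deriv N1 u * f' u) + (N2 u * f2'' u + deriv N2 u * f2' u) +
      (N3 u * f1'' u + deriv N3 u * f1' u)) (at u)"
      by (intro DERIV_add DERIV_mult' profile_DERIV normal_DERIV)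
    from DERIV_unique[OF this[unfolded N_perp] DERIV_const] show ?thesis by simp
  qed
  have c: "deriv N1 u * N1 u + deriv N2 u * N2 u + deriv N3 u * N3 u = 0"
  proof -
    have "((\<lambda>u. N1 u * N1 u + N2 u * N2 u + N3 u * N3 u) has_real_derivative 
      (N1 u * deriv N1 u + deriv N1 u * N1 u) + (N2 u * deriv N2 u + deriv N2 u * N2 u) + (N3 u * deriv N3 u + deriv N3 u * N3 u)) (at u)"
      by (intro DERIV_add DERIV_mult' profile_DERIV normal_DERIV)
    moreover have "(\<lambda>u. N1 u * N1 u + N2 u * N2 u + N3 u * N3 u) = (\<lambda>u. 1)"
      using N_perp(3) by (simp add: power2_eq_square)
    ultimately have "((\<lambda>u. 1) has_real_derivative 
      (N1 u * deriv N1 u + deriv N1 u * N1 u) + (N2 u * deriv N2 u + deriv N2 u * N2 u) + (N3 u * deriv N3 u + deriv N3 u * N3 u)) (at u)" by simp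
    from DERIV_unique[OF this DERIV_const] show ?thesis by (simp add: mult.commute)
  qed
  have N: "f2 u * f1' u - f1 u * f2' u = wd u * N1 u" "f1 u * f' u - f u * f1' u = wd u * N2 u"
    "f u * f2' u - f2 u * f' u = wd u * N3 u"
    using wd_pos(1)[of u] by (auto simp: N1_def N2_def N3_def)
  have d: "N1 u * f'' u + N2 u * f2'' u + N3 u * f1'' u = - (w2 u * lambda_c f1 f2 u)"
  proof -
    \<comment> \<open>The factor \<open>wd u\<close> clears the denominators of the normal, and
      \<open>f u\<close> turns \<open>f'' u\<close> into the product computed in
      \<open>ff''\<close>.\<close>
    have "f u * (wd u * (N1 u * f'' u + N2 u * f2'' u + N3 u * f1'' u)) =
      g u * (f u * f'' u) + f u * (?k * f1' u * (f1 u * f' u - f u * f1' u) - 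
        ?k * f2' u * (f u * f2' u - f2 u * f' u))"
    proof -
      have e0: "f u * (wd u * (N1 u * x + N2 u * y + N3 u * z)) = f u * (wd u * N1 u * x + wd u * N2 u * y + wd u * N3 u * z)" for x y z
        by (simp only: distrib_left mult.assoc)
      show ?thesis unfolding e0 N[symmetric] fun_g_def second_derivatives by (simp add: algebra_simps)
    qed
    also have "f u * (?k * f1' u * (f1 u * f' u - f u * f1' u) - 
        ?k * f2' u * (f u * f2' u - f2 u * f' u)) = - ?k * ((f u)\<^sup>2 * w2 u)"
      using gamma_orth[of u] unit_speed[of u] by algebra
    also have "g u * (f u * f'' u) + - ?k * ((f u)\<^sup>2 * w2 u) = - (g u * w2 u + ?k)"
      unfolding ff'' one_minus_g_sq[symmetric] by (simp add: power2_eq_square algebra_simps)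
    finally have e: "N1 u * f'' u + N2 u * f2'' u + N3 u * f1'' u = 
        - (g u * w2 u + ?k) / (f u * wd u)"
      using wd_pos(1)[of u] f_pos[of u] by (simp add: field_simps)
    have "w2 u * lambda_c f1 f2 u = (g u * w2 u + ?k) / (f u * wd u)"
      unfolding lambda_c_eq power3_eq_cube wd_pos(2) using w2_pos[of u] by simp
    with e show ?thesis by (simp only: minus_divide_left)
  qed
  have S: "deriv N1 u * (wd u * N1 u) + deriv N2 u * (wd u * N2 u) + deriv N3 u * (wd u * N3 u) = 0"
    using c by algebra
  have "w2 u * deriv N1 u = w2 u * (lambda_c f1 f2 u * f' u)" "w2 u * deriv N2 u = w2 u * (lambda_c f1 f2 u * f2' u)"
    "w2 u * deriv N3 u = w2 u * (lambda_c f1 f2 u * f1' u)"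
    using cross_expansion[OF gamma_sq[of u] gamma_orth[of u] gamma'_sq[of u] a]
    unfolding N S b d by simp_all
  then show "deriv N1 u = lambda_c f1 f2 u * f' u" "deriv N2 u = lambda_c f1 f2 u * f2' u"
    "deriv N3 u = lambda_c f1 f2 u * f1' u" using w2_pos[of u] by simp_all
qed

section \<open>The unit normal field and the shape operator\<close>

definition nu0 :: "'a::euclidean_space \<times> 'b::euclidean_space \<times> real \<Rightarrow> 'a \<times> 'b \<times> real" where
  "nu0 q = (N1 (snd (snd q)) *\<^sub>R fst q, N2 (snd (snd q)) *\<^sub>R fst (snd q), N3 (snd (snd q)))"

lemma Cinf_on_nu0: "Cinf_on nu0 UNIV"
proof -
  have r: "Ck_on m (\<lambda>q. h (snd (snd q))) (UNIV :: ('a::euclidean_space \<times> 'b::euclidean_space \<times> real) set)" 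
    if "Cinf_on h UNIV" for h :: "real \<Rightarrow> real" and m
    by (rule Ck_on_compose[OF open_UNIV _ _ Cinf_onD[OF that]], rule UNIV_I) (intro Ck_on_snd Ck_on_ident open_UNIV)
  show ?thesis
    unfolding Cinf_on_def nu0_def
    by (intro allI Ck_on_Pair Ck_on_scaleR Ck_on_fst Ck_on_snd Ck_on_ident open_UNIV r C_N)
qed

text \<open>The differential of \<open>nu0\<close> factors through that of the immersion,
  diagonally. As \<open>shape_operator\<close> carries a minus sign, the curvatures
  \<open>lambda_a\<close>, \<open>lambda_b\<close>, \<open>lambda_c\<close> belong to the opposite
  normal.\<close>

lemma dd_nu0:
  "dd nu0 (v, w, s) (y :: 'a::euclidean_space, z :: 'b::euclidean_space, u) =
   dd (immersion f1 f2) (lambda_a f1 f2 u *\<^sub>R v, lambda_b f1 f2 u *\<^sub>R w, lambda_c f1 f2 u * s) (y, z, u)"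
proof -
  have "(nu0 has_derivative (\<lambda>V. (N1 (snd (snd (y, z, u))) *\<^sub>R fst V + (deriv N1 u * snd (snd V)) *\<^sub>R fst (y, z, u), 
           N2 (snd (snd (y, z, u))) *\<^sub>R fst (snd V) + (deriv N2 u * snd (snd V)) *\<^sub>R fst (snd (y, z, u)),
           deriv N3 u * snd (snd V)))) (at (y, z, u))"
    unfolding nu0_def
    by (intro has_derivative_Pair has_derivative_scaleR has_derivative_radial normal_DERIV has_derivative_fst has_derivative_snd has_derivative_ident)
  from dd_eqI[OF this, of "(v, w, s)"] show ?thesis
    by (simp add: dd_immersion N_derivative N1_eq N2_eq ac_simps)
qed

lemma unit_normal_field_nu0: "unit_normal_field M_dom (immersion f1 f2) nu0"
  unfolding unit_normal_field_def
proof (intro conjI ballI)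
  show "smooth_on M_dom nu0" by (rule Cinf_on_smooth_on[OF open_UNIV _ Cinf_on_nu0]) simp
  fix p :: "'a \<times> 'b \<times> real" assume p: "p \<in> M_dom"
  obtain y z u where pe: "p = (y, z, u)" by (cases p)
  have yz: "norm y = 1" "norm z = 1" using p by (auto simp: pe M_dom_iff)
  have "nu0 p \<bullet> nu0 p = 1" 
    using N_perp(3)[of u] yz by (simp add: pe nu0_def power2_eq_square norm_eq_1)
  then show "norm (nu0 p) = 1" by (simp add: norm_eq_1)
  show "nu0 p \<bullet> immersion f1 f2 p = 0"
    using N_perp(1)[of u] yz by (simp add: pe nu0_def immersion_def dot_square_norm mult.commute)
  fix V assume V: "V \<in> tangent_space M_dom p"
  obtain v w s where Ve: "V = (v, w, s)" by (cases V)
  have vw: "y \<bullet> v = 0" "z \<bullet> w = 0" using V by (auto simp: pe Ve tangent_space_M_dom[OF yz])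
  have "nu0 p \<bullet> tdiff M_dom (immersion f1 f2) p V = s * (N1 u * f' u + N2 u * f2' u + N3 u * f1' u)"
    unfolding tdiff_immersion[OF p V] unfolding pe Ve
    using yz vw by (simp add: nu0_def dd_immersion inner_add_right dot_square_norm algebra_simps)
  then show "nu0 p \<bullet> tdiff M_dom (immersion f1 f2) p V = 0" by (simp add: N_perp(2))
qed

text \<open>Orthogonality to the sphere directions leaves only multiples of \<open>y\<close> and
  \<open>z\<close> in the first two components, and the remaining problem is that of the normal of
  the profile curve. This controls the normal field chosen in \<open>sq_norm_A\<close>.\<close>

lemma unit_normal_unique:
  fixes \<nu> :: "'a::euclidean_space \<times> 'b::euclidean_space \<times> real \<Rightarrow> 'a \<times> 'b \<times> real"
  assumes \<nu>: "unit_normal_field M_dom (immersion f1 f2) \<nu>" and p: "p \<in> M_dom"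
  shows "\<nu> p = (\<nu> p \<bullet> nu0 p) *\<^sub>R nu0 p" "(\<nu> p \<bullet> nu0 p)\<^sup>2 = 1"
proof -
  obtain y z u where pe: "p = (y, z, u)" by (cases p)
  have yz: "norm y = 1" "norm z = 1" using p by (auto simp: pe M_dom_iff)
  have yy: "y \<bullet> y = 1" "z \<bullet> z = 1" using yz by (simp_all add: dot_square_norm)
  obtain n1 n2 n3 where n: "\<nu> p = (n1, n2, n3)" by (cases "\<nu> p")
  have unit: "norm (\<nu> p) = 1" and orth: "\<nu> p \<bullet> immersion f1 f2 p = 0" 
    and perp: "\<And>V. V \<in> tangent_space M_dom p \<Longrightarrow> \<nu> p \<bullet> dd (immersion f1 f2) V p = 0"
  proof -
    have *: "norm (\<nu> p) = 1 \<and> \<nu> p \<bullet> immersion f1 f2 p = 0 \<and>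
        (\<forall>v\<in>tangent_space M_dom p. \<nu> p \<bullet> tdiff M_dom (immersion f1 f2) p v = 0)"
      using \<nu> p unfolding unit_normal_field_def by blast
    then show "norm (\<nu> p) = 1" "\<nu> p \<bullet> immersion f1 f2 p = 0" by blast+
    show "\<nu> p \<bullet> dd (immersion f1 f2) V p = 0" if "V \<in> tangent_space M_dom p" for V
      using * that unfolding tdiff_immersion[OF p that, symmetric] by blast
  qed
  have perp': "n1 \<bullet> (f u *\<^sub>R v + (f' u * s) *\<^sub>R y) + n2 \<bullet> (f2 u *\<^sub>R w + (f2' u * s) *\<^sub>R z) + n3 * (f1' u * s) = 0"
    if "y \<bullet> v = 0" "z \<bullet> w = 0" for v w s
  proof -
    have "(v, w, s) \<in> tangent_space M_dom p" using that by (simp add: pe tangent_space_M_dom[OF yz])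
    from perp[OF this] show ?thesis unfolding n unfolding pe dd_immersion by simp
  qed
  have n1: "n1 = (n1 \<bullet> y) *\<^sub>R y"
  proof -
    let ?v = "n1 - (n1 \<bullet> y) *\<^sub>R y"
    have o: "y \<bullet> ?v = 0" by (simp add: inner_diff_right yy inner_commute)
    have "n1 \<bullet> ?v = 0" using perp'[OF o, of 0 0] f_pos[of u] by simp
    then have "?v \<bullet> ?v = 0" using o by (simp add: inner_diff_left)
    then show ?thesis by simp
  qed
  have n2: "n2 = (n2 \<bullet> z) *\<^sub>R z"
  proof -
    let ?v = "n2 - (n2 \<bullet> z) *\<^sub>R z"
    have o: "z \<bullet> ?v = 0" by (simp add: inner_diff_right yy inner_commute)
    have "n2 \<bullet> ?v = 0" using perp'[OF _ o, of 0 0] f2_pos[of u] by simp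
    then have "?v \<bullet> ?v = 0" using o by (simp add: inner_diff_left)
    then show ?thesis by simp
  qed
  define x1 x2 where "x1 = n1 \<bullet> y" and "x2 = n2 \<bullet> z"
  have n1': "n1 = x1 *\<^sub>R y" and n2': "n2 = x2 *\<^sub>R z" using n1 n2 by (auto simp: x1_def x2_def)
  have a: "x1 * f u + x2 * f2 u + n3 * f1 u = 0"
    using orth unfolding n unfolding pe n1' n2' by (simp add: immersion_def yy algebra_simps)
  have b: "x1 * f' u + x2 * f2' u + n3 * f1' u = 0"
    using perp'[of 0 0 1] unfolding n1' n2' by (simp add: yy mult.commute)
  have s: "\<nu> p \<bullet> nu0 p = x1 * N1 u + x2 * N2 u + n3 * N3 u"
    unfolding n unfolding pe n1' n2' by (simp add: nu0_def yy)
  note nm = normal_multiple[OF a b, folded s]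
  show e: "\<nu> p = (\<nu> p \<bullet> nu0 p) *\<^sub>R nu0 p"
  proof -
    have "(\<nu> p \<bullet> nu0 p) *\<^sub>R nu0 p = ((\<nu> p \<bullet> nu0 p * N1 u) *\<^sub>R y, (\<nu> p \<bullet> nu0 p * N2 u) *\<^sub>R z, \<nu> p \<bullet> nu0 p * N3 u)"
      by (simp add: nu0_def pe)
    also have "\<dots> = (n1, n2, n3)" unfolding nm[symmetric] n1' n2' ..
    finally show ?thesis using n by simp
  qed
  have "norm (nu0 p) = 1" using unit_normal_field_nu0 p unfolding unit_normal_field_def by blast
  then have "\<bar>\<nu> p \<bullet> nu0 p\<bar> = 1" using unit e by (metis norm_scaleR mult.right_neutral)
  then show "(\<nu> p \<bullet> nu0 p)\<^sup>2 = 1" by (metis one_power2 power2_abs)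
qed

text \<open>The sign relative to \<open>nu0\<close> is a differentiable function along each curve
  with square 1, so its derivative is 0 and it can be treated as a constant.\<close>

lemma tdiff_unit_normal:
  fixes \<nu> :: "'a::euclidean_space \<times> 'b::euclidean_space \<times> real \<Rightarrow> 'a \<times> 'b \<times> real"
  assumes \<nu>: "unit_normal_field M_dom (immersion f1 f2) \<nu>" and p: "p \<in> M_dom" and V: "V \<in> tangent_space M_dom p"
  shows "tdiff M_dom \<nu> p V = (\<nu> p \<bullet> nu0 p) *\<^sub>R dd nu0 V p"
proof -
  obtain c where c: "\<And>t. c t \<in> M_dom" "c 0 = p" "(c has_vector_derivative V) (at 0)"
    using V unfolding tangent_space_def by blast
  obtain U G where U: "open U" "p \<in> U" "\<And>m. Ck_on m G U" "\<And>q. q \<in> U \<inter> M_dom \<Longrightarrow> G q = \<nu> q"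
    using \<nu> p unfolding unit_normal_field_def smooth_on_def by metis
  have "G differentiable (at p)" using Ck_on_differentiable[OF U(3,2)] .
  then have "(G has_derivative (\<lambda>v. dd G v p)) (at p within M_dom)"
    using has_derivative_dd has_derivative_at_withinI by blast
  then have "(\<nu> has_derivative (\<lambda>v. dd G v p)) (at p within M_dom)"
    by (rule has_derivative_transform_eventually)
       (use U p in \<open>auto simp: eventually_at_topological\<close>)
  then have "\<nu> differentiable (at p within M_dom)" by (auto simp: differentiable_def)
  note d\<nu> = tdiff_curve[OF this c]
  have "nu0 differentiable (at (c 0))" using Cinf_on_differentiable[OF Cinf_on_nu0] by blast
  from vector_derivative_diff_chain_within[OF c(3) has_derivative_at_withinI[OF has_derivative_dd[OF this]]]
  have dn: "((\<lambda>t. nu0 (c t)) has_vector_derivative dd nu0 V p) (at 0)" by (simp add: o_def c(2))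
  define \<sigma> where "\<sigma> t = \<nu> (c t) \<bullet> nu0 (c t)" for t
  have "\<exists>s'. (\<sigma> has_real_derivative s') (at 0)"
    unfolding \<sigma>_def has_real_derivative_iff_has_vector_derivative
    using bounded_bilinear.has_vector_derivative[OF bounded_bilinear_inner d\<nu> dn] by blast
  then obtain s' where s': "(\<sigma> has_real_derivative s') (at 0)" by blast
  have sq: "(\<sigma> t)\<^sup>2 = 1" for t unfolding \<sigma>_def by (rule unit_normal_unique(2)[OF \<nu> c(1)])
  have "((\<lambda>t. \<sigma> t * \<sigma> t) has_real_derivative \<sigma> 0 * s' + s' * \<sigma> 0) (at 0)"
    by (rule DERIV_mult'[OF s' s'])
  then have "((\<lambda>t. 1) has_real_derivative \<sigma> 0 * s' + s' * \<sigma> 0) (at 0)"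
    using sq by (simp add: power2_eq_square)
  from DERIV_unique[OF this DERIV_const] have "\<sigma> 0 * s' = 0" by auto
  then have "s' = 0" using sq[of 0] by auto
  then have "((\<lambda>t. \<sigma> t *\<^sub>R nu0 (c t)) has_vector_derivative \<sigma> 0 *\<^sub>R dd nu0 V p) (at 0)"
    using has_vector_derivative_scaleR[OF s' dn] by simp
  moreover have "(\<lambda>t. \<sigma> t *\<^sub>R nu0 (c t)) = (\<lambda>t. \<nu> (c t))"
    unfolding \<sigma>_def using unit_normal_unique(1)[OF \<nu> c(1)] by simp
  ultimately show ?thesis
    using vector_derivative_unique_at[OF d\<nu>] by (simp add: \<sigma>_def c(2))
qed

lemma shape_operator_diagonal:
  fixes u :: real and \<nu> :: "'a::euclidean_space \<times> 'b::euclidean_space \<times> real \<Rightarrow> 'a \<times> 'b \<times> real"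
  assumes \<nu>: "unit_normal_field M_dom (immersion f1 f2) \<nu>" and yz: "norm y = 1" "norm z = 1"
    and vw: "y \<bullet> v = 0" "z \<bullet> w = 0"
  defines "s \<equiv> - (\<nu> (y, z, u) \<bullet> nu0 (y, z, u))"
  shows "shape_operator M_dom (immersion f1 f2) \<nu> (y, z, u) (v, w, t) =
    ((s * lambda_a f1 f2 u) *\<^sub>R v, (s * lambda_b f1 f2 u) *\<^sub>R w, s * lambda_c f1 f2 u * t)"
proof -
  let ?p = "(y, z, u)" and ?\<phi> = "immersion f1 f2 :: 'a \<times> 'b \<times> real \<Rightarrow> _"
  let ?W = "((s * lambda_a f1 f2 u) *\<^sub>R v, (s * lambda_b f1 f2 u) *\<^sub>R w, s * lambda_c f1 f2 u * t)"
  have p: "?p \<in> M_dom" using yz by (simp add: M_dom_iff)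
  note T = tangent_space_M_dom[OF yz, of u]
  have yy: "y \<bullet> y = 1" "z \<bullet> z = 1" using yz by (simp_all add: dot_square_norm)
  have lin: "linear (\<lambda>V. dd ?\<phi> V ?p)"
    using has_derivative_linear[OF has_derivative_dd[OF differentiable_immersion]] .
  have WT: "?W \<in> tangent_space M_dom ?p" using vw by (simp add: T)
  have "- tdiff M_dom \<nu> ?p (v, w, t) = s *\<^sub>R dd nu0 (v, w, t) ?p"
    by (subst tdiff_unit_normal[OF \<nu> p]) (use vw in \<open>simp_all add: T s_def\<close>)
  also have "\<dots> = dd ?\<phi> (s *\<^sub>R (lambda_a f1 f2 u *\<^sub>R v, lambda_b f1 f2 u *\<^sub>R w, lambda_c f1 f2 u * t)) ?p"
    unfolding dd_nu0 linear_cmul[OF lin] ..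
  also have "s *\<^sub>R (lambda_a f1 f2 u *\<^sub>R v, lambda_b f1 f2 u *\<^sub>R w, lambda_c f1 f2 u * t) = ?W" by simp
  finally have e: "- tdiff M_dom \<nu> ?p (v, w, t) = dd ?\<phi> ?W ?p" .
  show ?thesis
    unfolding shape_operator_def e
  proof (rule the_equality)
    show "?W \<in> tangent_space M_dom ?p \<and> tdiff M_dom ?\<phi> ?p ?W = dd ?\<phi> ?W ?p"
      using WT tdiff_immersion[OF p WT] by blast
    fix W assume W: "W \<in> tangent_space M_dom ?p \<and> tdiff M_dom ?\<phi> ?p W = dd ?\<phi> ?W ?p"
    then have "dd ?\<phi> W ?p = dd ?\<phi> ?W ?p" using tdiff_immersion[OF p] by metis
    then have "dd ?\<phi> (W - ?W) ?p = 0" using linear_diff[OF lin] by simp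
    moreover obtain d1 d2 d3 where d: "W - ?W = (d1, d2, d3)" by (cases "W - ?W")
    moreover obtain w1 w2 w3 where We: "W = (w1, w2, w3)" by (cases W)
    then have o: "y \<bullet> d1 = 0" "z \<bullet> d2 = 0" using W d vw by (auto simp: T inner_diff_right)
    ultimately have z: "f u *\<^sub>R d1 + (f' u * d3) *\<^sub>R y = 0" "f2 u *\<^sub>R d2 + (f2' u * d3) *\<^sub>R z = 0" "f1' u * d3 = 0"
      by (simp_all add: dd_immersion zero_prod_def)
    \<comment> \<open>Pairing with \<open>y\<close> and \<open>z\<close> isolates the
      \<open>u\<close> component \<open>d3\<close>, which then vanishes because the velocity of (f1,
      f2) is not 0. So the differential of the immersion is injective on tangent vectors.\<close>
    have "y \<bullet> (f u *\<^sub>R d1 + (f' u * d3) *\<^sub>R y) = 0" "z \<bullet> (f2 u *\<^sub>R d2 + (f2' u * d3) *\<^sub>R z) = 0"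
      by (simp_all add: z)
    then have z': "f' u * d3 = 0" "f2' u * d3 = 0" using o by (simp_all add: inner_add_right yy)
    have "d3 = ((f1' u)\<^sup>2 + (f2' u)\<^sup>2) * d3" by (simp add: unit_speed)
    also have "\<dots> = 0" using z(3) z'(2) by algebra
    finally have "d3 = 0" .
    then have "d1 = 0" "d2 = 0" using z f_pos[of u] f2_pos[of u] by auto
    then show "W = ?W" using d \<open>d3 = 0\<close> by (metis eq_iff_diff_eq_0 zero_prod_def)
  qed
qed

text \<open>The choice of the normal enters through the sign \<open>s\<close>, which disappears in
  the squares. A principal space is the product of those blocks whose curvature equals the given
  value, so coincidences among the three curvatures do no harm.\<close>

lemma sq_norm_A_formula:
  fixes y :: "'a::euclidean_space" and z :: "'b::euclidean_space"
  assumes yz: "norm y = 1" "norm z = 1" and dim: "DIM('a) = k + 1" "DIM('b) = l + 1" and kl: "k \<ge> 1" "l \<ge> 1"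
  shows "sq_norm_A M_dom (immersion f1 f2) (y, z, u) =
    real k * (lambda_a f1 f2 u)\<^sup>2 + real l * (lambda_b f1 f2 u)\<^sup>2 + (lambda_c f1 f2 u)\<^sup>2"
proof -
  let ?p = "(y, z, u)" and ?\<phi> = "immersion f1 f2 :: 'a \<times> 'b \<times> real \<Rightarrow> _"
  define \<nu> where "\<nu> = (SOME \<nu>. unit_normal_field M_dom ?\<phi> \<nu>)"
  have \<nu>: "unit_normal_field M_dom ?\<phi> \<nu>" unfolding \<nu>_def by (rule someI[of _ nu0]) (rule unit_normal_field_nu0)
  define s where "s = - (\<nu> ?p \<bullet> nu0 ?p)"
  have s2: "s\<^sup>2 = 1" using unit_normal_unique(2)[OF \<nu>, of ?p] yz by (simp add: s_def M_dom_iff)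
  define a b c where "a = s * lambda_a f1 f2 u" and "b = s * lambda_b f1 f2 u" and "c = s * lambda_c f1 f2 u"
  define V1 where "V1 \<mu> = (if \<mu> = a then {v. y \<bullet> v = 0} else {0})" for \<mu>
  define V2 where "V2 \<mu> = (if \<mu> = b then {v. z \<bullet> v = 0} else {0})" for \<mu>
  define V3 where "V3 \<mu> = (if \<mu> = c then UNIV else {0::real})" for \<mu>
  have P: "principal_space M_dom ?\<phi> \<nu> ?p \<mu> = V1 \<mu> \<times> V2 \<mu> \<times> V3 \<mu>" for \<mu>
  proof (rule set_eqI, clarify)
    fix v :: 'a and w :: 'b and t :: real
    have "(v, w, t) \<in> principal_space M_dom ?\<phi> \<nu> ?p \<mu> \<longleftrightarrow> 
      y \<bullet> v = 0 \<and> z \<bullet> w = 0 \<and> a *\<^sub>R v = \<mu> *\<^sub>R v \<and> b *\<^sub>R w = \<mu> *\<^sub>R w \<and> c * t = \<mu> * t"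
      unfolding principal_space_def mem_Collect_eq tangent_space_M_dom[OF yz]
      using shape_operator_diagonal[OF \<nu> yz, of v w u t] by (auto simp: a_def b_def c_def s_def)
    also have "\<dots> \<longleftrightarrow> (v, w, t) \<in> V1 \<mu> \<times> V2 \<mu> \<times> V3 \<mu>"
      by (auto simp: V1_def V2_def V3_def)
    finally show "(v, w, t) \<in> principal_space M_dom ?\<phi> \<nu> ?p \<mu> \<longleftrightarrow> (v, w, t) \<in> V1 \<mu> \<times> V2 \<mu> \<times> V3 \<mu>" .
  qed
  have nz: "y \<noteq> 0" "z \<noteq> 0" using yz by auto
  have d1: "dim {v. y \<bullet> v = 0} = k" and d2: "dim {v. z \<bullet> v = 0} = l"
    using nz dim by (simp_all add: dim_hyperplane)
  have sub: "subspace (V1 \<mu>)" "subspace (V2 \<mu>)" "subspace (V3 \<mu>)" for \<mu>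
    by (auto simp: V1_def V2_def V3_def subspace_hyperplane subspace_0)
  have dimP: "dim (principal_space M_dom ?\<phi> \<nu> ?p \<mu>) = 
     (if \<mu> = a then k else 0) + ((if \<mu> = b then l else 0) + (if \<mu> = c then 1 else 0))" for \<mu>
    unfolding P by (simp add: dim_Times sub subspace_Times) (simp add: V1_def V2_def V3_def d1 d2)
  \<comment> \<open>Since \<open>k\<close> and \<open>l\<close> are positive, all three blocks have
    positive dimension, so \<open>a\<close>, \<open>b\<close> and \<open>c\<close> all
    occur.\<close>
  have pc: "principal_curvatures M_dom ?\<phi> \<nu> ?p = {a, b, c}"
  proof -
    have "(\<exists>v\<in>principal_space M_dom ?\<phi> \<nu> ?p \<mu>. v \<noteq> 0) \<longleftrightarrow> dim (principal_space M_dom ?\<phi> \<nu> ?p \<mu>) \<noteq> 0" for \<mu>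
      by (auto simp: dim_eq_0)
    then show ?thesis unfolding principal_curvatures_def using kl by (auto simp: dimP)
  qed
  have "sq_norm_A M_dom ?\<phi> ?p = (\<Sum>\<mu>\<in>{a, b, c}. real ((if \<mu> = a then k else 0) + ((if \<mu> = b then l else 0) + (if \<mu> = c then 1 else 0))) * \<mu>\<^sup>2)"
    unfolding sq_norm_A_def Let_def \<nu>_def[symmetric] pc dimP ..
  \<comment> \<open>The set \<open>{a, b, c}\<close> may have fewer than three elements. With one
    indicator term per block each sum has exactly one contribution, whatever the
    coincidences.\<close>
  also have "\<dots> = (\<Sum>\<mu>\<in>{a, b, c}. (if \<mu> = a then real k * \<mu>\<^sup>2 else 0) + ((if \<mu> = b then real l * \<mu>\<^sup>2 else 0) + (if \<mu> = c then \<mu>\<^sup>2 else 0)))"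
    by (rule sum.cong) (auto simp: algebra_simps)
  also have "\<dots> = real k * a\<^sup>2 + real l * b\<^sup>2 + c\<^sup>2"
    by (simp only: sum.distrib sum.delta' sum.delta finite_insert finite.emptyI) simp
  finally show ?thesis by (simp add: a_def b_def c_def power_mult_distrib s2)
qed

end

section \<open>Separation of variables\<close>

definition sphere_ext :: "('a::euclidean_space \<times> 'b::euclidean_space \<times> real \<Rightarrow> real) \<Rightarrow> 'a \<times> 'b \<times> real \<Rightarrow> real" where
  "sphere_ext \<zeta> q = \<zeta> (sgn (fst q), sgn (fst (snd q)), snd (snd q))"

lemma Ck_on_sgn_dom3:
  "Ck_on m (\<lambda>q. sgn (fst q)) (dom3 :: ('a::euclidean_space \<times> 'b::euclidean_space \<times> real) set)"
  "Ck_on m (\<lambda>q. sgn (fst (snd q))) (dom3 :: ('a::euclidean_space \<times> 'b::euclidean_space \<times> real) set)"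
proof -
  show "Ck_on m (\<lambda>q. sgn (fst q)) (dom3 :: ('a \<times> 'b \<times> real) set)"
    by (rule Ck_on_compose[OF open_dom3 _ _ Ck_on_sgn]) 
       (auto simp: dom3_def intro: Ck_on_fst[OF open_dom3 Ck_on_ident, unfolded dom3_def])
  show "Ck_on m (\<lambda>q. sgn (fst (snd q))) (dom3 :: ('a \<times> 'b \<times> real) set)"
    by (rule Ck_on_compose[OF open_dom3 _ _ Ck_on_sgn]) 
       (auto simp: dom3_def intro: Ck_on_fst[OF open_dom3 Ck_on_snd[OF open_dom3 Ck_on_ident], unfolded dom3_def])
qed

lemma Ck_on_projection_dom3:
  "Ck_on m (\<lambda>q. (sgn (fst q), sgn (fst (snd q)), snd (snd q))) (dom3 :: ('a::euclidean_space \<times> 'b::euclidean_space \<times> real) set)"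
  by (intro Ck_on_Pair open_dom3 Ck_on_sgn_dom3 Ck_on_snd Ck_on_ident)

lemma projection_in_M_dom: "q \<in> dom3 \<Longrightarrow> (sgn (fst q), sgn (fst (snd q)), snd (snd q)) \<in> M_dom"
  by (auto simp: dom3_def M_dom_iff norm_sgn)

text \<open>\<open>smooth_on\<close> provides an ambient extension only near each point of
  \<open>M_dom\<close>. Composing it with the projection to the spheres agrees with
  \<open>sphere_ext\<close> on a whole neighbourhood in \<open>dom3\<close>.\<close>

lemma Cinf_on_sphere_ext:
  fixes \<zeta> :: "'a::euclidean_space \<times> 'b::euclidean_space \<times> real \<Rightarrow> real"
  assumes "smooth_on M_dom \<zeta>" shows "Cinf_on (sphere_ext \<zeta>) dom3"
  unfolding Cinf_on_def
proof (intro allI Ck_on_local)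
  fix m and q :: "'a \<times> 'b \<times> real" assume q: "q \<in> dom3"
  let ?\<pi> = "\<lambda>q :: 'a \<times> 'b \<times> real. (sgn (fst q), sgn (fst (snd q)), snd (snd q))"
  obtain U G where U: "open U" "?\<pi> q \<in> U" "\<And>m. Ck_on m G U" "\<And>p. p \<in> U \<inter> M_dom \<Longrightarrow> G p = \<zeta> p"
    using assms projection_in_M_dom[OF q] unfolding smooth_on_def by metis
  let ?V = "dom3 \<inter> ?\<pi> -` U"
  have V: "open ?V"
    by (rule continuous_open_preimage[OF Ck_on_continuous[OF Ck_on_projection_dom3] open_dom3 U(1)])
  have "Ck_on m (\<lambda>p. G (?\<pi> p)) ?V"
    by (rule Ck_on_compose[OF V _ Ck_on_subset[OF Ck_on_projection_dom3] U(3)]) auto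
  then have "Ck_on m (sphere_ext \<zeta>) ?V"
    by (rule Ck_on_cong[OF V, rotated]) (auto simp: sphere_ext_def intro!: U(4) projection_in_M_dom)
  then show "\<exists>U. open U \<and> q \<in> U \<and> Ck_on m (sphere_ext \<zeta>) U"
    using V q U(2) by (intro exI[of _ ?V]) auto
qed

lemma homogeneous_sphere_ext:
  assumes "smooth_on M_dom \<zeta>" shows "homogeneous (sphere_ext \<zeta>)"
  by unfold_locales (use Cinf_on_sphere_ext[OF assms] in \<open>auto simp: sphere_ext_def sgn_scaleR\<close>)

lemma sphere_ext_M_dom: "q \<in> M_dom \<Longrightarrow> sphere_ext \<zeta> q = \<zeta> q"
  by (cases q) (auto simp: M_dom_iff sphere_ext_def sgn_div_norm)

text \<open>Only the behaviour along one line matters, so the product structure of a separated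
  function passes to its derivatives; \<open>c\<close> collects the factors that are constant on the
  line.\<close>

lemma dd_slice:
  assumes F: "F differentiable (at q)" and A: "A differentiable (at x)" and S: "open S" "x \<in> S"
    and eq: "\<And>t. x + t *\<^sub>R b \<in> S \<Longrightarrow> F (q + t *\<^sub>R V) = A (x + t *\<^sub>R b) * (c::real)"
  shows "dd F V q = dd A b x * c"
proof -
  have "open ((\<lambda>t. x + t *\<^sub>R b) -` S)"
    by (rule open_vimage[OF S(1)]) (auto intro!: continuous_intros)
  moreover have "((\<lambda>t. A (x + t *\<^sub>R b) * c) has_vector_derivative dd A b x * c) (at 0)"
    using bounded_linear.has_vector_derivative[OF bounded_linear_mult_left has_vector_derivative_line0[OF A]] .
  ultimately have "((\<lambda>t. F (q + t *\<^sub>R V)) has_vector_derivative dd A b x * c) (at 0)"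
    using S by (elim has_vector_derivative_transform_within_open) (auto simp: eq)
  from vector_derivative_unique_at[OF has_vector_derivative_line0[OF F] this] show ?thesis .
qed

lemma Ck_on_zonal: "Ck_on m (\<lambda>x. poly p (v \<bullet> sgn x)) (- {0} :: 'a::euclidean_space set)"
proof (rule Ck_on_compose[OF _ _ _ Ck_on_poly])
  show "Ck_on m (\<lambda>x. v \<bullet> sgn x) (- {0} :: 'a set)"
    by (intro Ck_on_inner Ck_on_const Ck_on_sgn) auto
qed auto

definition separated :: "(real \<Rightarrow> real) \<Rightarrow> real poly \<Rightarrow> 'a \<Rightarrow> real poly \<Rightarrow> 'b \<Rightarrow>
    'a::euclidean_space \<times> 'b::euclidean_space \<times> real \<Rightarrow> real" where
  "separated \<eta> P v Q w q = \<eta> (snd (snd q)) * poly P (v \<bullet> sgn (fst q)) * poly Q (w \<bullet> sgn (fst (snd q)))"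

lemma homogeneous_separated:
  assumes "Cinf_on \<eta> UNIV" shows "homogeneous (separated \<eta> P v Q w)"
proof
  show "Cinf_on (separated \<eta> P v Q w) dom3"
    unfolding Cinf_on_def separated_def
  proof (intro allI Ck_on_mult open_dom3)
    fix m
    show "Ck_on m (\<lambda>q. \<eta> (snd (snd q))) (dom3 :: ('a \<times> 'b \<times> real) set)"
      by (rule Ck_on_compose[OF open_dom3 _ _ Cinf_onD[OF assms]], rule UNIV_I) (intro Ck_on_snd open_dom3 Ck_on_ident)
    show "Ck_on m (\<lambda>q. poly P (v \<bullet> sgn (fst q))) (dom3 :: ('a \<times> 'b \<times> real) set)"
      by (rule Ck_on_compose[OF open_dom3 _ _ Ck_on_poly], rule UNIV_I) (intro Ck_on_inner Ck_on_const Ck_on_sgn_dom3 open_dom3)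
    show "Ck_on m (\<lambda>q. poly Q (w \<bullet> sgn (fst (snd q)))) (dom3 :: ('a \<times> 'b \<times> real) set)"
      by (rule Ck_on_compose[OF open_dom3 _ _ Ck_on_poly], rule UNIV_I) (intro Ck_on_inner Ck_on_const Ck_on_sgn_dom3 open_dom3)
  qed
qed (auto simp: separated_def sgn_scaleR)

lemma laplace_separated:
  fixes v :: "'a::euclidean_space" and w :: "'b::euclidean_space"
  assumes \<eta>: "Cinf_on \<eta> UNIV" and dim: "DIM('a) = k + 1" "DIM('b) = l + 1"
    and vw: "norm v = 1" "norm w = 1" 
    and P: "gegen_op k P = smult (- a) P" and Q: "gegen_op l Q = smult (- b) Q"
    and q: "x \<noteq> 0" "y \<noteq> 0"
  shows "(x \<bullet> x) * laplace_x (separated \<eta> P v Q w) (x, y, u) = - a * separated \<eta> P v Q w (x, y, u)"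
    "(y \<bullet> y) * laplace_y (separated \<eta> P v Q w) (x, y, u) = - b * separated \<eta> P v Q w (x, y, u)"
proof -
  interpret homogeneous "separated \<eta> P v Q w" by (rule homogeneous_separated[OF \<eta>])
  have C: "Ck_on 2 (\<lambda>x. poly p (e \<bullet> sgn x)) (- {0})" for p and e :: "'c::euclidean_space" by (rule Ck_on_zonal)
  have d0: "(\<lambda>x. poly p (e \<bullet> sgn x)) differentiable (at x)" if "x \<noteq> 0" for p and e x :: "'c::euclidean_space"
    using C[of p e] that by (simp add: numeral_2_eq_2)
  have d1: "dd (\<lambda>x. poly p (e \<bullet> sgn x)) h differentiable (at x)" if "x \<noteq> 0" for p and e x h :: "'c::euclidean_space"
    using C[of p e] that by (simp add: numeral_2_eq_2)
  let ?S = "separated \<eta> P v Q w"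
  have x1: "dd ?S (h, 0, 0) (x', y, u) = dd (\<lambda>x. poly P (v \<bullet> sgn x)) h x' * (\<eta> u * poly Q (w \<bullet> sgn y))" if "x' \<noteq> 0" for h x'
    by (rule dd_slice[where S = "- {0}"]) (use that q diff d0 in \<open>auto simp: mem_dom3 separated_def\<close>)
  have "dd (dd ?S (h, 0, 0)) (h, 0, 0) (x, y, u) = dd (dd (\<lambda>x. poly P (v \<bullet> sgn x)) h) h x * (\<eta> u * poly Q (w \<bullet> sgn y))" for h
    by (rule dd_slice[where S = "- {0}"]) (use q diff2 d1 x1 in \<open>auto simp: mem_dom3\<close>)
  then have "laplace_x ?S (x, y, u) = poly (gegen_op k P) (v \<bullet> sgn x) / (x \<bullet> x) * (\<eta> u * poly Q (w \<bullet> sgn y))"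
    by (simp add: laplace_x_def laplace_zonal[OF dim(1) q(1) vw(1)] sum_distrib_right[symmetric])
  then show "(x \<bullet> x) * laplace_x ?S (x, y, u) = - a * ?S (x, y, u)"
    using q by (simp add: P separated_def)
  have y1: "dd ?S (0, h, 0) (x, y', u) = dd (\<lambda>y. poly Q (w \<bullet> sgn y)) h y' * (\<eta> u * poly P (v \<bullet> sgn x))" if "y' \<noteq> 0" for h y'
    by (rule dd_slice[where S = "- {0}"]) (use that q diff d0 in \<open>auto simp: mem_dom3 separated_def\<close>)
  have "dd (dd ?S (0, h, 0)) (0, h, 0) (x, y, u) = dd (dd (\<lambda>y. poly Q (w \<bullet> sgn y)) h) h y * (\<eta> u * poly P (v \<bullet> sgn x))" for h
    by (rule dd_slice[where S = "- {0}"]) (use q diff2 d1 y1 in \<open>auto simp: mem_dom3\<close>)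
  then have "laplace_y ?S (x, y, u) = poly (gegen_op l Q) (w \<bullet> sgn y) / (y \<bullet> y) * (\<eta> u * poly P (v \<bullet> sgn x))"
    by (simp add: laplace_y_def laplace_zonal[OF dim(2) q(2) vw(2)] sum_distrib_right[symmetric])
  then show "(y \<bullet> y) * laplace_y ?S (x, y, u) = - b * ?S (x, y, u)"
    using q by (simp add: Q separated_def)
qed

section \<open>Scaling behaviour and Green's identity for degree 0 functions\<close>

lemma dd_scaling:
  fixes F :: "'a::euclidean_space \<times> 'b::euclidean_space \<times> real \<Rightarrow> real"
  assumes F: "\<And>q. q \<in> dom3 \<Longrightarrow> F differentiable (at q)" and rs: "r > 0" "s > 0"
    and FG: "\<And>x y u. x \<noteq> 0 \<Longrightarrow> y \<noteq> 0 \<Longrightarrow> F (r *\<^sub>R x, s *\<^sub>R y, u) = (c::real) * F (x, y, u)"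
    and q: "x \<noteq> 0" "y \<noteq> 0"
  shows "c * dd F (v, w, t) (x, y, u) = dd F (r *\<^sub>R v, s *\<^sub>R w, t) (r *\<^sub>R x, s *\<^sub>R y, u)"
proof -
  define L where "L p = (r *\<^sub>R fst p, s *\<^sub>R fst (snd p), snd (snd p))" for p :: "'a \<times> 'b \<times> real"
  have L: "(L has_derivative L) (at p)" for p
    unfolding L_def by (auto intro!: derivative_eq_intros)
  have "((\<lambda>p. F (L p)) has_derivative (\<lambda>V. dd F (L V) (L (x, y, u)))) (at (x, y, u))"
    by (rule has_derivative_compose[OF L has_derivative_dd]) (use q rs F in \<open>auto simp: L_def mem_dom3\<close>)
  then have "((\<lambda>p. c * F p) has_derivative (\<lambda>V. dd F (L V) (L (x, y, u)))) (at (x, y, u))"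
  proof (rule has_derivative_transform_within_open[OF _ open_dom3])
    show "(x, y, u) \<in> dom3" using q by (simp add: mem_dom3)
    show "F (L p) = c * F p" if "p \<in> dom3" for p
      using that by (cases p) (simp add: L_def mem_dom3 FG)
  qed
  moreover have "((\<lambda>p. c * F p) has_derivative (\<lambda>V. c * dd F V (x, y, u))) (at (x, y, u))"
    by (intro has_derivative_mult_right has_derivative_dd F) (use q in \<open>simp add: mem_dom3\<close>)
  ultimately have "(\<lambda>V. dd F (L V) (L (x, y, u))) = (\<lambda>V. c * dd F V (x, y, u))"
    by (rule has_derivative_unique)
  from fun_cong[OF this, of "(v, w, t)"] show ?thesis by (simp add: L_def)
qed

context homogeneous
begin

text \<open>Second derivatives of a degree 0 function have degree -2. This carries the eigenvalue
  equation, known only on the unit spheres, to all of \<open>dom3\<close>, where the integrals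
  live.\<close>

lemma laplace_scaling:
  assumes q: "x \<noteq> 0" "y \<noteq> 0"
  shows "laplace_x Z (sgn x, sgn y, u) = (x \<bullet> x) * laplace_x Z (x, y, u)"
    "laplace_y Z (sgn x, sgn y, u) = (y \<bullet> y) * laplace_y Z (x, y, u)"
proof -
  define r s where "r = norm x" and "s = norm y"
  have rs: "r > 0" "s > 0" using q by (simp_all add: r_def s_def)
  have xy: "r *\<^sub>R sgn x = x" "s *\<^sub>R sgn y = y" using q by (simp_all add: r_def s_def sgn_div_norm)
  have sq: "sgn x \<noteq> 0" "sgn y \<noteq> 0" using q by (simp_all add: sgn_zero_iff)
  have lin: "linear (\<lambda>V. dd Z V p)" if "p \<in> dom3" for p using has_derivative_linear[OF has_derivative_dd[OF diff[OF that]]] .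
  have lin2: "linear (\<lambda>V. dd (dd Z W) V p)" if "p \<in> dom3" for p W using has_derivative_linear[OF has_derivative_dd[OF diff2[OF that]]] .
  have fx: "dd Z (b, 0, 0) (r *\<^sub>R x', s *\<^sub>R y', u) = (1 / r) * dd Z (b, 0, 0) (x', y', u)" if "x' \<noteq> 0" "y' \<noteq> 0" for x' y' b u
    using dd_scaling[where F = Z and c = 1 and v = b and w = 0 and t = 0 and u = u, OF diff rs _ that] hom[OF _ _ rs] that rs
      linear_cmul[OF lin, of "(r *\<^sub>R x', s *\<^sub>R y', u)" r "(b, 0, 0)"]
    by (simp add: mem_dom3 field_simps)
  have fy: "dd Z (0, b, 0) (r *\<^sub>R x', s *\<^sub>R y', u) = (1 / s) * dd Z (0, b, 0) (x', y', u)" if "x' \<noteq> 0" "y' \<noteq> 0" for x' y' b u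
    using dd_scaling[where F = Z and c = 1 and v = 0 and w = b and t = 0 and u = u, OF diff rs _ that] hom[OF _ _ rs] that rs
      linear_cmul[OF lin, of "(r *\<^sub>R x', s *\<^sub>R y', u)" s "(0, b, 0)"]
    by (simp add: mem_dom3 field_simps)
  \<comment> \<open>The constant of \<open>dd_scaling\<close> is now 1 / r, the scaling of the first
    derivative by \<open>fx\<close>; rescaling the direction supplies the other factor of r.\<close>
  have gx: "dd (dd Z (b, 0, 0)) (b, 0, 0) (sgn x, sgn y, u) = r\<^sup>2 * dd (dd Z (b, 0, 0)) (b, 0, 0) (x, y, u)" for b
    using dd_scaling[where F = "dd Z (b, 0, 0)" and v = b and w = 0 and t = 0 and u = u, OF diff2 rs fx sq] rs q
      linear_cmul[OF lin2, of "(x, y, u)" "(b, 0, 0)" r "(b, 0, 0)"]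
    by (simp add: xy mem_dom3 field_simps power2_eq_square)
  have gy: "dd (dd Z (0, b, 0)) (0, b, 0) (sgn x, sgn y, u) = s\<^sup>2 * dd (dd Z (0, b, 0)) (0, b, 0) (x, y, u)" for b
    using dd_scaling[where F = "dd Z (0, b, 0)" and v = 0 and w = b and t = 0 and u = u, OF diff2 rs fy sq] rs q
      linear_cmul[OF lin2, of "(x, y, u)" "(0, b, 0)" s "(0, b, 0)"]
    by (simp add: xy mem_dom3 field_simps power2_eq_square)
  show "laplace_x Z (sgn x, sgn y, u) = (x \<bullet> x) * laplace_x Z (x, y, u)"
    unfolding laplace_x_def gx by (simp add: sum_distrib_left r_def dot_square_norm)
  show "laplace_y Z (sgn x, sgn y, u) = (y \<bullet> y) * laplace_y Z (x, y, u)"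
    unfolding laplace_y_def gy by (simp add: sum_distrib_left s_def dot_square_norm)
qed

lemma slice:
  assumes "p \<in> pair_dom"
  shows "dd (\<lambda>p. Z (fst p, snd p, u)) (v, w) p = dd Z (v, w, 0) (fst p, snd p, u)"
    "dd (dd (\<lambda>p. Z (fst p, snd p, u)) (v, w)) (v', w') p = dd (dd Z (v, w, 0)) (v', w', 0) (fst p, snd p, u)"
proof -
  have c: "dd (\<lambda>p. F (fst p, snd p, u)) (v, w) p = dd F (v, w, 0) (fst p, snd p, u)"
    if "F differentiable (at (fst p, snd p, u))" for F :: "'a \<times> 'b \<times> real \<Rightarrow> real" and v w p
  proof -
    have "((\<lambda>p. (fst p, snd p, u)) has_derivative (\<lambda>V. (fst V, snd V, 0))) (at p)"
      by (auto intro!: derivative_eq_intros)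
    from dd_eqI[OF has_derivative_compose[OF this has_derivative_dd[OF that]]] show ?thesis by simp
  qed
  have d: "(fst p, snd p, u) \<in> dom3" if "p \<in> pair_dom" for p :: "'a \<times> 'b" 
    using that by (auto simp: pair_dom_def mem_dom3)
  show "dd (\<lambda>p. Z (fst p, snd p, u)) (v, w) p = dd Z (v, w, 0) (fst p, snd p, u)"
    by (rule c[OF diff[OF d[OF assms]]])
  have "(\<lambda>p. dd Z (v, w, 0) (fst p, snd p, u)) differentiable (at p)"
  proof -
    have "((\<lambda>p. (fst p, snd p, u)) has_derivative (\<lambda>V. (fst V, snd V, 0))) (at p)"
      by (auto intro!: derivative_eq_intros)
    from has_derivative_compose[OF this has_derivative_dd[OF diff2[OF d[OF assms]]]] show ?thesis
      by (auto simp: differentiable_def)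
  qed
  then have "dd (dd (\<lambda>p. Z (fst p, snd p, u)) (v, w)) (v', w') p = dd (\<lambda>p. dd Z (v, w, 0) (fst p, snd p, u)) (v', w') p"
    by (intro differentiable_cong_open(2)[OF open_pair_dom assms] c[OF diff[OF d], symmetric])
  also have "\<dots> = dd (dd Z (v, w, 0)) (v', w', 0) (fst p, snd p, u)"
    by (rule c[OF diff2[OF d[OF assms]]])
  finally show "dd (dd (\<lambda>p. Z (fst p, snd p, u)) (v, w)) (v', w') p = dd (dd Z (v, w, 0)) (v', w', 0) (fst p, snd p, u)" .
qed

lemma Ck_on_slice: "Ck_on m (\<lambda>p. Z (fst p, snd p, u)) pair_dom"
  by (rule Ck_on_compose[OF open_pair_dom _ _ Cinf_onD[OF smooth]])
     (auto simp: pair_dom_def mem_dom3 simp del: split_paired_All intro!: Ck_on_Pair Ck_on_fst Ck_on_snd Ck_on_ident Ck_on_const open_pair_dom[unfolded pair_dom_def])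

text \<open>The partial gradient of a degree 0 function is orthogonal to the position vector.
  \<open>\<rho>\<close> is the factor by which the gradient of a radial weight is a multiple of that
  vector; this supplies the hypotheses of \<open>Green_identity\<close>.\<close>

lemma slice_perp:
  assumes "p \<in> pair_dom"
  shows "(\<Sum>b\<in>Basis. dd (\<lambda>p. Z (fst p, snd p, u)) (b, 0) p * (\<rho> * (fst p \<bullet> b))) = 0"
    "(\<Sum>b\<in>Basis. dd (\<lambda>p. Z (fst p, snd p, u)) (0, b) p * (\<rho> * (snd p \<bullet> b))) = 0"
proof -
  have nz: "fst p \<noteq> 0" "snd p \<noteq> 0" using assms by (auto simp: pair_dom_def)
  have d: "Z differentiable (at (fst p, snd p, u))" by (rule diff) (simp add: mem_dom3 nz)
  have "(\<Sum>b\<in>Basis. dd (\<lambda>p. Z (fst p, snd p, u)) (b, 0) p * (\<rho> * (fst p \<bullet> b))) = \<rho> * (grad_x Z (fst p, snd p, u) \<bullet> fst p)"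
    unfolding slice(1)[OF assms] grad_x_def inner_sum_left sum_distrib_left
    by (rule sum.cong) (simp_all add: inner_commute[of "fst p"])
  then show "(\<Sum>b\<in>Basis. dd (\<lambda>p. Z (fst p, snd p, u)) (b, 0) p * (\<rho> * (fst p \<bullet> b))) = 0"
    by (simp add: inner_grad[OF d] radial_derivative[OF nz])
  have "(\<Sum>b\<in>Basis. dd (\<lambda>p. Z (fst p, snd p, u)) (0, b) p * (\<rho> * (snd p \<bullet> b))) = \<rho> * (grad_y Z (fst p, snd p, u) \<bullet> snd p)"
    unfolding slice(1)[OF assms] grad_y_def inner_sum_left sum_distrib_left
    by (rule sum.cong) (simp_all add: inner_commute[of "snd p"])
  then show "(\<Sum>b\<in>Basis. dd (\<lambda>p. Z (fst p, snd p, u)) (0, b) p * (\<rho> * (snd p \<bullet> b))) = 0"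
    by (simp add: inner_grad[OF d] radial_derivative[OF nz])
qed

end

lemma bump_real_derivative: "(bump has_real_derivative deriv bump r) (at r)"
  using dd_real(2)[OF Ck_on_differentiable[OF Ck_on_bump[unfolded One_nat_def]]] by blast

lemma dd_radial_cutoff:
  fixes p :: "'a::euclidean_space \<times> 'b::euclidean_space"
  shows "\<exists>\<rho>. \<forall>b. dd (\<lambda>p. (fst p \<bullet> fst p) * cutoff p) (b, 0) p = \<rho> * (fst p \<bullet> b)"
    "\<exists>\<rho>. \<forall>b. dd (\<lambda>p. (snd p \<bullet> snd p) * cutoff p) (0, b) p = \<rho> * (snd p \<bullet> b)"
proof -
  have nx: "((\<lambda>p. fst p \<bullet> fst p) has_derivative (\<lambda>V. 2 * (fst p \<bullet> fst V))) (at p)"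
    using has_derivative_inner[OF has_derivative_fst[OF has_derivative_ident] has_derivative_fst[OF has_derivative_ident], of p UNIV]
    by (simp add: inner_commute)
  have ny: "((\<lambda>p. snd p \<bullet> snd p) has_derivative (\<lambda>V. 2 * (snd p \<bullet> snd V))) (at p)"
    using has_derivative_inner[OF has_derivative_snd[OF has_derivative_ident] has_derivative_snd[OF has_derivative_ident], of p UNIV]
    by (simp add: inner_commute)
  have bx: "((\<lambda>p. bump (fst p \<bullet> fst p)) has_derivative (\<lambda>V. deriv bump (fst p \<bullet> fst p) * (2 * (fst p \<bullet> fst V)))) (at p)"
    by (rule has_derivative_compose[OF nx bump_real_derivative[unfolded has_field_derivative_def]])
  have bY: "((\<lambda>p. bump (snd p \<bullet> snd p)) has_derivative (\<lambda>V. deriv bump (snd p \<bullet> snd p) * (2 * (snd p \<bullet> snd V)))) (at p)"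
    by (rule has_derivative_compose[OF ny bump_real_derivative[unfolded has_field_derivative_def]])
  note c = has_derivative_mult[OF bx bY, folded cutoff_def]
  let ?X = "fst p \<bullet> fst p" and ?Y = "snd p \<bullet> snd p"
  have "dd (\<lambda>p. (fst p \<bullet> fst p) * cutoff p) (b, 0) p = 
     (2 * cutoff p + 2 * ?X * deriv bump ?X * bump ?Y) * (fst p \<bullet> b)" for b
    using dd_eqI[OF has_derivative_mult[OF nx c], of "(b, 0)"] by (simp add: algebra_simps)
  then show "\<exists>\<rho>. \<forall>b. dd (\<lambda>p. (fst p \<bullet> fst p) * cutoff p) (b, 0) p = \<rho> * (fst p \<bullet> b)" by blast
  have "dd (\<lambda>p. (snd p \<bullet> snd p) * cutoff p) (0, b) p = 
     (2 * cutoff p + 2 * ?Y * deriv bump ?Y * bump ?X) * (snd p \<bullet> b)" for b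
    using dd_eqI[OF has_derivative_mult[OF ny c], of "(0, b)"] by (simp add: algebra_simps)
  then show "\<exists>\<rho>. \<forall>b. dd (\<lambda>p. (snd p \<bullet> snd p) * cutoff p) (0, b) p = \<rho> * (snd p \<bullet> b)" by blast
qed

text \<open>With the weight |x|^2 \<open>cutoff\<close> the degree -2 Laplacian in \<open>x\<close>
  becomes the self-adjoint spherical one, and similarly in \<open>y\<close>. The parameters
  \<open>u\<close> and \<open>u'\<close> are independent because only the sphere variables are
  integrated.\<close>

lemma Green_slice:
  fixes Z \<Theta> :: "'a::euclidean_space \<times> 'b::euclidean_space \<times> real \<Rightarrow> real"
  assumes "homogeneous Z" "homogeneous \<Theta>"
  shows "integral UNIV (\<lambda>p. laplace_x Z (fst p, snd p, u) * \<Theta> (fst p, snd p, u') * ((fst p \<bullet> fst p) * cutoff p)) =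
      integral UNIV (\<lambda>p. Z (fst p, snd p, u) * laplace_x \<Theta> (fst p, snd p, u') * ((fst p \<bullet> fst p) * cutoff p))"
    "integral UNIV (\<lambda>p. laplace_y Z (fst p, snd p, u) * \<Theta> (fst p, snd p, u') * ((snd p \<bullet> snd p) * cutoff p)) =
      integral UNIV (\<lambda>p. Z (fst p, snd p, u) * laplace_y \<Theta> (fst p, snd p, u') * ((snd p \<bullet> snd p) * cutoff p))"
proof -
  interpret Z: homogeneous Z by fact
  interpret \<Theta>: homogeneous \<Theta> by fact
  let ?Z = "\<lambda>p. Z (fst p, snd p, u)" and ?T = "\<lambda>p. \<Theta> (fst p, snd p, u')"
  \<comment> \<open>The slice derivative formulas hold on \<open>pair_dom\<close> only; elsewhere
    both sides are multiplied by \<open>cutoff p = 0\<close>.\<close>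
  have 0: "a * cutoff p = b * cutoff p" if "p \<in> pair_dom \<Longrightarrow> a = b" for a b p
    using that cutoff_eq_0[of p] pair_shell_subset by (cases "p \<in> pair_dom") auto
  have cutoffC: "Ck_on 1 cutoff pair_dom" using Ck_on_subset[OF Ck_on_cutoff] by blast
  have injx: "inj_on (\<lambda>b. (b, 0) :: 'a \<times> 'b) S" and injy: "inj_on (\<lambda>b. (0, b) :: 'a \<times> 'b) S'" for S S'
    by (auto simp: inj_on_def)
  have "integral UNIV (\<lambda>p. (\<Sum>b\<in>(\<lambda>b. (b, 0)) ` Basis. dd (dd ?Z b) b p) * ?T p * ((fst p \<bullet> fst p) * cutoff p)) =
      integral UNIV (\<lambda>p. ?Z p * (\<Sum>b\<in>(\<lambda>b. (b, 0)) ` Basis. dd (dd ?T b) b p) * ((fst p \<bullet> fst p) * cutoff p))"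
  proof (rule Green_identity[OF open_pair_dom compact_pair_shell pair_shell_subset])
    fix p :: "'a \<times> 'b" assume p: "p \<in> pair_dom"
    obtain \<rho> where \<rho>: "\<And>b. dd (\<lambda>p. (fst p \<bullet> fst p) * cutoff p) (b, 0) p = \<rho> * (fst p \<bullet> b)" 
      using dd_radial_cutoff(1) by blast
    show "(\<Sum>b\<in>(\<lambda>b. (b, 0)) ` Basis. dd ?Z b p * dd (\<lambda>p. (fst p \<bullet> fst p) * cutoff p) b p) = 0"
      "(\<Sum>b\<in>(\<lambda>b. (b, 0)) ` Basis. dd ?T b p * dd (\<lambda>p. (fst p \<bullet> fst p) * cutoff p) b p) = 0"
      by (simp_all only: sum.reindex[OF injx] o_def \<rho> Z.slice_perp[OF p] \<Theta>.slice_perp[OF p])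
  qed (auto simp: cutoff_eq_0 simp del: One_nat_def intro!: Z.Ck_on_slice \<Theta>.Ck_on_slice Ck_on_mult Ck_on_inner Ck_on_fst Ck_on_ident open_pair_dom cutoffC)
  moreover have "(\<Sum>b\<in>(\<lambda>b. (b, 0)) ` Basis. dd (dd ?Z b) b p) * ?T p * ((fst p \<bullet> fst p) * cutoff p) = 
      laplace_x Z (fst p, snd p, u) * ?T p * ((fst p \<bullet> fst p) * cutoff p)" 
    "?Z p * (\<Sum>b\<in>(\<lambda>b. (b, 0)) ` Basis. dd (dd ?T b) b p) * ((fst p \<bullet> fst p) * cutoff p) =
      ?Z p * laplace_x \<Theta> (fst p, snd p, u') * ((fst p \<bullet> fst p) * cutoff p)" for p
    unfolding mult.assoc[symmetric]
    by (rule 0, simp only: sum.reindex[OF injx] o_def Z.slice \<Theta>.slice laplace_x_def)+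
  ultimately show "integral UNIV (\<lambda>p. laplace_x Z (fst p, snd p, u) * \<Theta> (fst p, snd p, u') * ((fst p \<bullet> fst p) * cutoff p)) =
      integral UNIV (\<lambda>p. Z (fst p, snd p, u) * laplace_x \<Theta> (fst p, snd p, u') * ((fst p \<bullet> fst p) * cutoff p))"
    by simp
  have "integral UNIV (\<lambda>p. (\<Sum>b\<in>(\<lambda>b. (0, b)) ` Basis. dd (dd ?Z b) b p) * ?T p * ((snd p \<bullet> snd p) * cutoff p)) =
      integral UNIV (\<lambda>p. ?Z p * (\<Sum>b\<in>(\<lambda>b. (0, b)) ` Basis. dd (dd ?T b) b p) * ((snd p \<bullet> snd p) * cutoff p))"
  proof (rule Green_identity[OF open_pair_dom compact_pair_shell pair_shell_subset])
    fix p :: "'a \<times> 'b" assume p: "p \<in> pair_dom"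
    obtain \<rho> where \<rho>: "\<And>b. dd (\<lambda>p. (snd p \<bullet> snd p) * cutoff p) (0, b) p = \<rho> * (snd p \<bullet> b)" 
      using dd_radial_cutoff(2) by blast
    show "(\<Sum>b\<in>(\<lambda>b. (0, b)) ` Basis. dd ?Z b p * dd (\<lambda>p. (snd p \<bullet> snd p) * cutoff p) b p) = 0"
      "(\<Sum>b\<in>(\<lambda>b. (0, b)) ` Basis. dd ?T b p * dd (\<lambda>p. (snd p \<bullet> snd p) * cutoff p) b p) = 0"
      by (simp_all only: sum.reindex[OF injy] o_def \<rho> Z.slice_perp[OF p] \<Theta>.slice_perp[OF p])
  qed (auto simp: cutoff_eq_0 simp del: One_nat_def intro!: Z.Ck_on_slice \<Theta>.Ck_on_slice Ck_on_mult Ck_on_inner Ck_on_snd Ck_on_ident open_pair_dom cutoffC)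
  moreover have "(\<Sum>b\<in>(\<lambda>b. (0, b)) ` Basis. dd (dd ?Z b) b p) * ?T p * ((snd p \<bullet> snd p) * cutoff p) = 
      laplace_y Z (fst p, snd p, u) * ?T p * ((snd p \<bullet> snd p) * cutoff p)" 
    "?Z p * (\<Sum>b\<in>(\<lambda>b. (0, b)) ` Basis. dd (dd ?T b) b p) * ((snd p \<bullet> snd p) * cutoff p) =
      ?Z p * laplace_y \<Theta> (fst p, snd p, u') * ((snd p \<bullet> snd p) * cutoff p)" for p
    unfolding mult.assoc[symmetric]
    by (rule 0, simp only: sum.reindex[OF injy] o_def Z.slice \<Theta>.slice laplace_y_def)+
  ultimately show "integral UNIV (\<lambda>p. laplace_y Z (fst p, snd p, u) * \<Theta> (fst p, snd p, u') * ((snd p \<bullet> snd p) * cutoff p)) =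
      integral UNIV (\<lambda>p. Z (fst p, snd p, u) * laplace_y \<Theta> (fst p, snd p, u') * ((snd p \<bullet> snd p) * cutoff p))"
    by simp
qed

section \<open>The two inclusions between the spectra, for a potential \<open>V\<close> depending on
  \<open>u\<close>\<close>

definition separated_op ::
    "nat \<Rightarrow> nat \<Rightarrow> (real \<Rightarrow> real) \<Rightarrow> (real \<Rightarrow> real) \<Rightarrow> (real \<Rightarrow> real) \<Rightarrow> nat \<Rightarrow> nat \<Rightarrow> (real \<Rightarrow> real) \<Rightarrow> real \<Rightarrow> real" where
  "separated_op k l f1 f2 V i j \<eta> u = radial_part k l f1 f2 \<eta> u
     - (sphere_eigenvalue k i / (fun_f f1 f2 u)\<^sup>2 + sphere_eigenvalue l j / (f2 u)\<^sup>2) * \<eta> u + V u * \<eta> u"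

lemma eigenfunction_of_separated:
  assumes "profile f1 f2" and kl: "k \<ge> 1" "l \<ge> 1"
    and dim: "DIM('a::euclidean_space) = k + 1" "DIM('b::euclidean_space) = l + 1"
    and \<mu>: "\<mu> \<in> spectrum UNIV (periodic_functions T) (separated_op k l f1 f2 V i j)"
  shows "\<mu> \<in> spectrum (M_dom :: ('a \<times> 'b \<times> real) set) (M_functions T)
     (\<lambda>\<zeta> p. laplacian M_dom (immersion f1 f2) \<zeta> p + V (snd (snd p)) * \<zeta> p)"
proof -
  interpret profile f1 f2 by fact
  obtain \<eta> u0 where \<eta>: "\<eta> \<in> periodic_functions T" "\<eta> u0 \<noteq> 0" 
    and eq: "\<And>u. separated_op k l f1 f2 V i j \<eta> u + \<mu> * \<eta> u = 0"
    using \<mu> unfolding spectrum_def by blast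
  have C\<eta>: "Cinf_on \<eta> UNIV" and per: "\<And>u. \<eta> (u + T) = \<eta> u"
    using \<eta>(1) by (auto simp: periodic_functions_def smooth_on_UNIV)
  let ?a = "sphere_eigenvalue k i" and ?b = "sphere_eigenvalue l j"
  obtain P where P: "P \<noteq> 0" "gegen_op k P = smult (- ?a) P" using gegen_exists[OF kl(1)] by blast
  obtain Q where Q: "Q \<noteq> 0" "gegen_op l Q = smult (- ?b) Q" using gegen_exists[OF kl(2)] by blast
  obtain v :: 'a where v: "norm v = 1" using nonempty_Basis norm_Basis by blast
  obtain w :: 'b where w: "norm w = 1" using nonempty_Basis norm_Basis by blast
  obtain y0 :: 'a where y0: "norm y0 = 1" "poly P (v \<bullet> y0) \<noteq> 0"
    using zonal_nonzero[of v P] v P kl dim by auto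
  obtain z0 :: 'b where z0: "norm z0 = 1" "poly Q (w \<bullet> z0) \<noteq> 0"
    using zonal_nonzero[of w Q] w Q kl dim by auto
  define \<zeta> where "\<zeta> = separated \<eta> P v Q w"
  interpret homogeneous \<zeta> unfolding \<zeta>_def by (rule homogeneous_separated[OF C\<eta>])
  interpret profile_function f1 f2 \<zeta> ..
  have "\<zeta> \<in> M_functions T"
    using Cinf_on_smooth_on[OF open_dom3 M_dom_subset_dom3 smooth] per
    by (simp add: M_functions_def \<zeta>_def separated_def)
  moreover have "\<exists>p\<in>M_dom. \<zeta> p \<noteq> 0"
    using y0 z0 \<eta>(2) 
    by (intro bexI[of _ "(y0, z0, u0)"]) (simp_all add: \<zeta>_def separated_def M_dom_iff sgn_div_norm)
  moreover have "laplacian M_dom (immersion f1 f2) \<zeta> p + V (snd (snd p)) * \<zeta> p + \<mu> * \<zeta> p = 0" if "p \<in> M_dom" for p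
  proof -
    obtain y z u where p: "p = (y, z, u)" by (cases p)
    have yz: "norm y = 1" "norm z = 1" using that by (auto simp: p M_dom_iff)
    then have nz: "y \<noteq> 0" "z \<noteq> 0" "y \<bullet> y = 1" "z \<bullet> z = 1" by (auto simp: dot_square_norm)
    have lx: "laplace_x \<zeta> p = - ?a * \<zeta> p" and ly: "laplace_y \<zeta> p = - ?b * \<zeta> p"
      using laplace_separated[OF C\<eta> dim v w P(2) Q(2) nz(1,2), of u] nz by (simp_all add: \<zeta>_def p)
    \<comment> \<open>At a fixed point of the spheres the product is a constant multiple of the
      radial factor, so the ordinary operator can be applied to the latter.\<close>
    define c where "c = poly P (v \<bullet> y) * poly Q (w \<bullet> z)"
    have zc: "(\<lambda>u. \<zeta> (y, z, u)) = (\<lambda>u. \<eta> u * c)"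
      using yz by (simp add: \<zeta>_def separated_def c_def sgn_div_norm mult.assoc)
    have "deriv (\<lambda>u. \<eta> u * c) = (\<lambda>u. deriv \<eta> u * c)"
      by (intro ext DERIV_imp_deriv DERIV_cmult_right Cinf_on_real_derivative[OF C\<eta>] UNIV_I)
    moreover have "deriv (\<lambda>u. deriv \<eta> u * c) u = deriv (deriv \<eta>) u * c"
      by (intro DERIV_imp_deriv DERIV_cmult_right Cinf_on_real_derivative[OF Cinf_on_deriv[OF C\<eta> open_UNIV]] UNIV_I)
    ultimately have r: "radial_part k l f1 f2 (\<lambda>u. \<zeta> (y, z, u)) u = radial_part k l f1 f2 \<eta> u * c"
      unfolding zc radial_part_def Let_def by (simp add: algebra_simps)
    have \<zeta>p: "\<zeta> p = \<eta> u * c" using fun_cong[OF zc, of u] by (simp add: p)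
    have lap: "laplacian M_dom (immersion f1 f2) \<zeta> p = laplace_x \<zeta> p / (f u)\<^sup>2 + laplace_y \<zeta> p / (f2 u)\<^sup>2 +
        radial_part k l f1 f2 (\<lambda>u. \<zeta> (y, z, u)) u"
      unfolding p by (rule laplacian_formula[OF yz refl dim])
    have u: "snd (snd p) = u" by (simp add: p)
    have "laplacian M_dom (immersion f1 f2) \<zeta> p + V (snd (snd p)) * \<zeta> p + \<mu> * \<zeta> p = 
       c * (separated_op k l f1 f2 V i j \<eta> u + \<mu> * \<eta> u)"
      unfolding lap lx ly r \<zeta>p u separated_op_def by (simp add: algebra_simps)
    then show ?thesis using eq by simp
  qed
  ultimately show ?thesis unfolding spectrum_def by blast
qed

lemma sgn_sgn_vector: "sgn (sgn x) = sgn x" for x :: "'a::real_normed_vector"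
  by (cases "x = 0") (simp_all add: sgn_div_norm)

lemma exists_separated_eigenfunction:
  assumes "profile f1 f2" and kl: "k \<ge> 1" "l \<ge> 1"
    and dim: "DIM('a::euclidean_space) = k + 1" "DIM('b::euclidean_space) = l + 1"
    and \<mu>: "\<mu> \<in> spectrum (M_dom :: ('a \<times> 'b \<times> real) set) (M_functions T)
     (\<lambda>\<zeta> p. laplacian M_dom (immersion f1 f2) \<zeta> p + V (snd (snd p)) * \<zeta> p)"
  shows "\<exists>i j. \<mu> \<in> spectrum UNIV (periodic_functions T) (separated_op k l f1 f2 V i j)"
proof -
  interpret profile f1 f2 by fact
  obtain \<zeta> :: "'a \<times> 'b \<times> real \<Rightarrow> real" and p0 where \<zeta>: "\<zeta> \<in> M_functions T" and p0: "p0 \<in> M_dom" "\<zeta> p0 \<noteq> 0"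
    and eq: "\<And>p. p \<in> M_dom \<Longrightarrow> laplacian M_dom (immersion f1 f2) \<zeta> p + V (snd (snd p)) * \<zeta> p + \<mu> * \<zeta> p = 0"
    using \<mu> unfolding spectrum_def by blast
  have sm: "smooth_on M_dom \<zeta>" and per: "\<And>y z u. norm y = 1 \<Longrightarrow> norm z = 1 \<Longrightarrow> \<zeta> (y, z, u + T) = \<zeta> (y, z, u)"
    using \<zeta> by (auto simp: M_functions_def)
  define Z where "Z = sphere_ext \<zeta>"
  interpret homogeneous Z unfolding Z_def by (rule homogeneous_sphere_ext[OF sm])
  interpret profile_function f1 f2 Z ..
  have Zsgn: "Z (sgn x, sgn y, u) = Z (x, y, u)" for x y u
    by (simp add: Z_def sphere_ext_def sgn_sgn_vector)
  have Zper: "Z (x, y, u + T) = Z (x, y, u)" if "x \<noteq> 0" "y \<noteq> 0" for x y u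
    using that per[of "sgn x" "sgn y" u] by (simp add: Z_def sphere_ext_def norm_sgn)
  obtain y0 z0 u0 where p0e: "p0 = (y0, z0, u0)" by (cases p0)
  have yz0: "y0 \<in> sphere 0 1" "z0 \<in> sphere 0 1" using p0(1) by (auto simp: p0e M_dom_iff)
  have "continuous_on (sphere 0 1 \<times> sphere 0 1) (\<lambda>p. Z (fst p, snd p, u0))"
    by (rule continuous_on_subset[OF Ck_on_continuous[OF Ck_on_slice]]) (auto simp: pair_dom_def)
  moreover have "Z (fst (y0, z0), snd (y0, z0), u0) \<noteq> 0"
    using p0 sphere_ext_M_dom[OF p0(1), of \<zeta>] by (simp add: Z_def p0e)
  ultimately obtain v w n m where vw: "norm v = 1" "norm w = 1" and
    mom: "integral UNIV (\<lambda>p. Z (fst (sgn (fst p), sgn (snd p)), snd (sgn (fst p), sgn (snd p)), u0) *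
       ((v \<bullet> sgn (fst p)) ^ n * (w \<bullet> sgn (snd p)) ^ m * cutoff p)) \<noteq> 0"
    using exists_nonzero_moment[OF _ yz0, of "\<lambda>p. Z (fst p, snd p, u0)"] by blast
  \<comment> \<open>The nonzero moment involves powers of linear forms; these are split into
    eigenpolynomials so that Green's identity can act on each part.\<close>
  obtain P where P: "monom 1 n = (\<Sum>i\<le>n. P i)" 
    "\<And>i. i \<le> n \<Longrightarrow> gegen_op k (P i) = smult (- sphere_eigenvalue k i) (P i)"
    using gegen_decomposition[OF kl(1) degree_monom_le[of "1::real" n]] by blast
  obtain Q where Q: "monom 1 m = (\<Sum>j\<le>m. Q j)" 
    "\<And>j. j \<le> m \<Longrightarrow> gegen_op l (Q j) = smult (- sphere_eigenvalue l j) (Q j)"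
    using gegen_decomposition[OF kl(2) degree_monom_le[of "1::real" m]] by blast
  \<comment> \<open>The radial factor is the constant 1: only the angular parts are paired with
    \<open>Z\<close>, and the dependence on \<open>u\<close> is left to the resulting
    coefficient.\<close>
  define \<Theta> where "\<Theta> i j = (separated (\<lambda>_. 1) (P i) v (Q j) w :: 'a \<times> 'b \<times> real \<Rightarrow> real)" for i j
  define W where "W i j p = \<Theta> i j (fst p, snd p, 0) * cutoff p" for i j and p :: "'a \<times> 'b"
  have C1: "Cinf_on (\<lambda>_. 1 :: real) (UNIV :: real set)" by (simp add: Cinf_on_def Ck_on_const)
  have h\<Theta>: "homogeneous (\<Theta> i j)" for i j unfolding \<Theta>_def by (rule homogeneous_separated[OF C1])
  have Wc: "continuous_on pair_dom (W i j)" for i j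
    unfolding W_def
    by (intro continuous_on_mult Ck_on_continuous[OF homogeneous.Ck_on_slice[OF h\<Theta>]]
        continuous_on_subset[OF Ck_on_continuous[OF Ck_on_cutoff]]) auto
  have W0: "W i j p = 0" if "p \<notin> pair_shell" for i j p using cutoff_eq_0[OF that] by (simp add: W_def)
  have cZ: "continuous_on dom3 Z" by (rule Ck_on_continuous[OF Cinf_onD[OF smooth]])
  \<comment> \<open>The double sum of these coefficients over \<open>i\<close> and \<open>j\<close>
    is the nonzero moment, so they cannot all vanish at \<open>u0\<close>.\<close>
  have "\<exists>i\<le>n. \<exists>j\<le>m. slice_integral (W i j) Z u0 \<noteq> 0"
  proof (rule ccontr)
    assume "\<not> (\<exists>i\<le>n. \<exists>j\<le>m. slice_integral (W i j) Z u0 \<noteq> 0)"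
    then have "slice_integral (W i j) Z u0 = 0" if "i \<le> n" "j \<le> m" for i j using that by blast
    then have "((\<lambda>p. Z (fst p, snd p, u0) * W i j p) has_integral 0) UNIV" if "i \<le> n" "j \<le> m" for i j
      using integrable_integral[OF slice_integrable(1)[OF Wc[of i j] W0 cZ, of u0]] that 
      by (simp add: slice_integral_def)
    then have "((\<lambda>p. \<Sum>i\<le>n. \<Sum>j\<le>m. Z (fst p, snd p, u0) * W i j p) has_integral (\<Sum>i\<le>n. \<Sum>j\<le>m. 0)) UNIV"
      by (intro has_integral_sum) auto
    moreover have "(\<Sum>i\<le>n. \<Sum>j\<le>m. Z (fst p, snd p, u0) * W i j p) = 
       Z (fst (sgn (fst p), sgn (snd p)), snd (sgn (fst p), sgn (snd p)), u0) *
       ((v \<bullet> sgn (fst p)) ^ n * (w \<bullet> sgn (snd p)) ^ m * cutoff p)" for p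
    proof -
      have "(v \<bullet> sgn (fst p)) ^ n = poly (\<Sum>i\<le>n. P i) (v \<bullet> sgn (fst p))" "(w \<bullet> sgn (snd p)) ^ m = poly (\<Sum>j\<le>m. Q j) (w \<bullet> sgn (snd p))"
        unfolding P(1)[symmetric] Q(1)[symmetric] by (simp_all add: poly_monom)
      then have pq: "(v \<bullet> sgn (fst p)) ^ n * (w \<bullet> sgn (snd p)) ^ m = 
          (\<Sum>i\<le>n. \<Sum>j\<le>m. poly (P i) (v \<bullet> sgn (fst p)) * poly (Q j) (w \<bullet> sgn (snd p)))"
        by (simp add: poly_sum sum_product)
      show ?thesis unfolding pq
        by (simp add: Zsgn W_def \<Theta>_def separated_def sum_distrib_left sum_distrib_right mult.assoc)
    qed
    ultimately show False using mom by (simp add: integral_unique)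
  qed
  then obtain i j where ij: "i \<le> n" "j \<le> m" and nz: "slice_integral (W i j) Z u0 \<noteq> 0" by blast
  let ?a = "sphere_eigenvalue k i" and ?b = "sphere_eigenvalue l j"
  \<comment> \<open>The component of \<open>Z\<close> along the chosen pair of zonal eigenfunctions.
    The choice was made at \<open>u0\<close>, but the component is defined for all
    \<open>u\<close>.\<close>
  define \<eta> where "\<eta> = slice_integral (W i j) Z"
  note Wij = Wc[of i j] W0[of _ i j]
  have "Cinf_on \<eta> UNIV" unfolding \<eta>_def by (rule Cinf_on_slice_integral[OF Wij smooth])
  moreover have "\<eta> (u + T) = \<eta> u" for u
    unfolding \<eta>_def slice_integral_def
  proof (rule Henstock_Kurzweil_Integration.integral_cong)
    show "Z (fst p, snd p, u + T) * W i j p = Z (fst p, snd p, u) * W i j p" for p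
      using Zper[of "fst p" "snd p" u] W0[of p i j] pair_shell_subset 
      by (cases "p \<in> pair_dom") (auto simp: pair_dom_def)
  qed
  ultimately have "\<eta> \<in> periodic_functions T" by (simp add: periodic_functions_def smooth_on_UNIV)
  moreover have "\<eta> u0 \<noteq> 0" using nz by (simp add: \<eta>_def)
  moreover have "separated_op k l f1 f2 V i j \<eta> u + \<mu> * \<eta> u = 0" for u
  proof -
    let ?q = "\<lambda>p :: 'a \<times> 'b. (fst p, snd p, u)"
    let ?C = "real k * (f' u / f u) + real l * (f2' u / f2 u) - f' u * f'' u / w2 u"
    note smooth1 = Cinf_on_dd[OF smooth, of "(0, 0, 1)"]
    have d1: "deriv \<eta> = slice_integral (W i j) (Zu)"
      unfolding \<eta>_def by (intro ext DERIV_imp_deriv slice_integral_derivative[OF Wij smooth])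
    have d2: "deriv (deriv \<eta>) = slice_integral (W i j) (Zuu)"
      unfolding d1 by (intro ext DERIV_imp_deriv slice_integral_derivative[OF Wij smooth1])
    have I: "((\<lambda>p. F (?q p) * W i j p) has_integral slice_integral (W i j) F u) UNIV" if "continuous_on dom3 F" for F
      using integrable_integral[OF slice_integrable(1)[OF Wij that]] by (simp add: slice_integral_def)
    have c: "continuous_on dom3 (Zu)" "continuous_on dom3 (Zuu)"
      by (rule Ck_on_continuous[OF Cinf_onD], intro Cinf_on_dd smooth)+
    have I0: "((\<lambda>p. Z (?q p) * W i j p) has_integral \<eta> u) UNIV" using I[OF cZ] by (simp add: \<eta>_def)
    have I1: "((\<lambda>p. Zu (?q p) * W i j p) has_integral deriv \<eta> u) UNIV" using I[OF c(1)] by (simp add: d1)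
    have I2: "((\<lambda>p. Zuu (?q p) * W i j p) has_integral deriv (deriv \<eta>) u) UNIV" 
      using I[OF c(2)] by (simp add: d2)
    have off: "W i j p = 0" "cutoff p = 0" if "p \<notin> pair_dom" for p 
      using that W0 cutoff_eq_0 pair_shell_subset by blast+
    have ls: "(fst p \<bullet> fst p) * laplace_x (\<Theta> i j) (fst p, snd p, 0) = - ?a * \<Theta> i j (fst p, snd p, 0)"
      "(snd p \<bullet> snd p) * laplace_y (\<Theta> i j) (fst p, snd p, 0) = - ?b * \<Theta> i j (fst p, snd p, 0)" if "p \<in> pair_dom" for p
    proof -
      have nz: "fst p \<noteq> 0" "snd p \<noteq> 0" using that by (auto simp: pair_dom_def)
      show "(fst p \<bullet> fst p) * laplace_x (\<Theta> i j) (fst p, snd p, 0) = - ?a * \<Theta> i j (fst p, snd p, 0)"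
        "(snd p \<bullet> snd p) * laplace_y (\<Theta> i j) (fst p, snd p, 0) = - ?b * \<Theta> i j (fst p, snd p, 0)"
        unfolding \<Theta>_def by (rule laplace_separated[OF C1 dim vw P(2)[OF ij(1)] Q(2)[OF ij(2)] nz])+
    qed
    \<comment> \<open>Common to both spheres: \<open>F\<close> is a partial Laplacian of
      \<open>Z\<close> and \<open>G\<close> that of \<open>\<Theta> i j\<close>, with
      \<open>N\<close> the squared norm. Green's identity moves the Laplacian to the eigenfunction,
      which returns the factor \<open>- a\<close>.\<close>
    have pairing: "((\<lambda>p. F (?q p) * (N p * W i j p)) has_integral - a * \<eta> u) UNIV"
      if F: "continuous_on dom3 F" and N: "continuous_on pair_dom N"
        and Green: "integral UNIV (\<lambda>p. F (?q p) * \<Theta> i j (fst p, snd p, 0) * (N p * cutoff p)) =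
          integral UNIV (\<lambda>p. Z (?q p) * G (fst p, snd p, 0) * (N p * cutoff p))"
        and G: "\<And>p. p \<in> pair_dom \<Longrightarrow> N p * G (fst p, snd p, 0) = - a * \<Theta> i j (fst p, snd p, 0)"
      for F G N a
    proof -
      have int: "(\<lambda>p. F (?q p) * (N p * W i j p)) integrable_on UNIV"
        by (rule slice_integrable(1)[OF _ _ F]) (auto intro!: continuous_intros Wij N simp: W0)
      have "integral UNIV (\<lambda>p. F (?q p) * (N p * W i j p)) =
          integral UNIV (\<lambda>p. F (?q p) * \<Theta> i j (fst p, snd p, 0) * (N p * cutoff p))"
        by (simp add: W_def ac_simps)
      also have "\<dots> = integral UNIV (\<lambda>p. - a * (Z (?q p) * W i j p))"
        unfolding Green
      proof (rule Henstock_Kurzweil_Integration.integral_cong)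
        fix p :: "'a \<times> 'b"
        show "Z (?q p) * G (fst p, snd p, 0) * (N p * cutoff p) = - a * (Z (?q p) * W i j p)"
        proof (cases "p \<in> pair_dom")
          case True
          have "Z (?q p) * G (fst p, snd p, 0) * (N p * cutoff p) =
            Z (?q p) * cutoff p * (N p * G (fst p, snd p, 0))" by (simp only: ac_simps)
          then show ?thesis unfolding G[OF True] by (simp add: W_def)
        qed (simp add: off)
      qed
      also have "\<dots> = - a * \<eta> u" using I0 by (intro integral_unique has_integral_mult_right)
      finally have val: "integral UNIV (\<lambda>p. F (?q p) * (N p * W i j p)) = - a * \<eta> u" .
      show ?thesis using integrable_integral[OF int] unfolding val .
    qed
    have Ix: "((\<lambda>p. laplace_x Z (?q p) * ((fst p \<bullet> fst p) * W i j p)) has_integral - ?a * \<eta> u) UNIV"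
      by (rule pairing[OF continuous_on_laplace(1) _ Green_slice(1)[OF homogeneous_axioms h\<Theta>] ls(1)])
         (auto intro!: continuous_intros)
    have Iy: "((\<lambda>p. laplace_y Z (?q p) * ((snd p \<bullet> snd p) * W i j p)) has_integral - ?b * \<eta> u) UNIV"
      by (rule pairing[OF continuous_on_laplace(2) _ Green_slice(2)[OF homogeneous_axioms h\<Theta>] ls(2)])
         (auto intro!: continuous_intros)
    \<comment> \<open>The eigenvalue equation at the projected point
      \<open>(sgn x, sgn y, u)\<close>, rewritten at \<open>(x, y, u)\<close> by
      \<open>laplace_scaling\<close> and multiplied by the weight. Integrating it term by term
      yields the ordinary equation for \<open>\<eta>\<close>.\<close>
    have zero: "1 / (f u)\<^sup>2 * (laplace_x Z (?q p) * ((fst p \<bullet> fst p) * W i j p)) + 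
        1 / (f2 u)\<^sup>2 * (laplace_y Z (?q p) * ((snd p \<bullet> snd p) * W i j p)) +
        1 / w2 u * (Zuu (?q p) * W i j p + ?C * (Zu (?q p) * W i j p)) +
        (V u + \<mu>) * (Z (?q p) * W i j p) = 0" for p
    proof (cases "p \<in> pair_dom")
      case False
      then show ?thesis using off by simp
    next
      case True
      obtain x y where p: "p = (x, y)" by (cases p)
      have xy: "x \<noteq> 0" "y \<noteq> 0" using True by (auto simp: p pair_dom_def)
      have s: "norm (sgn x) = 1" "norm (sgn y) = 1" using xy by (simp_all add: norm_sgn)
      have "laplacian M_dom (immersion f1 f2) \<zeta> (sgn x, sgn y, u) =
        ((x \<bullet> x) * laplace_x Z (x, y, u)) / (f u)\<^sup>2 + ((y \<bullet> y) * laplace_y Z (x, y, u)) / (f2 u)\<^sup>2 + 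
          radial_part k l f1 f2 (\<lambda>u. Z (x, y, u)) u"
        using laplacian_formula[OF s _ dim, of \<zeta> u] sphere_ext_M_dom[of _ \<zeta>]
        by (simp add: laplace_scaling[OF xy] Zsgn Z_def[symmetric])
      also have "radial_part k l f1 f2 (\<lambda>u. Z (x, y, u)) u = 1 / w2 u * 
         (Zuu (x, y, u) + ?C * Zu (x, y, u))"
        unfolding radial_part_def Let_def deriv_u[OF xy] ..
      finally have lap: "laplacian M_dom (immersion f1 f2) \<zeta> (sgn x, sgn y, u) =
        ((x \<bullet> x) * laplace_x Z (x, y, u)) / (f u)\<^sup>2 + ((y \<bullet> y) * laplace_y Z (x, y, u)) / (f2 u)\<^sup>2 + 1 / w2 u * 
         (Zuu (x, y, u) + ?C * Zu (x, y, u))" .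
      have "\<zeta> (sgn x, sgn y, u) = Z (x, y, u)" by (simp add: Z_def sphere_ext_def)
      then have "((x \<bullet> x) * laplace_x Z (x, y, u)) / (f u)\<^sup>2 + ((y \<bullet> y) * laplace_y Z (x, y, u)) / (f2 u)\<^sup>2 + 
          1 / w2 u * (Zuu (x, y, u) + ?C * Zu (x, y, u)) + (V u + \<mu>) * Z (x, y, u) = 0"
        using eq[of "(sgn x, sgn y, u)"] s unfolding lap by (simp add: M_dom_iff distrib_right)
      then have "(((x \<bullet> x) * laplace_x Z (x, y, u)) / (f u)\<^sup>2 + ((y \<bullet> y) * laplace_y Z (x, y, u)) / (f2 u)\<^sup>2 + 
          1 / w2 u * (Zuu (x, y, u) + ?C * Zu (x, y, u)) + (V u + \<mu>) * Z (x, y, u)) * W i j p = 0"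
        by simp
      \<comment> \<open>A regrouping identity over plain real variables, used to match the two forms
        of the equation without unfolding the derivatives.\<close>
      moreover have "1 / c1 * (l1 * (x1 * A)) + 1 / c2 * (l2 * (x2 * A)) + 1 / c3 * (z2 * A + C * (z1 * A)) + c4 * (z0 * A) =
          (x1 * l1 / c1 + x2 * l2 / c2 + 1 / c3 * (z2 + C * z1) + c4 * z0) * A" for c1 c2 c3 c4 l1 l2 x1 x2 z0 z1 z2 A C :: real
        by (simp add: algebra_simps add_divide_distrib)
      ultimately show ?thesis by (simp only: p fst_conv snd_conv)
    qed
    have "((\<lambda>p. 1 / (f u)\<^sup>2 * (laplace_x Z (?q p) * ((fst p \<bullet> fst p) * W i j p)) + 
        1 / (f2 u)\<^sup>2 * (laplace_y Z (?q p) * ((snd p \<bullet> snd p) * W i j p)) +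
        1 / w2 u * (Zuu (?q p) * W i j p + ?C * (Zu (?q p) * W i j p)) +
        (V u + \<mu>) * (Z (?q p) * W i j p)) has_integral 
        (1 / (f u)\<^sup>2 * (- ?a * \<eta> u) + 1 / (f2 u)\<^sup>2 * (- ?b * \<eta> u) + 1 / w2 u * (deriv (deriv \<eta>) u + ?C * deriv \<eta> u) +
         (V u + \<mu>) * \<eta> u)) UNIV"
      by (intro has_integral_add has_integral_mult_right Ix Iy I0 I1 I2)
    then have "((\<lambda>p :: 'a \<times> 'b. 0) has_integral 
        (1 / (f u)\<^sup>2 * (- ?a * \<eta> u) + 1 / (f2 u)\<^sup>2 * (- ?b * \<eta> u) + 1 / w2 u * (deriv (deriv \<eta>) u + ?C * deriv \<eta> u) +
         (V u + \<mu>) * \<eta> u)) UNIV"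
      unfolding zero .
    then have "1 / (f u)\<^sup>2 * (- ?a * \<eta> u) + 1 / (f2 u)\<^sup>2 * (- ?b * \<eta> u) + 1 / w2 u * (deriv (deriv \<eta>) u + ?C * deriv \<eta> u) +
         (V u + \<mu>) * \<eta> u = 0"
      by (rule has_integral_unique[OF _ has_integral_0])
    moreover have "separated_op k l f1 f2 V i j \<eta> u + \<mu> * \<eta> u = 
       1 / (f u)\<^sup>2 * (- ?a * \<eta> u) + 1 / (f2 u)\<^sup>2 * (- ?b * \<eta> u) + 1 / w2 u * (deriv (deriv \<eta>) u + ?C * deriv \<eta> u) +
         (V u + \<mu>) * \<eta> u"
      unfolding separated_op_def radial_part_def Let_def by (simp add: distrib_right)
    ultimately show ?thesis by simp
  qed
  ultimately have "\<mu> \<in> spectrum UNIV (periodic_functions T) (separated_op k l f1 f2 V i j)"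
    unfolding spectrum_def by blast
  then show ?thesis by blast
qed

lemma spectrum_cong:
  assumes "\<And>\<zeta> p. p \<in> N \<Longrightarrow> P \<zeta> p = P' \<zeta> p"
  shows "spectrum N D P = spectrum N D P'"
  unfolding spectrum_def using assms by simp

text \<open>The potential has to depend on \<open>u\<close> alone to commute with the pairing in the
  sphere variables. For the stability operator this is what \<open>sq_norm_A_formula\<close>
  guarantees.\<close>

lemma spectrum_separation:
  assumes "profile f1 f2" "k \<ge> 1" "l \<ge> 1" "DIM('a::euclidean_space) = k + 1" "DIM('b::euclidean_space) = l + 1"
  shows "spectrum (M_dom :: ('a \<times> 'b \<times> real) set) (M_functions T)
       (\<lambda>\<zeta> p. laplacian M_dom (immersion f1 f2) \<zeta> p + V (snd (snd p)) * \<zeta> p) =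
     (\<Union>i. \<Union>j. spectrum UNIV (periodic_functions T) (separated_op k l f1 f2 V i j))"
    (is "?L = ?R")
proof (rule set_eqI, rule iffI)
  fix \<mu>
  show "\<mu> \<in> ?R" if "\<mu> \<in> ?L" using exists_separated_eigenfunction[OF assms that] by simp
  assume "\<mu> \<in> ?R"
  then obtain i j where "\<mu> \<in> spectrum UNIV (periodic_functions T) (separated_op k l f1 f2 V i j)" by auto
  then show "\<mu> \<in> ?L" by (rule eigenfunction_of_separated[OF assms])
qed

theorem theorem4p2:
  fixes k l :: nat
    and f1 f2 :: "real \<Rightarrow> real"
    and T :: real
    and \<phi> :: "'a::euclidean_space \<times> 'b::euclidean_space \<times> real \<Rightarrow> 'a \<times> 'b \<times> real"
  assumes "k \<ge> 1" and "l \<ge> 1"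
    and "DIM('a) = k + 1" and "DIM('b) = l + 1"
    and "T > 0"
    and "smooth_on UNIV f1" and "smooth_on UNIV f2"
    and "\<And>u. f1 (u + T) = f1 u" and "\<And>u. f2 (u + T) = f2 u"
    and "\<And>u. (deriv f1 u)\<^sup>2 + (deriv f2 u)\<^sup>2 = 1"
    and "\<And>u. f2 u > 0"
    and "\<And>u. (f1 u)\<^sup>2 + (f2 u)\<^sup>2 < 1"
    and "\<phi> = immersion f1 f2"
  shows "spectrum M_dom (M_functions T) (laplacian M_dom \<phi>) =
           (\<Union>i. \<Union>j. spectrum UNIV (periodic_functions T) (L_op k l f1 f2 i j))
       \<and> spectrum M_dom (M_functions T) (stability_operator k l \<phi>) =
           (\<Union>i. \<Union>j. spectrum UNIV (periodic_functions T) (S_op k l f1 f2 i j))"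
proof -
  have pr: "profile f1 f2"
    using assms by unfold_locales (auto simp: smooth_on_UNIV)
  note sep = spectrum_separation[OF pr assms(1-4), of T]
  \<comment> \<open>The zeroth order term n + |A|^2 of the stability operator, as a function of
    \<open>u\<close> alone.\<close>
  define V where "V u = real k + real l + 1 + (real k * (lambda_a f1 f2 u)\<^sup>2 + real l * (lambda_b f1 f2 u)\<^sup>2 + (lambda_c f1 f2 u)\<^sup>2)" for u
  have "spectrum M_dom (M_functions T) (laplacian M_dom \<phi>) =
    spectrum M_dom (M_functions T) (\<lambda>\<zeta> p. laplacian M_dom \<phi> \<zeta> p + 0 * \<zeta> p)"
    by (rule spectrum_cong) simp
  also have "\<dots> = (\<Union>i. \<Union>j. spectrum UNIV (periodic_functions T) (separated_op k l f1 f2 (\<lambda>_. 0) i j))"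
    using sep[of "\<lambda>_. 0"] unfolding assms(13) .
  also have "separated_op k l f1 f2 (\<lambda>_. 0) = L_op k l f1 f2"
    by (intro ext) (simp add: separated_op_def L_op_def)
  finally have 1: "spectrum M_dom (M_functions T) (laplacian M_dom \<phi>) =
           (\<Union>i. \<Union>j. spectrum UNIV (periodic_functions T) (L_op k l f1 f2 i j))" .
  have "spectrum M_dom (M_functions T) (stability_operator k l \<phi>) =
    spectrum M_dom (M_functions T) (\<lambda>\<zeta> p. laplacian M_dom \<phi> \<zeta> p + V (snd (snd p)) * \<zeta> p)"
  proof (rule spectrum_cong)
    fix \<zeta> and p :: "'a \<times> 'b \<times> real" assume "p \<in> M_dom"
    moreover obtain y z u where "p = (y, z, u)" by (cases p)
    ultimately have "sq_norm_A M_dom \<phi> p = 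
      real k * (lambda_a f1 f2 u)\<^sup>2 + real l * (lambda_b f1 f2 u)\<^sup>2 + (lambda_c f1 f2 u)\<^sup>2"
      using profile.sq_norm_A_formula[OF pr _ _ assms(3,4,1,2)] by (simp add: M_dom_iff assms(13))
    then show "stability_operator k l \<phi> \<zeta> p = laplacian M_dom \<phi> \<zeta> p + V (snd (snd p)) * \<zeta> p"
      using \<open>p = (y, z, u)\<close> by (simp add: stability_operator_def V_def)
  qed
  also have "\<dots> = (\<Union>i. \<Union>j. spectrum UNIV (periodic_functions T) (separated_op k l f1 f2 V i j))"
    using sep[of V] unfolding assms(13) .
  also have "separated_op k l f1 f2 V = S_op k l f1 f2"
    by (intro ext) (simp add: separated_op_def S_op_def V_def algebra_simps)
  finally have "spectrum M_dom (M_functions T) (stability_operator k l \<phi>) =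
           (\<Union>i. \<Union>j. spectrum UNIV (periodic_functions T) (S_op k l f1 f2 i j))" .
  with 1 show ?thesis by blast
qed

end
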